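(* Let $p$ be an odd prime and $L/\mathbb Q$ a cyclic extension of degree $p$ with Galois group $G=\langle\sigma\rangle$ and conductor $\mathfrak f$. Let $\mathcal A_{L/\mathbb Q}=\{x\in\mathbb Q[G] : x\mathcal O_L\subset\mathcal O_L\}$ be the associated order, and let $\zeta_p=e^{2\pi i/p}$. (1) If $p\nmid\mathfrak f$, then there is a group isomorphism $\mathcal A_{L/\mathbb Q}^\times \xrightarrow{\sim} U_p$ with $\sigma\mapsto\zeta_p$. (2) If $p\mid\mathfrak f$, then there is an exact sequence of abelian groups $1\to\{1,\,1-2\mathbf e_{\mathbf 1}\}\to\mathcal A_{L/\mathbb Q}^\times\xrightarrow{\psi}\mathbb Z[\zeta_p]^\times\to 1,$ where $\psi$ is induced by the $\mathbb Q$-algebra homomorphism $\mathbb Q[G]\to\mathbb Q(\zeta_p)$, $\sigma\mapsto\zeta_p$, and $\mathbf e_{\mathbf 1}=\frac1p\sum_{i=0}^{p-1}\sigma^i$.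
   Context: $\mathcal O_L$ is the ring of integers of $L$. $U_p=\{u\in\mathbb Z[\zeta_p]^\times : u\equiv \pm1 \pmod{(1-\zeta_p)}\}$. $\mathbf e_{\mathbf 1}$ is the idempotent of $\mathbb Q[G]$ attached to the trivial character. *)

theory Defs
  imports
    Complex_Main
    "HOL-Computational_Algebra.Computational_Algebra"
    "HOL-Algebra.Bij"
    "HOL-Algebra.Embedded_Algebras"
    "HOL-Algebra.Generated_Fields"
begin

section \<open>Subfields of a field of characteristic zero\<close>

definition field_alg :: "(rat, 'a::field_char_0) module" where
  "field_alg = \<lparr>carrier = UNIV, mult = (*), one = 1, zero = 0, add = (+),
     smult = (\<lambda>q x. of_rat q * x)\<rparr>"

abbreviation sub_alg :: "'a::field_char_0 set \<Rightarrow> (rat, 'a) module" where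
  "sub_alg K \<equiv> field_alg\<lparr>carrier := K\<rparr>"

definition ring_of_integers :: "'a::field_char_0 set \<Rightarrow> 'a set" where
  "ring_of_integers L = {a \<in> L. algebraic_int a}"

text \<open>Elements of the Galois group are extensional functions on \<open>L\<close>
  (\<^const>\<open>undefined\<close> outside), as in \<^const>\<open>BijGroup\<close>.\<close>

definition galois_group :: "'a::field_char_0 set \<Rightarrow> 'a set \<Rightarrow> ('a \<Rightarrow> 'a) monoid" where
  "galois_group K L = (BijGroup L)\<lparr>carrier :=
     {g \<in> Bij L. g \<in> ring_iso (sub_alg L) (sub_alg L) \<and> (\<forall>x\<in>K. g x = x)}\<rparr>"

definition galois_extension :: "'a::field_char_0 set \<Rightarrow> 'a set \<Rightarrow> nat \<Rightarrow> bool" where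
  "galois_extension K L n \<longleftrightarrow>
     subfield K field_alg \<and> subfield L field_alg \<and> K \<subseteq> L \<and>
     ring.dimension field_alg n K L \<and>
     {x \<in> L. \<forall>g \<in> carrier (galois_group K L). g x = x} = K"

section \<open>Cyclotomic numbers\<close>

definition zeta :: "nat \<Rightarrow> complex" where
  "zeta n = exp (2 * of_real pi * \<i> / of_nat n)"

definition cyclotomic_field :: "nat \<Rightarrow> complex set" where
  "cyclotomic_field n = generate_field field_alg {zeta n}"

definition cyclotomic_integers :: "nat \<Rightarrow> complex set" where
  "cyclotomic_integers n = generate_ring field_alg {zeta n}"

definition cyclotomic_units :: "nat \<Rightarrow> complex monoid" where
  "cyclotomic_units n = units_of (sub_alg (cyclotomic_integers n))"

text \<open>The group \<open>U\<^sub>p\<close> of units that are \<open>\<plusminus>1\<close> modulo \<open>1 - \<zeta>\<^sub>p\<close>;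
  the congruence is taken in \<open>\<int>[\<zeta>\<^sub>p]\<close>.\<close>

definition U_group :: "nat \<Rightarrow> complex monoid" where
  "U_group p = (cyclotomic_units p)\<lparr>carrier :=
     {u \<in> carrier (cyclotomic_units p).
        \<exists>s\<in>{1, -1}. \<exists>c \<in> cyclotomic_integers p. u - s = (1 - zeta p) * c}\<rparr>"

text \<open>The conductor of an abelian extension \<open>L/\<rat>\<close> is the least \<open>f \<ge> 1\<close> such that \<open>L\<close>
  embeds into the \<open>f\<close>-th cyclotomic field.  It is a predicate rather than a
  \<open>LEAST\<close> term, so that no junk value arises from a missing embedding.  Ring
  homomorphisms between fields are injective, so every element of the
  \<^const>\<open>ring_hom\<close> below is an embedding.\<close>

definition embeds_cyclotomic :: "'a::field_char_0 set \<Rightarrow> nat \<Rightarrow> bool" where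
  "embeds_cyclotomic L n \<longleftrightarrow> ring_hom (sub_alg L) (sub_alg (cyclotomic_field n)) \<noteq> {}"

definition is_conductor :: "'a::field_char_0 set \<Rightarrow> nat \<Rightarrow> bool" where
  "is_conductor L f \<longleftrightarrow> f > 0 \<and> embeds_cyclotomic L f \<and>
     (\<forall>n>0. embeds_cyclotomic L n \<longrightarrow> f \<le> n)"

section \<open>Rational group algebras\<close>

text \<open>\<open>\<rat>[G]\<close> for a finite group \<open>G\<close>: the element \<open>\<Sum>g\<in>G. x\<^sub>g g\<close> is its coefficient function,
  extended by zero outside \<^term>\<open>carrier G\<close>; multiplication is convolution.\<close>

definition group_alg :: "('g, 'b) monoid_scheme \<Rightarrow> (rat, 'g \<Rightarrow> rat) module" where
  "group_alg G =
     \<lparr>carrier = {x. \<forall>g. g \<notin> carrier G \<longrightarrow> x g = 0},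
      mult = (\<lambda>x y g. if g \<in> carrier G
                then \<Sum>h\<in>carrier G. x h * y (inv\<^bsub>G\<^esub> h \<otimes>\<^bsub>G\<^esub> g) else 0),
      one = (\<lambda>g. if g = \<one>\<^bsub>G\<^esub> then 1 else 0),
      zero = (\<lambda>g. 0),
      add = (\<lambda>x y g. x g + y g),
      smult = (\<lambda>q x g. q * x g)\<rparr>"

definition group_elt :: "'g \<Rightarrow> 'g \<Rightarrow> rat" where
  "group_elt g = (\<lambda>h. if h = g then 1 else 0)"

definition rat_alg_hom ::
    "(rat, 'a, 'm) module_scheme \<Rightarrow> (rat, 'b, 'n) module_scheme \<Rightarrow> ('a \<Rightarrow> 'b) set" where
  "rat_alg_hom A B = {h \<in> ring_hom A B.
     \<forall>q. \<forall>x\<in>carrier A. h (q \<odot>\<^bsub>A\<^esub> x) = q \<odot>\<^bsub>B\<^esub> h x}"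

section \<open>The associated order\<close>

abbreviation QG :: "'a::field_char_0 set \<Rightarrow> (rat, ('a \<Rightarrow> 'a) \<Rightarrow> rat) module" where
  "QG L \<equiv> group_alg (galois_group \<rat> L)"

definition galois_action :: "'a::field_char_0 set \<Rightarrow> (('a \<Rightarrow> 'a) \<Rightarrow> rat) \<Rightarrow> 'a \<Rightarrow> 'a" where
  "galois_action L x a = (\<Sum>g\<in>carrier (galois_group \<rat> L). of_rat (x g) * g a)"

definition associated_order :: "'a::field_char_0 set \<Rightarrow> (('a \<Rightarrow> 'a) \<Rightarrow> rat) set" where
  "associated_order L = {x \<in> carrier (QG L).
     galois_action L x ` ring_of_integers L \<subseteq> ring_of_integers L}"

definition associated_order_units :: "'a::field_char_0 set \<Rightarrow> (('a \<Rightarrow> 'a) \<Rightarrow> rat) monoid" where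
  "associated_order_units L = units_of ((QG L)\<lparr>carrier := associated_order L\<rparr>)"

definition trivial_idempotent ::
    "'a::field_char_0 set \<Rightarrow> ('a \<Rightarrow> 'a) \<Rightarrow> nat \<Rightarrow> ('a \<Rightarrow> 'a) \<Rightarrow> rat" where
  "trivial_idempotent L \<sigma> p =
     (1 / of_nat p) \<odot>\<^bsub>QG L\<^esub> (\<Oplus>\<^bsub>QG L\<^esub> i\<in>{..<p}. group_elt \<sigma> [^]\<^bsub>QG L\<^esub> i)"

section \<open>Exact sequences of abelian groups\<close>

text \<open>Exactness of \<open>1 \<rightarrow> A \<rightarrow> B \<rightarrow> C \<rightarrow> 1\<close>.  The library's \<open>short_exact_sequence\<close> requires all
  groups to live on one type.\<close>

definition exact_abelian ::
    "('a, 'm) monoid_scheme \<Rightarrow> ('b, 'n) monoid_scheme \<Rightarrow> ('c, 'k) monoid_scheme \<Rightarrow>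
     ('a \<Rightarrow> 'b) \<Rightarrow> ('b \<Rightarrow> 'c) \<Rightarrow> bool" where
  "exact_abelian A B C f g \<longleftrightarrow> comm_group A \<and> comm_group B \<and> comm_group C \<and>
     f \<in> mon A B \<and> g \<in> epi B C \<and> kernel B C g = f ` carrier A"

end

theory Submission
  imports Defs "Jordan_Normal_Form.Char_Poly" "HOL-Number_Theory.Residues"
begin

text \<open>Let \<open>\<epsilon>\<close> and \<open>\<psi>\<close> send \<open>\<sigma>\<close> to \<open>1\<close> and to \<open>\<zeta>\<^sub>p\<close>; together they embed \<open>\<rat>[G]\<close> into \<open>\<rat> \<times> \<rat>(\<zeta>\<^sub>p)\<close>,
  and the associated order \<open>A\<close> lies between \<open>\<int>[G]\<close> and the preimage \<open>M\<close> of \<open>\<int> \<times> \<int>[\<zeta>\<^sub>p]\<close>.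
  Since \<open>\<int>[G]\<close> has prime index in \<open>M\<close> and \<open>p \<cdot> e\<^sub>1\<close> acts as the trace, \<open>A = M\<close> if \<open>p\<close> divides the
  trace of every integer of \<open>L\<close>, and \<open>A = \<int>[G]\<close> otherwise; the units of either order are
  read off from their coordinates.

  It remains to see that all traces are divisible by \<open>p\<close> if and only if \<open>p\<close> divides the conductor
  \<open>f\<close>. Embed \<open>L\<close> into \<open>\<rat>(\<zeta>\<^sub>f)\<close>, whose integers form \<open>S = \<int>[\<zeta>\<^sub>f]\<close>. If \<open>f = p\<^sup>k m\<close> with \<open>k > 0\<close> and
  \<open>p\<close> not dividing \<open>m\<close>, minimality of \<open>f\<close> yields an automorphism over \<open>\<rat>(\<zeta>\<^sub>m)\<close> that moves \<open>L\<close>; it is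
  the identity modulo \<open>1 - \<zeta>\<close>, where \<open>\<zeta>\<close> has order \<open>p\<^sup>k\<close>, so traces are congruent to
  \<open>p y \<equiv> 0\<close>. Conversely, Fourier inversion writes \<open>f\<close> as an \<open>S\<close>-linear combination of traces.\<close>

text \<open>Prime ideals never appear. For each prime l an element d of S is exhibited such that
  some power of d lies in l S and \<open>x ^ q\<close> is congruent to x modulo d for all x in S.
  The second property makes S/dS reduced, which is what the proof that Z[zeta_f] is integrally
  closed rests on; the first turns congruences modulo d between rational integers into congruences
  modulo l. Integral closedness serves to recognise the integers of L inside S and, over Q(zeta_pf),
  to show that \<psi> maps the associated order into Z[zeta_p]: there a Lagrange resolvent supplies
  one denominator for all powers of \<open>\<psi> x\<close>. Two facts about Q[G] carry the rest.
  The kernel of \<psi> is spanned by the sum of all group elements, by irreducibility of the p-th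
  cyclotomic polynomial, so \<open>\<psi> x\<close> determines x up to a multiple of the trace
  element. In Z[G] the coordinates are tied by \<open>\<psi> x\<close> being congruent to
  \<open>\<epsilon> x\<close> modulo 1 - zeta_p; this is the origin of the condition defining U_p,
  and p being odd keeps the signs 1 and -1 apart.\<close>

hide_const (open) up_ring.coeff up_ring.monom module.smult Coset.order

section \<open>Subrings, subfields and polynomials over them\<close>

text \<open>Subrings and subfields are plain sets inside a field type, so that type-class arithmetic
  applies directly; \<open>subfield_field_alg_iff\<close> links them to the record-based notions of
  the theorem.\<close>

definition sring :: "'a::field set \<Rightarrow> bool" where
  "sring R \<longleftrightarrow> 1 \<in> R \<and> (\<forall>x\<in>R. \<forall>y\<in>R. x - y \<in> R \<and> x * y \<in> R)"

definition sfield :: "'a::field set \<Rightarrow> bool" where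
  "sfield F \<longleftrightarrow> sring F \<and> (\<forall>x\<in>F. inverse x \<in> F)"

lemma sring_1: "sring R \<Longrightarrow> 1 \<in> R"
  and sring_diff: "sring R \<Longrightarrow> x \<in> R \<Longrightarrow> y \<in> R \<Longrightarrow> x - y \<in> R"
  and sring_mult: "sring R \<Longrightarrow> x \<in> R \<Longrightarrow> y \<in> R \<Longrightarrow> x * y \<in> R"
  by (auto simp: sring_def)

lemma sring_0: "sring R \<Longrightarrow> 0 \<in> R"
  using sring_diff[of R 1 1] sring_1[of R] by simp

lemma sring_uminus: "sring R \<Longrightarrow> x \<in> R \<Longrightarrow> - x \<in> R"
  using sring_diff[of R 0 x] sring_0[of R] by simp

lemma sring_add: "sring R \<Longrightarrow> x \<in> R \<Longrightarrow> y \<in> R \<Longrightarrow> x + y \<in> R"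
  using sring_diff[of R x "- y"] sring_uminus[of R y] by simp

lemma sring_power: "sring R \<Longrightarrow> x \<in> R \<Longrightarrow> x ^ n \<in> R"
  by (induction n) (auto intro: sring_1 sring_mult)

lemma sring_sum: "sring R \<Longrightarrow> (\<And>i. i \<in> I \<Longrightarrow> u i \<in> R) \<Longrightarrow> sum u I \<in> R"
  by (induction I rule: infinite_finite_induct) (auto intro: sring_0 sring_add)

lemma sring_of_nat: "sring R \<Longrightarrow> of_nat n \<in> R"
  by (induction n) (auto intro: sring_0 sring_1 sring_add)

lemma sring_of_int: "sring R \<Longrightarrow> of_int n \<in> R"
  by (cases n) (auto intro: sring_of_nat sring_diff sring_uminus simp del: of_nat_Suc)

lemmas sring_intros = sring_0 sring_1 sring_diff sring_mult sring_uminus sring_add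
  sring_power sring_sum sring_of_nat sring_of_int

lemma sfield_sring: "sfield F \<Longrightarrow> sring F"
  and sfield_inverse: "sfield F \<Longrightarrow> x \<in> F \<Longrightarrow> inverse x \<in> F"
  by (auto simp: sfield_def)

lemma sfield_divide: "sfield F \<Longrightarrow> x \<in> F \<Longrightarrow> y \<in> F \<Longrightarrow> x / y \<in> F"
  by (simp add: divide_inverse sring_mult sfield_sring sfield_inverse)

lemma sring_Ints: "sring \<int>"
  by (auto simp: sring_def)

lemma sfield_Rats: "sfield (\<rat> :: 'a::field_char_0 set)"
  by (auto simp: sfield_def sring_def)

lemma Ints_subset_sring: "sring R \<Longrightarrow> \<int> \<subseteq> R"
  by (auto elim!: Ints_cases intro: sring_of_int)

lemma Rats_subset_sfield:
  fixes F :: "'a::field_char_0 set"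
  shows "sfield F \<Longrightarrow> \<rat> \<subseteq> F"
  by (auto elim!: Rats_cases' intro: sfield_divide sring_of_int dest: sfield_sring)

section \<open>Polynomials with coefficients in a subring; minimal polynomials and simple
  extensions\<close>

definition poly_over :: "'a::comm_ring_1 set \<Rightarrow> 'a poly set" where
  "poly_over R = {g. \<forall>i. coeff g i \<in> R}"

definition adjoin :: "'a::comm_ring_1 set \<Rightarrow> 'a \<Rightarrow> 'a set" where
  "adjoin R x = (\<lambda>g. poly g x) ` poly_over R"

lemma poly_over_mono: "R \<subseteq> T \<Longrightarrow> poly_over R \<subseteq> poly_over T"
  by (auto simp: poly_over_def)

lemma poly_over_pCons:
  "sring R \<Longrightarrow> pCons a g \<in> poly_over R \<longleftrightarrow> a \<in> R \<and> g \<in> poly_over R"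
  by (auto simp: poly_over_def coeff_pCons split: nat.splits)

lemma poly_over_0: "sring R \<Longrightarrow> 0 \<in> poly_over R"
  by (auto simp: poly_over_def intro: sring_0)

lemma poly_over_const: "sring R \<Longrightarrow> c \<in> R \<Longrightarrow> [:c:] \<in> poly_over R"
  by (auto simp: poly_over_pCons poly_over_0)

lemma poly_over_1: "sring R \<Longrightarrow> 1 \<in> poly_over R"
  by (auto simp: one_pCons intro: poly_over_const sring_1)

lemma poly_over_add: "sring R \<Longrightarrow> g \<in> poly_over R \<Longrightarrow> h \<in> poly_over R \<Longrightarrow> g + h \<in> poly_over R"
  and poly_over_diff: "sring R \<Longrightarrow> g \<in> poly_over R \<Longrightarrow> h \<in> poly_over R \<Longrightarrow> g - h \<in> poly_over R"
  and poly_over_uminus: "sring R \<Longrightarrow> g \<in> poly_over R \<Longrightarrow> - g \<in> poly_over R"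
  and poly_over_smult: "sring R \<Longrightarrow> c \<in> R \<Longrightarrow> g \<in> poly_over R \<Longrightarrow> smult c g \<in> poly_over R"
  and poly_over_mult: "sring R \<Longrightarrow> g \<in> poly_over R \<Longrightarrow> h \<in> poly_over R \<Longrightarrow> g * h \<in> poly_over R"
  by (auto simp: poly_over_def coeff_mult intro!: sring_intros)

lemma poly_over_monom: "sring R \<Longrightarrow> c \<in> R \<Longrightarrow> monom c n \<in> poly_over R"
  by (auto simp: poly_over_def intro: sring_0)

lemma poly_over_pcompose:
  "sring R \<Longrightarrow> g \<in> poly_over R \<Longrightarrow> h \<in> poly_over R \<Longrightarrow> pcompose g h \<in> poly_over R"
  by (induction g)
    (auto simp: pcompose_pCons poly_over_pCons poly_over_0 intro!: poly_over_add poly_over_mult)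

lemmas poly_over_intros = poly_over_0 poly_over_1 poly_over_const poly_over_add poly_over_diff
  poly_over_uminus poly_over_smult poly_over_mult poly_over_monom poly_over_pcompose

lemma poly_in_sring: "sring R \<Longrightarrow> g \<in> poly_over R \<Longrightarrow> x \<in> R \<Longrightarrow> poly g x \<in> R"
  by (induction g) (auto simp: poly_over_pCons intro!: sring_intros)

lemma adjoinI: "g \<in> poly_over R \<Longrightarrow> poly g x \<in> adjoin R x"
  by (auto simp: adjoin_def)

lemma adjoin_mono: "R \<subseteq> T \<Longrightarrow> adjoin R x \<subseteq> adjoin T x"
  using poly_over_mono[of R T] by (auto simp: adjoin_def)

lemma sring_adjoin:
  assumes "sring R"
  shows "sring (adjoin R x)"
  unfolding sring_def
proof (intro conjI ballI)
  show "1 \<in> adjoin R x" using adjoinI[OF poly_over_1[OF assms], of x] by simp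
next
  fix y z assume "y \<in> adjoin R x" "z \<in> adjoin R x"
  then obtain g h where "g \<in> poly_over R" "h \<in> poly_over R" "y = poly g x" "z = poly h x"
    by (auto simp: adjoin_def)
  then show "y - z \<in> adjoin R x" "y * z \<in> adjoin R x"
    using adjoinI[OF poly_over_diff[OF assms], of g h x] adjoinI[OF poly_over_mult[OF assms], of g h x]
    by auto
qed

lemma in_adjoin_self: "sring R \<Longrightarrow> x \<in> adjoin R x"
  using adjoinI[OF poly_over_monom[of R 1 1], of x] by (simp add: poly_monom sring_1)

lemma adjoin_least:
  assumes "sring T" "R \<subseteq> T" "x \<in> T"
  shows "adjoin R x \<subseteq> T"
proof
  fix y assume "y \<in> adjoin R x"
  then obtain g where "g \<in> poly_over R" "y = poly g x" by (auto simp: adjoin_def)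
  then show "y \<in> T" using poly_in_sring[OF assms(1)] poly_over_mono[OF assms(2)] assms(3) by auto
qed

text \<open>Long division by leading terms, carried out by hand because quotient and remainder must
  keep their coefficients in the subset F.\<close>

lemma poly_over_division:
  assumes F: "sfield F" and g: "g \<in> poly_over F" and h: "h \<in> poly_over F" "h \<noteq> 0"
  shows "\<exists>q\<in>poly_over F. \<exists>r\<in>poly_over F. g = q * h + r \<and> (r = 0 \<or> degree r < degree h)"
  using g
proof (induction "degree g" arbitrary: g rule: less_induct)
  case less
  note R = sfield_sring[OF F]
  show ?case
  proof (cases "g = 0 \<or> degree g < degree h")
    case True
    then show ?thesis using less.prems poly_over_0[OF R] by (intro bexI[of _ 0] bexI[of _ g]) auto
  next
    case False
    define c where "c = monom (lead_coeff g / lead_coeff h) (degree g - degree h)"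
    define g' where "g' = g - c * h"
    have c: "c \<in> poly_over F"
      unfolding c_def using less.prems h
      by (intro poly_over_monom R sfield_divide F) (auto simp: poly_over_def)
    have g'F: "g' \<in> poly_over F"
      unfolding g'_def using c less.prems h R by (auto intro!: poly_over_intros)
    have cz: "lead_coeff g / lead_coeff h \<noteq> 0" using False h by auto
    have "degree c = degree g - degree h" unfolding c_def by (rule degree_monom_eq[OF cz])
    moreover have "c \<noteq> 0" using cz by (simp add: c_def monom_eq_0_iff)
    ultimately have dc: "degree (c * h) = degree g"
      using False h(2) by (subst degree_mult_eq) auto
    have lc: "lead_coeff (c * h) = lead_coeff g"
      using h(2) \<open>degree c = _\<close> by (simp only: lead_coeff_mult) (simp add: c_def)
    show ?thesis
    proof (cases "g' = 0")
      case True
      then show ?thesis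
        using c poly_over_0[OF R] by (intro bexI[of _ c] bexI[of _ 0]) (auto simp: g'_def)
    next
      case g'0: False
      have "degree g' < degree g"
      proof -
        have "degree g' \<le> degree g" unfolding g'_def using dc by (intro degree_diff_le) auto
        moreover have "coeff g' (degree g) = 0" unfolding g'_def using lc dc by simp
        ultimately show ?thesis using g'0
          by (metis le_neq_implies_less leading_coeff_0_iff)
      qed
      from less.hyps[OF this g'F] obtain q r where qr: "q \<in> poly_over F" "r \<in> poly_over F"
        "g' = q * h + r" "r = 0 \<or> degree r < degree h" by auto
      have "g = (c + q) * h + r" using qr(3) by (auto simp: g'_def algebra_simps)
      then show ?thesis using qr c R by (intro bexI[of _ "c + q"] bexI[of _ r]) (auto intro: poly_over_intros)
    qed
  qed
qed

text \<open>The last conjunct states that h generates the ideal of polynomials over F vanishing at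
  x; it takes the place of irreducibility.\<close>

definition is_min_poly :: "'a::field set \<Rightarrow> 'a \<Rightarrow> 'a poly \<Rightarrow> bool" where
  "is_min_poly F x h \<longleftrightarrow> h \<in> poly_over F \<and> lead_coeff h = 1 \<and> poly h x = 0 \<and>
     (\<forall>g\<in>poly_over F. poly g x = 0 \<longrightarrow> (\<exists>q\<in>poly_over F. g = q * h))"

lemma min_poly_exists:
  assumes F: "sfield F" and g: "g \<in> poly_over F" "g \<noteq> 0" "poly g x = 0"
  shows "\<exists>h. is_min_poly F x h"
proof -
  note R = sfield_sring[OF F]
  define P where "P = (\<lambda>n. \<exists>g\<in>poly_over F. g \<noteq> 0 \<and> poly g x = 0 \<and> degree g = n)"
  have "P (degree g)" using g by (auto simp: P_def)
  then have "P (LEAST n. P n)" by (rule LeastI)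
  then obtain h0 where h0: "h0 \<in> poly_over F" "h0 \<noteq> 0" "poly h0 x = 0" "degree h0 = (LEAST n. P n)"
    by (auto simp: P_def)
  define h where "h = smult (inverse (lead_coeff h0)) h0"
  have "lead_coeff h0 \<in> F" using h0(1) by (auto simp: poly_over_def)
  then have h: "h \<in> poly_over F" "lead_coeff h = 1" "poly h x = 0"
    using h0(1-3) by (auto simp: h_def intro!: poly_over_smult R sfield_inverse F)
  have "degree h = degree h0" using h0(2) by (simp add: h_def)
  then have hdeg: "degree h = (LEAST n. P n)" using h0(4) by simp
  have "\<exists>q\<in>poly_over F. u = q * h" if u: "u \<in> poly_over F" "poly u x = 0" for u
  proof -
    have "h \<noteq> 0" using h(2) by auto
    from poly_over_division[OF F u(1) h(1) this] obtain q r where qr: "q \<in> poly_over F"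
      "r \<in> poly_over F" "u = q * h + r" "r = 0 \<or> degree r < degree h" by auto
    have "poly r x = 0" using qr(3) u(2) h(3) by simp
    have "r = 0"
    proof (rule ccontr)
      assume "r \<noteq> 0"
      then have "P (degree r)" using qr \<open>poly r x = 0\<close> by (auto simp: P_def)
      then have "(LEAST n. P n) \<le> degree r" by (rule Least_le)
      then show False using qr(4) \<open>r \<noteq> 0\<close> hdeg by auto
    qed
    then show ?thesis using qr by auto
  qed
  then show ?thesis using h by (auto simp: is_min_poly_def)
qed

lemma min_poly_degree_le:
  assumes "is_min_poly F x h" "g \<in> poly_over F" "g \<noteq> 0" "poly g x = 0"
  shows "degree h \<le> degree g"
proof -
  obtain q where "g = q * h" using assms by (auto simp: is_min_poly_def)
  moreover from this have "q \<noteq> 0" "h \<noteq> 0" using assms by auto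
  ultimately show ?thesis by (simp add: degree_mult_eq)
qed

lemma min_poly_degree_pos:
  assumes "is_min_poly F x h"
  shows "degree h > 0"
proof (rule ccontr)
  assume "\<not> degree h > 0"
  then obtain c where c: "h = [:c:]" by (metis degree_eq_zeroE gr0I)
  then show False using assms by (auto simp: is_min_poly_def)
qed

lemma adjoin_min_poly_rep:
  assumes F: "sfield F" and h: "is_min_poly F x h" and y: "y \<in> adjoin F x"
  shows "\<exists>g\<in>poly_over F. y = poly g x \<and> degree g < degree h"
proof -
  obtain u where u: "u \<in> poly_over F" "y = poly u x" using y by (auto simp: adjoin_def)
  have "h \<in> poly_over F" "h \<noteq> 0" "poly h x = 0" using h by (auto simp: is_min_poly_def)
  with poly_over_division[OF F u(1)] obtain q r where qr: "q \<in> poly_over F"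
      "r \<in> poly_over F" "u = q * h + r" "r = 0 \<or> degree r < degree h" by blast
  then show ?thesis using u \<open>poly h x = 0\<close> min_poly_degree_pos[OF h] by (intro bexI[of _ r]) auto
qed

text \<open>Euclidean descent on the degree of g: dividing h by g leaves r with r(x) = - q(x) g(x).
  This is nonzero because q has smaller degree than h, so an inverse of r(x) times - q(x) inverts
  g(x).\<close>

lemma adjoin_inverse_aux:
  assumes F: "sfield F" and h: "is_min_poly F x h"
    and g: "g \<in> poly_over F" "poly g x \<noteq> 0" "degree g < degree h"
  shows "\<exists>v\<in>poly_over F. poly v x * poly g x = 1"
  using g
proof (induction "degree g" arbitrary: g rule: less_induct)
  case less
  note R = sfield_sring[OF F]
  have hF: "h \<in> poly_over F" "h \<noteq> 0" "poly h x = 0" using h by (auto simp: is_min_poly_def)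
  show ?case
  proof (cases "degree g = 0")
    case True
    then obtain c where c: "g = [:c:]" by (metis degree_eq_zeroE)
    then have "c \<noteq> 0" "c \<in> F" using less.prems by (auto simp: poly_over_pCons[OF R])
    then show ?thesis
      using c F R by (intro bexI[of _ "[:inverse c:]"] poly_over_const sfield_inverse) auto
  next
    case False
    have "g \<noteq> 0" using less.prems by auto
    from poly_over_division[OF F hF(1) less.prems(1) this] obtain q r where qr: "q \<in> poly_over F"
      "r \<in> poly_over F" "h = q * g + r" "r = 0 \<or> degree r < degree g" by auto
    have e: "poly q x * poly g x + poly r x = 0" using qr(3) hF(3) by auto
    have r0: "poly r x \<noteq> 0"
    proof
      assume "poly r x = 0"
      then have "poly q x = 0" using e less.prems by auto
      have "q \<noteq> 0" using qr less.prems(3) False hF(2) by auto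
      then have "degree h \<le> degree q" using min_poly_degree_le[OF h qr(1)] \<open>poly q x = 0\<close> by auto
      moreover have "degree h = degree q + degree g"
        using qr \<open>q \<noteq> 0\<close> \<open>g \<noteq> 0\<close> False
        by (metis add.right_neutral degree_add_eq_left degree_mult_eq trans_less_add2)
      ultimately show False using False by auto
    qed
    then have "degree r < degree g" using qr(4) by auto
    from less.hyps[OF this qr(2) r0] this less.prems obtain v where
      v: "v \<in> poly_over F" "poly v x * poly r x = 1" by auto
    have "poly (- (v * q)) x * poly g x = 1"
      using v(2) e by (simp add: mult.assoc add_eq_0_iff)
    then show ?thesis using v(1) qr(1) R by (intro bexI[of _ "- (v * q)"]) (auto intro: poly_over_intros)
  qed
qed

lemma adjoin_inverse:
  assumes F: "sfield F" and h: "is_min_poly F x h" and y: "y \<in> adjoin F x" "y \<noteq> 0"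
  shows "\<exists>v\<in>poly_over F. poly v x * y = 1"
  using adjoin_min_poly_rep[OF F h y(1)] adjoin_inverse_aux[OF F h] y(2) by auto

lemma sfield_adjoin:
  assumes F: "sfield F" and h: "is_min_poly F x h"
  shows "sfield (adjoin F x)"
  unfolding sfield_def
proof (intro conjI ballI)
  show "sring (adjoin F x)" using sring_adjoin sfield_sring F by auto
  fix y assume y: "y \<in> adjoin F x"
  show "inverse y \<in> adjoin F x"
  proof (cases "y = 0")
    case True then show ?thesis using y by simp
  next
    case False
    from adjoin_inverse[OF F h y this] obtain v where v: "v \<in> poly_over F" "poly v x * y = 1" by auto
    then have "inverse y = poly v x" using False by (simp add: field_simps)
    then show ?thesis using adjoinI[OF v(1)] by simp
  qed
qed

text \<open>All roots of the minimal polynomial satisfy the same polynomial equations over F. If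
  g(x) were nonzero with inverse v(x), then v g - 1 would vanish at x, hence at r, which excludes
  g(r) = 0.\<close>

lemma min_poly_conj:
  assumes F: "sfield F" and h: "is_min_poly F x h" and r: "poly h r = 0" and g: "g \<in> poly_over F"
  shows "poly g r = 0 \<longleftrightarrow> poly g x = 0"
proof
  have *: "poly g r = 0" if "g \<in> poly_over F" "poly g x = 0" for g
    using that h r by (auto simp: is_min_poly_def)
  then show "poly g x = 0 \<Longrightarrow> poly g r = 0" using g by auto
  assume gr: "poly g r = 0"
  show "poly g x = 0"
  proof (rule ccontr)
    assume "poly g x \<noteq> 0"
    then obtain v where v: "v \<in> poly_over F" "poly v x * poly g x = 1"
      using adjoin_inverse[OF F h adjoinI[OF g]] by auto
    have "poly (v * g - 1) r = 0"
      by (rule *) (use v g sfield_sring[OF F] in \<open>auto intro: poly_over_intros\<close>)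
    then show False using gr by simp
  qed
qed

text \<open>The determinant trick: x is an eigenvalue of an integer matrix, hence a root of its
  monic integral characteristic polynomial.\<close>

lemma algebraic_int_eigen:
  fixes x :: "'a::field_char_0" and v :: "nat \<Rightarrow> 'a" and a :: "nat \<Rightarrow> nat \<Rightarrow> int"
  assumes eq: "\<And>i. i < n \<Longrightarrow> x * v i = (\<Sum>j<n. of_int (a i j) * v j)" and nz: "k < n" "v k \<noteq> 0"
  shows "algebraic_int x"
proof -
  define A where "A = mat n n (\<lambda>(i, j). a i j)"
  define B :: "'a mat" where "B = map_mat of_int A"
  have A: "A \<in> carrier_mat n n" and B: "B \<in> carrier_mat n n" by (auto simp: A_def B_def)
  have "eigenvector B (vec n v) x"
    unfolding eigenvector_def
  proof (intro conjI)
    show "vec n v \<in> carrier_vec (dim_row B)" using B by auto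
    show "vec n v \<noteq> 0\<^sub>v (dim_row B)"
      using nz B by (metis carrier_matD(1) index_vec index_zero_vec(1))
    show "B *\<^sub>v vec n v = x \<cdot>\<^sub>v vec n v"
      by (rule eq_vecI)
        (use B eq in \<open>auto simp: B_def A_def scalar_prod_def atLeast0LessThan mult.commute\<close>)
  qed
  then have "poly (char_poly B) x = 0"
    using eigenvalue_root_char_poly[OF B] by (auto simp: eigenvalue_def)
  moreover have "char_poly B = map_poly of_int (char_poly A)"
    unfolding B_def by (rule of_int_hom.char_poly_hom[OF A])
  ultimately show ?thesis
    unfolding algebraic_int_altdef_ipoly using degree_monic_char_poly[OF A] by auto
qed

lemma adjoin_root_of_unity:
  assumes R: "sring R" and x: "x ^ f = 1" "f > 0" and y: "y \<in> adjoin R x"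
  shows "\<exists>c. (\<forall>j. c j \<in> R) \<and> y = (\<Sum>j<f. c j * x ^ j)"
proof -
  obtain g where g: "g \<in> poly_over R" "y = poly g x" using y by (auto simp: adjoin_def)
  have xm: "x ^ i = x ^ (i mod f)" for i
  proof -
    have "x ^ i = x ^ (f * (i div f) + i mod f)" by simp
    also have "\<dots> = x ^ (i mod f)" using x by (simp only: power_add power_mult) simp
    finally show ?thesis .
  qed
  define c where "c = (\<lambda>j. \<Sum>i\<in>{i\<in>{..degree g}. i mod f = j}. coeff g i)"
  have "y = (\<Sum>i\<le>degree g. coeff g i * x ^ (i mod f))"
    unfolding g(2) poly_altdef using xm by (intro sum.cong) auto
  also have "\<dots> = (\<Sum>j<f. \<Sum>i\<in>{i\<in>{..degree g}. i mod f = j}. coeff g i * x ^ (i mod f))"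
    using x by (intro sum.group[symmetric]) auto
  also have "\<dots> = (\<Sum>j<f. c j * x ^ j)"
    unfolding c_def sum_distrib_right by (intro sum.cong) auto
  finally have "y = (\<Sum>j<f. c j * x ^ j)" .
  moreover have "c j \<in> R" for j unfolding c_def using g R by (intro sring_sum) (auto simp: poly_over_def)
  ultimately show ?thesis by blast
qed

lemma Ints_adjoin_root_of_unity:
  fixes x :: "'a::field"
  assumes x: "x ^ f = 1" "f > 0" and y: "y \<in> adjoin \<int> x"
  shows "\<exists>c. y = (\<Sum>j<f. of_int (c j) * x ^ j)"
proof -
  obtain c where c: "\<forall>j. c j \<in> \<int>" "y = (\<Sum>j<f. c j * x ^ j)"
    using adjoin_root_of_unity[OF sring_Ints x y] by auto
  then have "\<forall>j. \<exists>m. c j = of_int m" by (auto elim: Ints_cases)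
  then obtain d where "\<And>j. c j = of_int (d j)" by metis
  then show ?thesis using c(2) by auto
qed

text \<open>The powers of x below f generate Z[x] additively and multiplication by y maps their span
  to itself, so they form an eigenvector for y; its entry at 0 is 1.\<close>

lemma algebraic_int_adjoin:
  fixes x :: "'a::field_char_0"
  assumes x: "x ^ f = 1" "f > 0" and y: "y \<in> adjoin \<int> x"
  shows "algebraic_int y"
proof -
  have "\<exists>c. y * x ^ i = (\<Sum>j<f. of_int (c j) * x ^ j)" for i
    by (rule Ints_adjoin_root_of_unity[OF x])
      (use y in \<open>auto intro!: sring_intros sring_adjoin sring_Ints in_adjoin_self\<close>)
  then obtain a where "\<And>i. y * x ^ i = (\<Sum>j<f. of_int (a i j) * x ^ j)" by metis
  then show ?thesis using x by (intro algebraic_int_eigen[of f y "\<lambda>i. x ^ i" a 0]) auto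
qed

section \<open>The ring of integers of a cyclotomic field\<close>

text \<open>Congruence modulo the principal ideal d S, used instead of a quotient ring.\<close>

definition scong :: "'a::comm_ring_1 set \<Rightarrow> 'a \<Rightarrow> 'a \<Rightarrow> 'a \<Rightarrow> bool" where
  "scong S d x y \<longleftrightarrow> (\<exists>s\<in>S. x - y = d * s)"

lemma scong_refl: "sring S \<Longrightarrow> scong S d x x"
  by (auto simp: scong_def intro: bexI[of _ 0] sring_0)

lemma scong_sym: "sring S \<Longrightarrow> scong S d x y \<Longrightarrow> scong S d y x"
  unfolding scong_def by (metis minus_diff_eq mult_minus_right sring_uminus)

lemma scong_trans: 
  assumes "sring S" "scong S d x y" "scong S d y w"
  shows "scong S d x w"
proof -
  obtain s t where "s \<in> S" "t \<in> S" "x - y = d * s" "y - w = d * t"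
    using assms by (auto simp: scong_def)
  then have "x - w = d * (s + t)" by (simp add: algebra_simps)
  then show ?thesis using \<open>s \<in> S\<close> \<open>t \<in> S\<close> assms(1) by (auto simp: scong_def intro: sring_add)
qed

lemma scong_add:
  assumes "sring S" "scong S d x y" "scong S d v w"
  shows "scong S d (x + v) (y + w)"
proof -
  obtain s t where "s \<in> S" "t \<in> S" "x - y = d * s" "v - w = d * t"
    using assms by (auto simp: scong_def)
  then have "(x + v) - (y + w) = d * (s + t)" by (simp add: algebra_simps)
  then show ?thesis using \<open>s \<in> S\<close> \<open>t \<in> S\<close> assms(1) by (auto simp: scong_def intro: sring_add)
qed

lemma scong_mult:
  assumes S: "sring S" and "scong S d x y" "scong S d v w" and "y \<in> S" "v \<in> S"
  shows "scong S d (x * v) (y * w)"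
proof -
  obtain s t where "s \<in> S" "t \<in> S" "x - y = d * s" "v - w = d * t"
    using assms by (auto simp: scong_def)
  moreover have "x * v - y * w = (x - y) * v + y * (v - w)" by (simp add: algebra_simps)
  ultimately have "x * v - y * w = d * (s * v + y * t)" by (simp add: algebra_simps)
  then show ?thesis using \<open>s \<in> S\<close> \<open>t \<in> S\<close> assms by (auto simp: scong_def intro!: sring_intros)
qed

lemma scong_power:
  assumes S: "sring S" and "scong S d x y" and "x \<in> S" "y \<in> S"
  shows "scong S d (x ^ n) (y ^ n)"
  by (induction n) (auto intro!: scong_refl scong_mult sring_power assms)

lemma scong_sum:
  assumes S: "sring S" and "\<And>i. i \<in> I \<Longrightarrow> scong S d (u i) (v i)"
  shows "scong S d (sum u I) (sum v I)"
  using assms(2) by (induction I rule: infinite_finite_induct) (auto intro!: scong_refl scong_add S)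

lemma scong_weaken:
  assumes S: "sring S" and "d = e * s" "s \<in> S" and "scong S d x y"
  shows "scong S e x y"
  using assms(4) unfolding scong_def assms(2) by (metis mult.assoc sring_mult[OF S assms(3)])

lemma scong_poly:
  assumes S: "sring S" and g: "g \<in> poly_over S" and "scong S d x y" "x \<in> S" "y \<in> S"
  shows "scong S d (poly g x) (poly g y)"
  using g
  by (induction g)
    (auto simp: poly_over_pCons[OF S] intro!: scong_refl scong_add scong_mult poly_in_sring assms)

lemma scong_freshman:
  fixes x :: "'a::field"
  assumes S: "sring S" and l: "Factorial_Ring.prime (l::nat)" and x: "x \<in> S" "y \<in> S"
  shows "scong S (of_nat l) ((x + y) ^ l) (x ^ l + y ^ l)"
proof -
  have l1: "l > 1" using l prime_gt_1_nat by blast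
  have "(x + y) ^ l = (\<Sum>k\<le>l. of_nat (l choose k) * x ^ k * y ^ (l - k))"
    by (rule binomial_ring)
  also have "{..l} = insert 0 (insert l {0<..<l})" using l1 by auto
  also have "(\<Sum>k\<in>\<dots>. of_nat (l choose k) * x ^ k * y ^ (l - k)) = y ^ l + (x ^ l +
      (\<Sum>k\<in>{0<..<l}. of_nat (l choose k) * x ^ k * y ^ (l - k)))"
    using l1 by (subst sum.insert; simp)+
  also have "(\<Sum>k\<in>{0<..<l}. of_nat (l choose k) * x ^ k * y ^ (l - k)) =
      of_nat l * (\<Sum>k\<in>{0<..<l}. of_nat ((l choose k) div l) * x ^ k * y ^ (l - k))"
    unfolding sum_distrib_left
  proof (intro sum.cong refl)
    fix k assume k: "k \<in> {0<..<l}"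
    then have "l dvd (l choose k)" using l by (intro dvd_choose_prime) auto
    then have "l choose k = l * ((l choose k) div l)" by simp
    then have "(of_nat (l choose k) :: 'a) = of_nat l * of_nat ((l choose k) div l)"
      by (metis of_nat_mult)
    then show "of_nat (l choose k) * x ^ k * y ^ (l - k) =
      of_nat l * (of_nat ((l choose k) div l) * x ^ k * y ^ (l - k))" by simp
  qed
  finally show ?thesis
    unfolding scong_def using x S
    by (intro bexI[of _ "\<Sum>k\<in>{0<..<l}. of_nat ((l choose k) div l) * x ^ k * y ^ (l - k)"])
      (auto intro!: sring_intros)
qed

lemma scong_fermat:
  fixes S :: "'a::field set"
  assumes S: "sring S" and l: "Factorial_Ring.prime (l::nat)"
  shows "scong S (of_nat l) (of_int n ^ l) (of_int n)"
proof -
  have nat: "scong S (of_nat l) (of_nat k ^ l) (of_nat k)" for k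
  proof (induction k)
    case 0
    then show ?case using prime_gt_0_nat[OF l] by (simp add: scong_refl[OF S] zero_power)
  next
    case (Suc k)
    have "scong S (of_nat l) ((1 + of_nat k) ^ l) (1 ^ l + of_nat k ^ l)"
      by (rule scong_freshman[OF S l]) (auto intro: sring_intros S)
    moreover have "scong S (of_nat l) (1 ^ l + of_nat k ^ l) (1 + of_nat k)"
      using Suc.IH by (auto intro!: scong_add scong_refl S)
    ultimately show ?case using scong_trans[OF S] by simp
  qed
  define k where "k = nat (n mod int l)"
  have "l > 0" using prime_gt_0_nat[OF l] by simp
  then have "n - int k = int l * (n div int l)"
    by (simp add: k_def minus_mod_eq_mult_div)
  then have "(of_int n :: 'a) - of_nat k = of_nat l * of_int (n div int l)"
    by (metis of_int_diff of_int_mult of_int_of_nat_eq)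
  then have nk: "scong S (of_nat l) (of_int n) (of_nat k)"
    by (auto simp: scong_def intro: sring_of_int[OF S])
  then have "scong S (of_nat l) (of_int n ^ l) (of_nat k ^ l)"
    by (intro scong_power S sring_intros)
  then show ?thesis using nat[of k] scong_sym[OF S nk] scong_trans[OF S] by blast
qed

text \<open>Induction along the Horner form: the l-th power is additive modulo l and fixes the
  integer coefficients by Fermat, so it acts only on the argument.\<close>

lemma scong_frobenius:
  fixes w :: "'a::field"
  assumes S: "sring S" and l: "Factorial_Ring.prime (l::nat)"
    and g: "g \<in> poly_over \<int>" and w: "w \<in> S"
  shows "scong S (of_nat l) (poly g w ^ l) (poly g (w ^ l))"
  using g
proof (induction g)
  case 0
  then show ?case using prime_gt_0_nat[OF l] by (simp add: scong_refl[OF S] zero_power)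
next
  case (pCons a g)
  then have a: "a \<in> \<int>" and g: "g \<in> poly_over \<int>" by (auto simp: poly_over_pCons[OF sring_Ints])
  have gw: "poly g v \<in> S" if "v \<in> S" for v
    using g that poly_over_mono[OF Ints_subset_sring[OF S]] by (auto intro: poly_in_sring[OF S])
  have aS: "a \<in> S" using a Ints_subset_sring[OF S] by auto
  have "scong S (of_nat l) ((a + w * poly g w) ^ l) (a ^ l + (w * poly g w) ^ l)"
    by (intro scong_freshman S l sring_intros aS w gw)
  moreover have "scong S (of_nat l) (a ^ l + (w * poly g w) ^ l) (a + w ^ l * poly g (w ^ l))"
    unfolding power_mult_distrib
    using pCons.IH[OF g] a scong_fermat[OF S l]
    by (intro scong_add scong_mult S scong_refl sring_intros w gw) (auto elim: Ints_cases)
  ultimately show ?case using scong_trans[OF S] by simp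
qed

lemma scong_frobenius_iterate:
  fixes w :: "'a::field"
  assumes S: "sring S" and l: "Factorial_Ring.prime (l::nat)"
    and g: "g \<in> poly_over \<int>" and w: "w \<in> S"
  shows "scong S (of_nat l) (poly g w ^ (l ^ r)) (poly g (w ^ (l ^ r)))"
proof (induction r)
  case 0
  then show ?case by (simp add: scong_refl[OF S])
next
  case (Suc r)
  have gS: "poly g v \<in> S" if "v \<in> S" for v
    using g that poly_over_mono[OF Ints_subset_sring[OF S]] by (auto intro: poly_in_sring[OF S])
  have "scong S (of_nat l) ((poly g w ^ (l ^ r)) ^ l) (poly g (w ^ (l ^ r)) ^ l)"
    by (intro scong_power[OF S Suc.IH] sring_intros S gS w)
  moreover have "scong S (of_nat l) (poly g (w ^ (l ^ r)) ^ l) (poly g ((w ^ (l ^ r)) ^ l))"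
    by (intro scong_frobenius S l g sring_intros w)
  ultimately show ?case using scong_trans[OF S]
    by (metis power_Suc2 power_mult)
qed

lemma clear_denominators:
  fixes g :: "'a::field_char_0 poly"
  assumes "g \<in> poly_over \<rat>"
  shows "\<exists>N>0. smult (of_nat N) g \<in> poly_over \<int>"
  using assms
proof (induction g)
  case 0
  then show ?case by (intro exI[of _ 1]) (auto simp: poly_over_0 sring_Ints)
next
  case (pCons a g)
  then obtain N where N: "N > 0" "smult (of_nat N) g \<in> poly_over \<int>"
    by (auto simp: poly_over_pCons sfield_sring[OF sfield_Rats])
  have "a \<in> \<rat>" using pCons.prems by (auto simp: poly_over_pCons sfield_sring[OF sfield_Rats])
  then obtain c d where cd: "d > 0" "a = of_int c / of_int d" by (auto elim: Rats_cases')
  define M where "M = N * nat d"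
  have aM: "of_nat M * a \<in> \<int>" using cd by (simp add: M_def)
  have "smult (of_nat M) g = smult (of_nat (nat d)) (smult (of_nat N) g)"
    by (simp add: M_def mult.commute)
  moreover have "smult (of_nat (nat d)) (smult (of_nat N) g) \<in> poly_over \<int>"
    by (rule poly_over_smult[OF sring_Ints _ N(2)]) simp
  ultimately have "smult (of_nat M) g \<in> poly_over \<int>" by argo
  then show ?case using N cd aM
    by (intro exI[of _ M]) (auto simp: poly_over_pCons[OF sring_Ints] M_def)
qed

section \<open>Powers of the standard root of unity and integral closedness of Z[zeta_f]\<close>

lemma zeta_power_cis: "zeta n ^ k = cis (2 * pi * k / n)"
proof -
  have "zeta n = cis (2 * pi / n)" by (simp add: zeta_def cis_conv_exp mult_ac)
  then show ?thesis by (simp add: DeMoivre mult_ac)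
qed

lemma zeta_power_self: "n > 0 \<Longrightarrow> zeta n ^ n = 1"
  by (simp add: zeta_power_cis)

lemma zeta_bij_betw: "n > 0 \<Longrightarrow> bij_betw (\<lambda>k. zeta n ^ k) {..<n} {z. z ^ n = 1}"
  using bij_betw_roots_unity[of n] by (simp add: zeta_power_cis)

lemma zeta_power_mod: "n > 0 \<Longrightarrow> zeta n ^ (k mod n) = zeta n ^ k"
proof -
  assume "n > 0"
  have "zeta n ^ k = zeta n ^ (n * (k div n) + k mod n)" by simp
  also have "\<dots> = zeta n ^ (k mod n)"
    using zeta_power_self[OF \<open>n > 0\<close>] by (simp only: power_add power_mult) simp
  finally show ?thesis by simp
qed

lemma zeta_power_eq_iff: "n > 0 \<Longrightarrow> zeta n ^ j = zeta n ^ k \<longleftrightarrow> j mod n = k mod n"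
proof -
  assume n: "n > 0"
  have "zeta n ^ j = zeta n ^ k \<longleftrightarrow> zeta n ^ (j mod n) = zeta n ^ (k mod n)"
    using zeta_power_mod[OF n] by simp
  also have "\<dots> \<longleftrightarrow> j mod n = k mod n"
    using zeta_bij_betw[OF n] n by (auto simp: bij_betw_def inj_on_def)
  finally show ?thesis .
qed

lemma zeta_power_eq_1_iff: "n > 0 \<Longrightarrow> zeta n ^ j = 1 \<longleftrightarrow> n dvd j"
  using zeta_power_eq_iff[of n j 0] by (auto simp: mod_eq_0_iff_dvd)

lemma zeta_mult_power: "k > 0 \<Longrightarrow> zeta (k * m) ^ k = zeta m"
  using zeta_power_cis[of "k * m" k] zeta_power_cis[of m 1] by simp

locale cyclotomic =
  fixes f :: nat
  assumes f_pos: "f > 0"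
begin

abbreviation "z \<equiv> zeta f"
abbreviation "K \<equiv> adjoin \<rat> (zeta f)"
abbreviation "S \<equiv> adjoin \<int> (zeta f)"

lemma S_sring: "sring S" by (rule sring_adjoin[OF sring_Ints])
lemma z_S: "z \<in> S" by (rule in_adjoin_self[OF sring_Ints])
lemma z_f: "z ^ f = 1" by (rule zeta_power_self[OF f_pos])
lemma S_subset_K: "S \<subseteq> K" by (intro adjoin_mono Ints_subset_Rats)
lemma z_K: "z \<in> K" using z_S S_subset_K by auto

lemma z_min_poly: assumes F: "sfield F" shows "\<exists>h. is_min_poly F z h"
proof (rule min_poly_exists[OF F])
  show "monom 1 f - 1 \<in> poly_over F"
    by (intro poly_over_intros sfield_sring F sring_1)
  show "monom 1 f - 1 \<noteq> (0 :: complex poly)"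
    using f_pos by (metis degree_1 degree_monom_eq eq_iff_diff_eq_0 less_irrefl one_neq_zero)
  show "poly (monom 1 f - 1) z = 0" by (simp add: poly_monom z_f)
qed

lemma K_sfield: "sfield K"
  using z_min_poly[OF sfield_Rats] sfield_adjoin[OF sfield_Rats] by auto

lemma K_sring: "sring K" by (rule sfield_sring[OF K_sfield])

lemma S_algebraic_int: "y \<in> S \<Longrightarrow> algebraic_int y"
  by (rule algebraic_int_adjoin[OF z_f f_pos])

lemma S_rat_int: "y \<in> S \<Longrightarrow> y \<in> \<rat> \<Longrightarrow> y \<in> \<int>"
  using S_algebraic_int rational_algebraic_int_is_int by auto

lemma K_denominator: "y \<in> K \<Longrightarrow> \<exists>N>0. of_nat N * y \<in> S"
proof -
  assume "y \<in> K"
  then obtain g where g: "g \<in> poly_over \<rat>" "y = poly g z" by (auto simp: adjoin_def)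
  obtain N where "N > 0" "smult (of_nat N) g \<in> poly_over \<int>" using clear_denominators[OF g(1)] by auto
  then show ?thesis using adjoinI[of "smult (of_nat N) g" \<int> z] g(2) by auto
qed

text \<open>(1/M) S modulo S is finite because S is generated by f powers of z. The function
  \<open>r\<close> records coordinates modulo M; the coordinates need not be unique, equal residues
  suffice.\<close>

lemma pigeonhole_mod_S:
  fixes u :: "nat \<Rightarrow> complex"
  assumes M: "M > 0" and u: "\<And>n. of_nat M * u n \<in> S"
  shows "\<exists>i j. j < i \<and> u i - u j \<in> S"
proof -
  have "\<exists>c. of_nat M * u n = (\<Sum>k<f. of_int (c k) * z ^ k)" for n
    by (rule Ints_adjoin_root_of_unity[OF z_f f_pos u])
  then obtain c where c: "\<And>n. of_nat M * u n = (\<Sum>k<f. of_int (c n k) * z ^ k)" by metis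
  define r where "r = (\<lambda>n. \<lambda>k\<in>{..<f}. c n k mod int M)"
  have "range r \<subseteq> {..<f} \<rightarrow>\<^sub>E {0..<int M}" using M by (simp add: r_def image_subset_iff restrict_PiE_iff)
  moreover have "finite ({..<f} \<rightarrow>\<^sub>E {0..<int M})" by (intro finite_PiE) auto
  ultimately have "finite (range r)" by (rule finite_subset)
  then have "\<not> inj r" using finite_imageD[of r UNIV] by auto
  then obtain i j where ij: "j < i" "r i = r j"
    unfolding inj_on_def by (metis linorder_neqE_nat)
  have "int M dvd c i k - c j k" if "k < f" for k
    using fun_cong[OF ij(2), of k] that by (simp add: r_def mod_eq_dvd_iff)
  then have "\<forall>k. \<exists>e. k < f \<longrightarrow> c i k - c j k = int M * e" by (auto simp: dvd_def)
  then obtain e where e: "\<And>k. k < f \<Longrightarrow> c i k - c j k = int M * e k" by metis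
  have "of_nat M * (u i - u j) = (\<Sum>k<f. of_int (c i k - c j k) * z ^ k)"
    by (simp add: right_diff_distrib c sum_subtractf left_diff_distrib)
  also have "\<dots> = of_nat M * (\<Sum>k<f. of_int (e k) * z ^ k)"
    unfolding sum_distrib_left by (intro sum.cong) (auto simp: e)
  finally have "u i - u j = (\<Sum>k<f. of_int (e k) * z ^ k)" using M by simp
  also have "\<dots> \<in> S" by (intro sring_intros S_sring z_S)
  finally show ?thesis using ij by auto
qed

text \<open>S/dS is reduced: replacing one factor x by \<open>x ^ q\<close> turns exponent n + 1
  into n + q, which is at least n + 2. So if the power n + 2 vanishes, the power n + 1 vanishes too,
  and the exponent descends to 1.\<close>

lemma power_scong_0_imp:
  assumes q: "q \<ge> 2" "\<And>x. x \<in> S \<Longrightarrow> scong S d (x ^ q) x" and x: "x \<in> S"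
  shows "scong S d (x ^ i) 0 \<Longrightarrow> i \<ge> 1 \<Longrightarrow> scong S d x 0"
proof (induction i rule: less_induct)
  case (less i)
  show ?case
  proof (cases "i = 1")
    case True
    then show ?thesis using less by simp
  next
    case False
    then obtain n where n: "i = n + 2" using less.prems(2) by (metis One_nat_def Suc_1 add.commute le_Suc_ex le_antisym not_less_eq_eq)
    have "n + q = i + (q - 2)" using q(1) n by simp
    then have "x ^ (n + q) = x ^ i * x ^ (q - 2)" by (simp only: power_add)
    moreover have "scong S d (x ^ i * x ^ (q - 2)) (0 * x ^ (q - 2))"
      by (rule scong_mult[OF S_sring less.prems(1) scong_refl[OF S_sring] sring_0[OF S_sring]
          sring_power[OF S_sring x]])
    ultimately have xnq: "scong S d (x ^ (n + q)) 0" by simp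
    have "scong S d (x ^ n * x) (x ^ n * x ^ q)"
      by (rule scong_mult[OF S_sring scong_refl[OF S_sring] scong_sym[OF S_sring q(2)[OF x]]
          sring_power[OF S_sring x] x])
    then have "scong S d (x ^ (n + 1)) (x ^ (n + q))" by (simp add: power_add mult.commute)
    then have "scong S d (x ^ (n + 1)) 0" using scong_trans[OF S_sring _ xnq] by blast
    then show ?thesis using less.IH[of "n + 1"] n by auto
  qed
qed

text \<open>Here \<open>z ^ m\<close> has order l^k. A power w of it has order l, so 0 = 1 + w + ...
  + w^(l-1) is congruent to l modulo \<pi>. Iterated Frobenius modulo l sends \<pi> to 1 - 1 = 0.
  With q = l^totient(m), Euler's theorem gives q = m c + 1, so z^q is congruent to z modulo \<pi>
  and the q-th power map is the identity on S modulo \<pi>.\<close>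

lemma prime_element_ramified:
  assumes l: "Factorial_Ring.prime l" and f: "f = l ^ k * m" "k > 0" "\<not> l dvd m"
  defines "\<pi> \<equiv> 1 - z ^ m"
  shows "\<pi> \<in> S" "\<pi> \<noteq> 0" "scong S \<pi> (of_nat l) 0" "\<exists>t. scong S (of_nat l) (\<pi> ^ t) 0"
    "\<exists>q\<ge>2. \<forall>x\<in>S. scong S \<pi> (x ^ q) x"
proof -
  note R = S_sring
  have l1: "l > 1" using l prime_gt_1_nat by blast
  have m0: "m > 0" using f_pos f by (cases m) auto
  have lk: "l ^ k > 1" using l1 f(2) by (rule one_less_power)
  show pi: "\<pi> \<in> S" unfolding \<pi>_def by (intro sring_intros R z_S)
  have "\<not> f dvd m" using f(1,2) lk m0 by (auto dest!: dvd_imp_le)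
  then show "\<pi> \<noteq> 0" using zeta_power_eq_1_iff[OF f_pos, of m] by (auto simp: \<pi>_def)
  have one_minus: "scong S \<pi> (z ^ (m * c)) 1" for c
  proof -
    have "scong S \<pi> (z ^ m) 1" unfolding scong_def \<pi>_def
      by (intro bexI[of _ "-1"] sring_intros R) auto
    then have "scong S \<pi> ((z ^ m) ^ c) (1 ^ c)" by (intro scong_power sring_intros R z_S)
    then show ?thesis by (simp add: power_mult)
  qed
  show l_pi: "scong S \<pi> (of_nat l) 0"
  proof -
    define w where "w = z ^ (m * l ^ (k - 1))"
    have "m * l ^ (k - 1) * l = f" using f by (cases k) (auto simp: mult_ac)
    then have wl: "w ^ l = 1" using z_f by (simp add: w_def flip: power_mult)
    have "m * l ^ (k - 1) < f" using \<open>m * l ^ (k - 1) * l = f\<close> m0 l1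
      by (metis f_pos mult.right_neutral mult_0 mult_less_cancel1 neq0_conv)
    then have "w \<noteq> 1" unfolding w_def using zeta_power_eq_1_iff[OF f_pos] m0 l1
      by (auto dest!: dvd_imp_le)
    then have "(\<Sum>i<l. w ^ i) = 0" using wl by (simp add: sum_gp_strict)
    moreover have "scong S \<pi> (\<Sum>i<l. w ^ i) (\<Sum>i<l. 1)"
      unfolding w_def power_mult[symmetric] mult.assoc by (intro scong_sum R one_minus)
    ultimately show ?thesis using scong_sym[OF R] by simp
  qed
  show "\<exists>t. scong S (of_nat l) (\<pi> ^ t) 0"
  proof
    have "scong S (of_nat l) (poly [:1, -1:] (z ^ m) ^ (l ^ k)) (poly [:1, -1:] ((z ^ m) ^ (l ^ k)))"
      by (intro scong_frobenius_iterate R l sring_intros z_S)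
        (auto simp: poly_over_pCons sring_Ints poly_over_0)
    moreover have "(z ^ m) ^ (l ^ k) = 1" using z_f f(1) by (simp add: mult.commute flip: power_mult)
    ultimately show "scong S (of_nat l) (\<pi> ^ (l ^ k)) 0" by (simp add: \<pi>_def)
  qed
  show "\<exists>q\<ge>2. \<forall>x\<in>S. scong S \<pi> (x ^ q) x"
  proof (intro exI conjI ballI)
    define q where "q = l ^ totient m"
    have "totient m > 0" using m0 by simp
    then have "1 < l ^ totient m" by (rule one_less_power[OF l1])
    then show "l ^ totient m \<ge> 2" by simp
    have "coprime l m" using l f(3) by (simp add: prime_imp_coprime)
    then have "[l ^ totient m = 1] (mod m)" by (rule euler_theorem)
    moreover have "q \<ge> 1" unfolding q_def using l1 by simp
    ultimately have "m dvd q - 1" unfolding q_def[symmetric]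
      by (simp add: cong_altdef_nat cong_sym_eq)
    then obtain c where c: "q = m * c + 1" using \<open>q \<ge> 1\<close> by (metis dvdE le_add_diff_inverse2)
    have zq: "scong S \<pi> (z ^ q) z"
      using scong_mult[OF R one_minus[of c] scong_refl[OF R, of \<pi> z]] unfolding c
      by (simp add: power_add sring_1[OF R] z_S mult.commute)
    fix x assume "x \<in> S"
    then obtain g where g: "g \<in> poly_over \<int>" "x = poly g z" by (auto simp: adjoin_def)
    have gS: "g \<in> poly_over S" using g poly_over_mono[OF Ints_subset_sring[OF R]] by auto
    have "scong S (of_nat l) (x ^ q) (poly g (z ^ q))"
      unfolding g(2) q_def by (intro scong_frobenius_iterate R l g z_S)
    moreover obtain s where "s \<in> S" "of_nat l = \<pi> * s" using l_pi by (auto simp: scong_def)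
    ultimately have "scong S \<pi> (x ^ q) (poly g (z ^ q))" using scong_weaken[OF R] by blast
    moreover have "scong S \<pi> (poly g (z ^ q)) (poly g z)"
      by (intro scong_poly R gS zq sring_intros z_S)
    ultimately show "scong S \<pi> (x ^ (l ^ totient m)) x"
      using scong_trans[OF R] g(2) q_def by blast
  qed
qed

text \<open>Now l is invertible modulo f, so some iterate of Frobenius fixes z itself and l can
  serve as its own d.\<close>

lemma prime_element_unramified:
  assumes l: "Factorial_Ring.prime l" and f: "\<not> l dvd f"
  shows "\<exists>q\<ge>2. \<forall>x\<in>S. scong S (of_nat l) (x ^ q) x"
proof (intro exI conjI ballI)
  have l1: "l > 1" using l prime_gt_1_nat by blast
  have "totient f > 0" using f_pos by simp
  then have "1 < l ^ totient f" by (rule one_less_power[OF l1])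
    then show "l ^ totient f \<ge> 2" by simp
  have "coprime l f" using l f by (simp add: prime_imp_coprime)
  then have "[l ^ totient f = 1] (mod f)" by (rule euler_theorem)
  then have zq: "z ^ (l ^ totient f) = z"
    using zeta_power_eq_iff[OF f_pos, of "l ^ totient f" 1] by (simp add: cong_def)
  fix x assume "x \<in> S"
  then obtain g where g: "g \<in> poly_over \<int>" "x = poly g z" by (auto simp: adjoin_def)
  show "scong S (of_nat l) (x ^ (l ^ totient f)) x"
    using scong_frobenius_iterate[OF S_sring l g(1) z_S, of "totient f"] g(2) zq by simp
qed

text \<open>Common interface for both cases: d is 1 - z^m if l divides f = l^k m, and l itself, with
  t = 1, otherwise.\<close>

lemma prime_element:
  assumes l: "Factorial_Ring.prime l"
  obtains d t q where "d \<in> S" "d \<noteq> 0" "scong S (of_nat l) (d ^ t) 0" "q \<ge> 2"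
    "\<And>x. x \<in> S \<Longrightarrow> scong S d (x ^ q) x"
proof (cases "l dvd f")
  case True
  obtain m where fm: "f = l ^ multiplicity l f * m" "\<not> l dvd m"
    using multiplicity_decompose'[of f l] l f_pos by (metis neq0_conv not_prime_unit)
  have "multiplicity l f > 0" using True l f_pos by (simp add: prime_multiplicity_gt_zero_iff)
  note r = prime_element_ramified[OF l fm(1) this fm(2)]
  obtain t where t: "scong S (of_nat l) ((1 - z ^ m) ^ t) 0" using r(4) by blast
  obtain q where "q \<ge> 2" "\<forall>x\<in>S. scong S (1 - z ^ m) (x ^ q) x" using r(5) by blast
  then show thesis using that[OF r(1,2) t] by blast
next
  case False
  have "scong S (of_nat l) (of_nat l ^ 1) 0"
    unfolding scong_def by (intro bexI[of _ 1]) (auto intro: sring_1 S_sring)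
  moreover have "(of_nat l :: complex) \<noteq> 0" using l by (metis not_prime_0 of_nat_eq_0_iff)
  moreover obtain q where "q \<ge> 2" "\<forall>x\<in>S. scong S (of_nat l) (x ^ q) x"
    using prime_element_unramified[OF l False] by blast
  ultimately show thesis using that[OF sring_of_nat[OF S_sring, of l]] by blast
qed

text \<open>If \<open>c\<close> is almost integral and \<open>x = d c \<in> S\<close>, the pigeonhole principle gives \<open>c\<^sup>i - c\<^sup>j \<in> S\<close> with
  \<open>j < i\<close>, so \<open>d\<close> divides \<open>x\<^sup>i\<close>; since \<open>x\<^sup>q = x\<close> in \<open>S/d\<close>, it divides \<open>x\<close>.\<close>

lemma integrally_closed_prime:
  assumes l: "Factorial_Ring.prime l" and b: "of_nat l * b \<in> S"
    and M: "M > 0" "\<And>n. of_nat M * b ^ n \<in> S"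
  shows "b \<in> S"
proof -
  note R = S_sring
  obtain d t q where d: "d \<in> S" "d \<noteq> 0" "scong S (of_nat l) (d ^ t) 0" and q: "q \<ge> 2"
    "\<And>x. x \<in> S \<Longrightarrow> scong S d (x ^ q) x" using prime_element[OF l] by blast
  \<comment> \<open>Factors d are removed one at a time. The descent starts at
    \<open>d ^ t * b\<close>, which lies in S because l divides \<open>d ^ t\<close> and l b is in
    S.\<close>
  have down: "d ^ t * b \<in> S \<Longrightarrow> b \<in> S" for t
  proof (induction t)
    case (Suc t)
    define c where "c = d ^ t * b"
    define x where "x = d * c"
    have xS: "x \<in> S" using Suc.prems by (simp add: x_def c_def mult_ac)
    have "of_nat M * c ^ n \<in> S" for n
    proof -
      have "of_nat M * c ^ n = (d ^ t) ^ n * (of_nat M * b ^ n)" by (simp add: c_def power_mult_distrib)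
      also have "\<dots> \<in> S" by (intro sring_intros R d M)
      finally show ?thesis .
    qed
    from pigeonhole_mod_S[OF M(1) this] obtain i j where ij: "j < i" "c ^ i - c ^ j \<in> S" by blast
    have "x ^ i - 0 = d * (d ^ (i - 1) * (c ^ i - c ^ j) + d ^ (i - 1 - j) * x ^ j)"
    proof -
      have e: "d ^ i = d * d ^ (i - 1)" "d ^ (i - 1) = d ^ (i - 1 - j) * d ^ j"
        using ij(1) by (cases i; simp flip: power_add)+
      have "x ^ i = d ^ i * (c ^ i - c ^ j) + d ^ i * c ^ j"
        by (simp add: x_def power_mult_distrib algebra_simps)
      also have "d ^ i * c ^ j = d * d ^ (i - 1 - j) * x ^ j"
        unfolding e(1) by (subst e(2)) (simp add: x_def power_mult_distrib)
      finally show ?thesis unfolding e(1) by (simp add: algebra_simps)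
    qed
    moreover have "d ^ (i - 1) * (c ^ i - c ^ j) + d ^ (i - 1 - j) * x ^ j \<in> S"
      using ij(2) by (intro sring_add sring_mult sring_power R d xS)
    ultimately have "scong S d (x ^ i) 0" unfolding scong_def by blast
    then have "scong S d x 0" using ij(1) by (intro power_scong_0_imp[OF q xS]) auto
    then have "c \<in> S" using d(2) by (auto simp: scong_def x_def)
    then show ?case using Suc.IH by (simp add: c_def)
  qed simp
  obtain s where "s \<in> S" "d ^ t = of_nat l * s" using d(3) by (auto simp: scong_def)
  then have "d ^ t * b = s * (of_nat l * b)" by simp
  also have "\<dots> \<in> S" by (intro sring_mult R \<open>s \<in> S\<close> b)
  finally show ?thesis by (rule down)
qed

text \<open>The hypothesis on M is almost integrality: one denominator for all powers of a. A
  denominator N of a itself is then stripped of its prime factors one by one, and each multiple N' a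
  inherits the hypothesis.\<close>

theorem integrally_closed:
  assumes a: "a \<in> K" and M: "M > 0" "\<And>n. of_nat M * a ^ n \<in> S"
  shows "a \<in> S"
proof -
  have "of_nat N * a \<in> S \<Longrightarrow> N > 0 \<Longrightarrow> a \<in> S" for N
  proof (induction N rule: less_induct)
    case (less N)
    show ?case
    proof (cases "N = 1")
      case True then show ?thesis using less by simp
    next
      case False
      then obtain l where l: "Factorial_Ring.prime l" "l dvd N" using prime_factor_nat by blast
      then obtain N' where N': "N = l * N'" by auto
      have "of_nat N' * a \<in> S"
      proof (rule integrally_closed_prime[OF l(1) _ M(1)])
        show "of_nat l * (of_nat N' * a) \<in> S" using less.prems(1) by (simp add: N' mult_ac)
        fix n
        have "of_nat M * (of_nat N' * a) ^ n = of_nat N' ^ n * (of_nat M * a ^ n)"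
          by (simp add: power_mult_distrib)
        also have "\<dots> \<in> S" by (intro sring_intros S_sring M)
        finally show "of_nat M * (of_nat N' * a) ^ n \<in> S" .
      qed
      moreover have "N' < N" "N' > 0" using less.prems(2) N' prime_gt_1_nat[OF l(1)] by auto
      ultimately show ?thesis using less.IH by blast
    qed
  qed
  then show ?thesis using K_denominator[OF a] by blast
qed

text \<open>A monic equation of degree d expresses every power of a by the lower ones, so
  \<open>N ^ d\<close> is a denominator common to all powers.\<close>

lemma algebraic_int_in_S:
  assumes a: "a \<in> K" "algebraic_int a"
  shows "a \<in> S"
proof -
  obtain N where N: "N > 0" "of_nat N * a \<in> S" using K_denominator[OF a(1)] by blast
  obtain p where p: "lead_coeff p = 1" "\<forall>i. coeff p i \<in> \<int>" "poly p a = 0"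
    using a(2) by (auto elim: algebraic_int.cases)
  note R = S_sring
  define d where "d = degree p"
  have small: "of_nat N ^ d * a ^ n \<in> S" if "n \<le> d" for n
  proof -
    have "of_nat N ^ d * a ^ n = of_nat N ^ (d - n) * (of_nat N * a) ^ n"
      using that by (simp add: power_mult_distrib flip: power_add mult.assoc)
    also have "\<dots> \<in> S" by (intro sring_intros R N)
    finally show ?thesis .
  qed
  have all: "of_nat N ^ d * a ^ n \<in> S" for n
  proof (induction n rule: less_induct)
    case (less n)
    show ?case
    proof (cases "n < d")
      case True then show ?thesis using small by simp
    next
      case False
      have "poly p a = (\<Sum>i<d. coeff p i * a ^ i) + a ^ d"
        unfolding poly_altdef using p(1) by (simp add: d_def flip: lessThan_Suc_atMost)
      then have "a ^ d = - (\<Sum>i<d. coeff p i * a ^ i)" using p(3) by (simp add: add_eq_0_iff)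
      moreover have "a ^ n = a ^ d * a ^ (n - d)" using False by (simp flip: power_add)
      ultimately have "of_nat N ^ d * a ^ n = - (\<Sum>i<d. coeff p i * (of_nat N ^ d * a ^ (i + (n - d))))"
        by (simp add: sum_distrib_left sum_distrib_right power_add mult_ac)
      also have "\<dots> \<in> S"
      proof (intro sring_uminus sring_sum R sring_mult[OF R, of "coeff p _"])
        fix i assume "i \<in> {..<d}"
        then show "of_nat N ^ d * a ^ (i + (n - d)) \<in> S" using less.IH[of "i + (n - d)"] False by simp
        show "coeff p i \<in> S" using p(2) Ints_subset_sring[OF R] by auto
      qed
      finally show ?thesis .
    qed
  qed
  show ?thesis
    by (rule integrally_closed[OF a(1), of "N ^ d"]) (use N all in auto)
qed

end

section \<open>Automorphisms of cyclotomic fields and traces\<close>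

context cyclotomic
begin

text \<open>An exponent \<open>a \<in> conj_exps F\<close> stands for the automorphism of \<open>F(\<zeta>)\<close> over \<open>F\<close> with
  \<open>\<zeta> \<mapsto> \<zeta>\<^sup>a\<close>, which is \<open>cmap a\<close> on \<open>K\<close>; outside \<open>K\<close>, and for other \<open>a\<close>, \<open>cmap a\<close> has junk values.\<close>

definition conj_exps :: "complex set \<Rightarrow> nat set" where
  "conj_exps F = {a\<in>{..<f}. \<forall>g\<in>poly_over F. poly g z = 0 \<longrightarrow> poly g (z ^ a) = 0}"

definition cmap :: "nat \<Rightarrow> complex \<Rightarrow> complex" where
  "cmap a y = poly (SOME g. g \<in> poly_over \<rat> \<and> poly g z = y) (z ^ a)"

lemma conj_exps_antimono: "F \<subseteq> F' \<Longrightarrow> conj_exps F' \<subseteq> conj_exps F"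
  using poly_over_mono[of F F'] by (auto simp: conj_exps_def)

lemma conj_exps_Rats: "sfield F \<Longrightarrow> a \<in> conj_exps F \<Longrightarrow> a \<in> conj_exps \<rat>"
  using conj_exps_antimono[OF Rats_subset_sfield] by blast

lemma finite_conj_exps: "finite (conj_exps F)"
  by (simp add: conj_exps_def)

lemma adjoin_subfield_eq_K:
  assumes F: "sfield F" "F \<subseteq> K"
  shows "adjoin F z = K"
proof
  show "adjoin F z \<subseteq> K" by (rule adjoin_least[OF K_sring F(2) z_K])
  show "K \<subseteq> adjoin F z" by (rule adjoin_mono[OF Rats_subset_sfield[OF F(1)]])
qed

text \<open>Independence of the \<open>SOME\<close> choice: two representatives differ by a
  polynomial over F vanishing at z, hence at z^a. Allowing coefficients in F records that the map is
  F-linear.\<close>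

lemma cmap_poly:
  assumes F: "sfield F" "F \<subseteq> K" and a: "a \<in> conj_exps F" and g: "g \<in> poly_over F"
  shows "cmap a (poly g z) = poly g (z ^ a)"
proof -
  have "poly g z \<in> K" using adjoinI[OF g, of z] adjoin_subfield_eq_K[OF F] by simp
  then have "\<exists>u. u \<in> poly_over \<rat> \<and> poly u z = poly g z" by (auto simp: adjoin_def)
  then obtain u where u: "u \<in> poly_over \<rat>" "poly u z = poly g z"
    "cmap a (poly g z) = poly u (z ^ a)"
    unfolding cmap_def by (metis (mono_tags, lifting) someI_ex)
  have "u \<in> poly_over F" using u(1) poly_over_mono[OF Rats_subset_sfield[OF F(1)]] by auto
  then have "g - u \<in> poly_over F" using g by (intro poly_over_diff sfield_sring F(1))
  then have "poly (g - u) (z ^ a) = 0" using a u(2) by (auto simp: conj_exps_def)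
  then show ?thesis using u(3) by simp
qed

lemma Rats_subset_K: "\<rat> \<subseteq> K" by (rule Rats_subset_sfield[OF K_sfield])

lemmas cmap_poly_Rats = cmap_poly[OF sfield_Rats Rats_subset_K]

lemma K_cases:
  assumes "y \<in> K"
  obtains g where "g \<in> poly_over \<rat>" "y = poly g z"
  using assms by (auto simp: adjoin_def)

lemma cmap_poly_power:
  assumes a: "a \<in> conj_exps \<rat>" and g: "g \<in> poly_over \<rat>"
  shows "cmap a (poly g (z ^ b)) = poly g (z ^ (a * b))"
proof -
  have "pcompose g (monom 1 b) \<in> poly_over \<rat>"
    using g by (intro poly_over_intros sfield_sring sfield_Rats) auto
  from cmap_poly_Rats[OF a this] show ?thesis
    by (simp add: poly_pcompose poly_monom power_mult)
qed

lemma cmap_z_power: "a \<in> conj_exps \<rat> \<Longrightarrow> cmap a (z ^ b) = z ^ (a * b)"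
  using cmap_poly_power[of a "[:0, 1:]" b]
  by (simp add: poly_over_pCons poly_over_0 sfield_sring[OF sfield_Rats])

lemma cmap_fix: 
  assumes F: "sfield F" "F \<subseteq> K" and a: "a \<in> conj_exps F" and y: "y \<in> F"
  shows "cmap a y = y"
  using cmap_poly[OF F a poly_over_const[OF sfield_sring[OF F(1)] y]] by simp

lemma cmap_rat: "a \<in> conj_exps \<rat> \<Longrightarrow> y \<in> \<rat> \<Longrightarrow> cmap a y = y"
  by (rule cmap_fix[OF sfield_Rats Rats_subset_K])

lemma cmap_add:
  assumes a: "a \<in> conj_exps \<rat>" and "x \<in> K" "y \<in> K"
  shows "cmap a (x + y) = cmap a x + cmap a y"
proof -
  obtain g h where gh: "g \<in> poly_over \<rat>" "h \<in> poly_over \<rat>" "x = poly g z" "y = poly h z"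
    using assms by (auto simp: adjoin_def)
  then show ?thesis
    using cmap_poly_Rats[OF a, of "g + h"] cmap_poly_Rats[OF a, of g] cmap_poly_Rats[OF a, of h]
    by (simp add: poly_over_add sfield_sring[OF sfield_Rats])
qed

lemma cmap_mult:
  assumes a: "a \<in> conj_exps \<rat>" and "x \<in> K" "y \<in> K"
  shows "cmap a (x * y) = cmap a x * cmap a y"
proof -
  obtain g h where gh: "g \<in> poly_over \<rat>" "h \<in> poly_over \<rat>" "x = poly g z" "y = poly h z"
    using assms by (auto simp: adjoin_def)
  then show ?thesis
    using cmap_poly_Rats[OF a, of "g * h"] cmap_poly_Rats[OF a, of g] cmap_poly_Rats[OF a, of h]
    by (simp add: poly_over_mult sfield_sring[OF sfield_Rats])
qed

lemma cmap_in_K: "a \<in> conj_exps \<rat> \<Longrightarrow> y \<in> K \<Longrightarrow> cmap a y \<in> K"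
  by (erule K_cases)
    (auto simp: cmap_poly_Rats intro!: poly_in_sring K_sring sring_power z_K
      intro: subsetD[OF poly_over_mono[OF Rats_subset_K]])

lemma cmap_in_S: "a \<in> conj_exps \<rat> \<Longrightarrow> y \<in> S \<Longrightarrow> cmap a y \<in> S"
proof -
  assume a: "a \<in> conj_exps \<rat>" and "y \<in> S"
  then obtain g where g: "g \<in> poly_over \<int>" "y = poly g z" by (auto simp: adjoin_def)
  then have "g \<in> poly_over \<rat>" "g \<in> poly_over S"
    using poly_over_mono[OF Ints_subset_Rats] poly_over_mono[OF Ints_subset_sring[OF S_sring]] by auto
  then show ?thesis
    using cmap_poly_Rats[OF a] g by (auto intro!: poly_in_sring S_sring sring_power z_S)
qed

lemma cmap_sum:
  assumes a: "a \<in> conj_exps \<rat>" and "\<And>i. i \<in> I \<Longrightarrow> u i \<in> K"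
  shows "cmap a (sum u I) = (\<Sum>i\<in>I. cmap a (u i))"
  using assms(2)
proof (induction I rule: infinite_finite_induct)
  case (insert i I)
  then show ?case using cmap_add[OF a, of "u i" "sum u I"] by (simp add: sring_sum[OF K_sring])
qed (auto simp: cmap_rat[OF a])

lemma cmap_prod:
  assumes a: "a \<in> conj_exps \<rat>" and "\<And>i. i \<in> I \<Longrightarrow> u i \<in> K"
  shows "cmap a (prod u I) = (\<Prod>i\<in>I. cmap a (u i)) \<and> prod u I \<in> K"
  using assms(2)
proof (induction I rule: infinite_finite_induct)
  case (insert i I)
  then show ?case using cmap_mult[OF a, of "u i" "prod u I"] by (simp add: sring_mult[OF K_sring])
qed (auto simp: cmap_rat[OF a] sring_1[OF K_sring])

text \<open>The converse of the implication defining \<open>conj_exps\<close>, by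
  \<open>min_poly_conj\<close>; it makes the conjugation maps injective.\<close>

lemma conj_exps_inj:
  assumes a: "a \<in> conj_exps \<rat>" and g: "g \<in> poly_over \<rat>" "poly g (z ^ a) = 0"
  shows "poly g z = 0"
proof -
  obtain h where h: "is_min_poly \<rat> z h" using z_min_poly[OF sfield_Rats] by blast
  then have "poly h (z ^ a) = 0" using a by (auto simp: is_min_poly_def conj_exps_def)
  from min_poly_conj[OF sfield_Rats h this g(1)] g(2) show ?thesis by simp
qed

lemma cmap_inj:
  assumes a: "a \<in> conj_exps \<rat>" and x: "x \<in> K" "y \<in> K" "cmap a x = cmap a y"
  shows "x = y"
proof -
  obtain g h where gh: "g \<in> poly_over \<rat>" "h \<in> poly_over \<rat>" "x = poly g z" "y = poly h z"
    using x by (auto simp: adjoin_def)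
  have "poly (g - h) z = 0"
    by (rule conj_exps_inj[OF a])
      (use gh x cmap_poly_Rats[OF a] in \<open>auto intro: poly_over_diff sfield_sring sfield_Rats\<close>)
  then show ?thesis using gh by simp
qed

lemma conj_exps_mult:
  assumes F: "sfield F" and ab: "a \<in> conj_exps F" "b \<in> conj_exps F"
  shows "a * b mod f \<in> conj_exps F"
  unfolding conj_exps_def
proof (intro CollectI conjI ballI impI)
  show "a * b mod f \<in> {..<f}" using f_pos by simp
  fix g assume g: "g \<in> poly_over F" "poly g z = 0"
  define u where "u = pcompose g (monom 1 b)"
  have u: "u \<in> poly_over F"
    unfolding u_def using g by (intro poly_over_intros sfield_sring F sring_1)
  have "poly g (z ^ b) = 0" using ab(2) g by (auto simp: conj_exps_def)
  then have "poly u z = 0" by (simp add: u_def poly_pcompose poly_monom)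
  then have "poly u (z ^ a) = 0" using ab(1) u by (auto simp: conj_exps_def)
  then show "poly g (z ^ (a * b mod f)) = 0"
    by (simp add: u_def poly_pcompose poly_monom zeta_power_mod[OF f_pos] power_mult)
qed

text \<open>An injective self-map of a finite set is onto; this yields inverses and the reindexing
  of sums and products over conjugates.\<close>

lemma conj_exps_bij:
  assumes F: "sfield F" and a: "a \<in> conj_exps F"
  shows "bij_betw (\<lambda>b. a * b mod f) (conj_exps F) (conj_exps F)"
proof -
  have "inj_on (\<lambda>b. a * b mod f) (conj_exps F)"
  proof (rule inj_onI)
    fix b c assume bc: "b \<in> conj_exps F" "c \<in> conj_exps F" "a * b mod f = a * c mod f"
    then have "z ^ (a * b) = z ^ (a * c)" using zeta_power_eq_iff[OF f_pos] by simp
    moreover have "monom 1 b - monom 1 c \<in> poly_over \<rat>"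
      by (intro poly_over_diff poly_over_monom sfield_sring sfield_Rats) auto
    ultimately have "z ^ b = z ^ c"
      using conj_exps_inj[OF conj_exps_Rats[OF F a], of "monom 1 b - monom 1 c"]
      by (simp add: poly_monom power_mult)
    then have "b mod f = c mod f" using zeta_power_eq_iff[OF f_pos] by simp
    then show "b = c" using bc by (simp add: conj_exps_def)
  qed
  moreover have "(\<lambda>b. a * b mod f) ` conj_exps F \<subseteq> conj_exps F"
    using conj_exps_mult[OF F a] by auto
  ultimately show ?thesis
    by (simp add: bij_betw_def endo_inj_surj finite_conj_exps)
qed

lemma cmap_comm:
  assumes "a \<in> conj_exps \<rat>" "b \<in> conj_exps \<rat>" "y \<in> K"
  shows "cmap a (cmap b y) = cmap b (cmap a y)"
proof -
  obtain g where "g \<in> poly_over \<rat>" "y = poly g z" using assms(3) by (rule K_cases)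
  then show ?thesis
    using assms cmap_poly_power[of a g b] cmap_poly_power[of b g a]
    by (simp add: cmap_poly_Rats mult.commute)
qed

text \<open>The minimal polynomial of \<open>z\<close> over \<open>F\<close> has as many roots as its degree, all of them
  powers of \<open>z\<close>; representing \<open>y\<close> by a polynomial of smaller degree, a \<open>y\<close> fixed by all
  conjugations makes that polynomial constant.\<close>

lemma conj_fixed_in_subfield:
  assumes F: "sfield F" "F \<subseteq> K" and y: "y \<in> K" and inv: "\<And>a. a \<in> conj_exps F \<Longrightarrow> cmap a y = y"
  shows "y \<in> F"
proof -
  note R = sfield_sring[OF F(1)]
  obtain h where h: "is_min_poly F z h" using z_min_poly[OF F(1)] by blast
  have hF: "h \<in> poly_over F" "h \<noteq> 0" "poly h z = 0" using h by (auto simp: is_min_poly_def)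
  define u :: "complex poly" where "u = monom 1 f - 1"
  have "u \<in> poly_over F" unfolding u_def by (intro poly_over_intros R sring_1)
  moreover have "poly u z = 0" by (simp add: u_def poly_monom z_f)
  ultimately obtain q where q: "u = q * h" using h by (auto simp: is_min_poly_def)
  have "u = monom 1 f + (- 1)" by (simp add: u_def)
  then have du: "degree u = f" using f_pos
    by (simp only:) (subst degree_add_eq_left; simp add: degree_monom_eq)
  then have u0: "u \<noteq> 0" using f_pos by auto
  then have q0: "q \<noteq> 0" using q by auto
  \<comment> \<open>X^f - 1 = q h has f distinct roots and q accounts for at most its degree of
    them, so at least \<open>degree h\<close> distinct roots remain for h.\<close>
  have "f = card {x. x ^ f = (1::complex)}" using f_pos by (simp add: card_roots_unity_eq)
  also have "{x. x ^ f = (1::complex)} = {x. poly u x = 0}" by (auto simp: u_def poly_monom)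
  also have "\<dots> = {x. poly q x = 0} \<union> {x. poly h x = 0}" by (auto simp: q)
  also have "card \<dots> \<le> card {x. poly q x = 0} + card {x. poly h x = 0}" by (rule card_Un_le)
  also have "card {x. poly q x = 0} \<le> degree q" by (rule card_poly_roots_bound[OF q0])
  finally have "f \<le> degree q + card {x. poly h x = 0}" by simp
  moreover have "f = degree q + degree h" using du q q0 hF(2) by (simp add: degree_mult_eq)
  ultimately have card_h: "degree h \<le> card {x. poly h x = 0}" by simp
  obtain g where g: "g \<in> poly_over F" "y = poly g z" "degree g < degree h"
    using adjoin_min_poly_rep[OF F(1) h] y adjoin_subfield_eq_K[OF F] by blast
  have "{x. poly h x = 0} \<subseteq> {x. poly (g - [:y:]) x = 0}"
  proof
    fix r assume "r \<in> {x. poly h x = 0}"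
    then have r: "poly h r = 0" by simp
    then have "poly u r = 0" by (simp add: q)
    then have "r \<in> {x. x ^ f = 1}" by (simp add: u_def poly_monom)
    also have "\<dots> = (\<lambda>k. z ^ k) ` {..<f}" using zeta_bij_betw[OF f_pos] by (simp add: bij_betw_def)
    finally obtain a where a: "a < f" "r = z ^ a" by auto
    have "a \<in> conj_exps F"
      using a r min_poly_conj[OF F(1) h r] by (auto simp: conj_exps_def)
    then have "poly g r = y" using inv[of a] cmap_poly[OF F _ g(1), of a] g(2) a(2) by simp
    then show "r \<in> {x. poly (g - [:y:]) x = 0}" by simp
  qed
  moreover have deg: "degree (g - [:y:]) < degree h"
    using g(3) by (metis degree_diff_less degree_pCons_0 gr_implies_not0 not_gr_zero)
  moreover have "g - [:y:] = 0"
  proof (rule ccontr)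
    assume n0: "g - [:y:] \<noteq> 0"
    have "card {x. poly h x = 0} \<le> card {x. poly (g - [:y:]) x = 0}"
      by (rule card_mono[OF poly_roots_finite[OF n0]]) fact
    also have "\<dots> \<le> degree (g - [:y:])" by (rule card_poly_roots_bound[OF n0])
    finally show False using deg card_h by simp
  qed
  then have "g = [:y:]" by simp
  then show ?thesis using g(1) by (simp add: poly_over_pCons[OF R])
qed

text \<open>Every subfield of K is normal because conjugations commute: the image of y is still
  fixed by all conjugations over F.\<close>

lemma cmap_in_subfield:
  assumes F: "sfield F" "F \<subseteq> K" and a: "a \<in> conj_exps \<rat>" and y: "y \<in> F"
  shows "cmap a y \<in> F"
proof (rule conj_fixed_in_subfield[OF F])
  show "cmap a y \<in> K" using cmap_in_K[OF a] y F by auto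
  fix b assume b: "b \<in> conj_exps F"
  have "cmap b (cmap a y) = cmap a (cmap b y)"
    using conj_exps_Rats[OF F(1) b] a y F(2) by (intro cmap_comm) auto
  then show "cmap b (cmap a y) = cmap a y" using cmap_fix[OF F b y] by simp
qed

text \<open>The sum is the trace from K down to F; a further conjugation over F only permutes its
  terms.\<close>

lemma conj_sum_in_subfield:
  assumes F: "sfield F" "F \<subseteq> K" and y: "y \<in> K"
  shows "(\<Sum>a\<in>conj_exps F. cmap a y) \<in> F"
proof (rule conj_fixed_in_subfield[OF F])
  note E = conj_exps_Rats[OF F(1)]
  show "(\<Sum>a\<in>conj_exps F. cmap a y) \<in> K"
    by (intro sring_sum K_sring cmap_in_K E y)
  fix b assume b: "b \<in> conj_exps F"
  obtain g where g: "g \<in> poly_over \<rat>" "y = poly g z" using y by (rule K_cases)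
  have "cmap b (\<Sum>a\<in>conj_exps F. cmap a y) = (\<Sum>a\<in>conj_exps F. cmap b (cmap a y))"
    by (intro cmap_sum E b cmap_in_K y)
  also have "\<dots> = (\<Sum>a\<in>conj_exps F. cmap (b * a mod f) y)"
    using E[OF b] E E[OF conj_exps_mult[OF F(1) b]] g
    by (intro sum.cong) (auto simp: cmap_poly_Rats cmap_poly_power zeta_power_mod[OF f_pos])
  also have "\<dots> = (\<Sum>a\<in>conj_exps F. cmap a y)"
    by (rule sum.reindex_bij_betw[OF conj_exps_bij[OF F(1) b]])
  finally show "cmap b (\<Sum>a\<in>conj_exps F. cmap a y) = (\<Sum>a\<in>conj_exps F. cmap a y)" .
qed

lemma cmap_iterate:
  assumes a: "a \<in> conj_exps \<rat>" and g: "g \<in> poly_over \<rat>"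
  shows "(cmap a ^^ i) (poly g (z ^ b)) = poly g (z ^ (a ^ i * b))"
  by (induction i) (auto simp: cmap_poly_power[OF a g] mult.assoc)

lemma funpow_cmap_in_K: "a \<in> conj_exps \<rat> \<Longrightarrow> y \<in> K \<Longrightarrow> (cmap a ^^ i) y \<in> K"
  by (induction i) (auto intro: cmap_in_K)

lemma funpow_cmap_in_S: "a \<in> conj_exps \<rat> \<Longrightarrow> y \<in> S \<Longrightarrow> (cmap a ^^ i) y \<in> S"
  by (induction i) (auto intro: cmap_in_S)

lemma funpow_cmap_in_subfield:
  "sfield F \<Longrightarrow> F \<subseteq> K \<Longrightarrow> a \<in> conj_exps \<rat> \<Longrightarrow> y \<in> F \<Longrightarrow> (cmap a ^^ i) y \<in> F"
  by (induction i) (auto intro: cmap_in_subfield)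

lemma funpow_cmap_sum:
  assumes "a \<in> conj_exps \<rat>" "\<And>j. j \<in> I \<Longrightarrow> u j \<in> K"
  shows "(cmap a ^^ i) (sum u I) = (\<Sum>j\<in>I. (cmap a ^^ i) (u j))"
  by (induction i) (auto simp: cmap_sum funpow_cmap_in_K assms)

section \<open>Rational integers in ideals of S, inertia, and divisibility of traces\<close>

lemma scong_nat_int:
  assumes "scong S (of_nat l) (of_int T) 0" "l > 0"
  shows "int l dvd T"
proof -
  obtain s where s: "s \<in> S" "of_int T = of_nat l * s" using assms by (auto simp: scong_def)
  then have "s = of_int T / of_nat l" using assms(2) by simp
  then have "s \<in> \<rat>" by simp
  then obtain n where "s = of_int n" using S_rat_int[OF s(1)] by (auto elim: Ints_cases)
  then have "of_int T = (of_int (int l * n) :: complex)" using s(2) by simp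
  then have "T = int l * n" by (simp only: of_int_eq_iff)
  then show ?thesis by simp
qed

text \<open>If T lies in dS, then T^t lies in l S, hence in l Z because rational elements of S are
  integers; l being prime, it divides T.\<close>

lemma scong_int_radical:
  assumes l: "Factorial_Ring.prime l" and d: "scong S (of_nat l) (d ^ t) 0"
    and T: "scong S d (of_int T) 0"
  shows "int l dvd T"
proof -
  obtain s where s: "s \<in> S" "of_int T = d * s" using T by (auto simp: scong_def)
  obtain r where r: "r \<in> S" "d ^ t = of_nat l * r" using d by (auto simp: scong_def)
  have "of_int (T ^ t) = of_nat l * (r * s ^ t)" using s r by (simp add: power_mult_distrib)
  then have "scong S (of_nat l) (of_int (T ^ t)) 0"
    unfolding scong_def using r s by (auto intro!: sring_mult sring_power S_sring)
  then have "int l dvd T ^ t" using scong_nat_int prime_gt_0_nat[OF l] by blast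
  then show ?thesis using l by (meson prime_dvd_power prime_nat_int_transfer)
qed

lemma zeta_scong_1: "scong S (1 - z ^ m) (z ^ (m * c)) 1"
proof -
  have "scong S (1 - z ^ m) (z ^ m) 1" unfolding scong_def
    by (intro bexI[of _ "-1"] sring_uminus sring_1 S_sring) auto
  then have "scong S (1 - z ^ m) ((z ^ m) ^ c) (1 ^ c)"
    by (intro scong_power sring_power sring_1 S_sring z_S)
  then show ?thesis by (simp add: power_mult)
qed

text \<open>An automorphism of \<open>\<rat>(\<zeta>\<^sub>f)\<close> over \<open>\<rat>(\<zeta>\<^sub>m)\<close>, \<open>f = l\<^sup>k m\<close>, lies in the inertia group.\<close>

lemma cmap_inertia:
  assumes f: "f = n * m" and a: "a \<in> conj_exps (adjoin \<rat> (zeta m))" "a \<in> conj_exps \<rat>" and y: "y \<in> S"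
  shows "scong S (1 - z ^ m) (cmap a y) y"
proof -
  note R = S_sring
  let ?d = "1 - z ^ m"
  have mn: "m > 0" "n > 0" using f f_pos by auto
  have zm: "zeta m = z ^ n" using zeta_mult_power[of n m] mn f by simp
  \<comment> \<open>\<open>u\<close> has coefficients in Q(zeta_m) because zeta_m = z^n, so the
    conjugate z^a is a root of it as well. This forces a to be 1 modulo m.\<close>
  define u where "u = monom 1 n - [:z ^ n:]"
  have QR: "sring (adjoin \<rat> (zeta m))" by (rule sring_adjoin[OF sfield_sring[OF sfield_Rats]])
  have "u \<in> poly_over (adjoin \<rat> (zeta m))"
    unfolding u_def zm[symmetric]
    by (intro poly_over_diff poly_over_monom poly_over_const QR sring_1 in_adjoin_self
        sfield_sring[OF sfield_Rats])
  moreover have "poly u z = 0" by (simp add: u_def poly_monom)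
  ultimately have "poly u (z ^ a) = 0" using a(1) by (auto simp: conj_exps_def)
  then have "z ^ (a * n) = z ^ n" by (simp add: u_def poly_monom power_mult)
  then have "(a * n) mod (m * n) = (1 * n) mod (m * n)"
    using zeta_power_eq_iff[OF f_pos] f by (simp add: mult.commute)
  then have am: "a mod m = 1 mod m" using mn(2)
    by (simp only: mod_mult_mult2) (metis mult_cancel2 neq0_conv)
  \<comment> \<open>Modulo 1 - z^m exponents of z matter only modulo m, so z^a and z agree.\<close>
  have z_mod: "scong S ?d (z ^ c) (z ^ (c mod m))" for c
  proof -
    have "scong S ?d (z ^ (m * (c div m)) * z ^ (c mod m)) (1 * z ^ (c mod m))"
      by (intro scong_mult R zeta_scong_1 scong_refl sring_1 sring_power z_S)
    then show ?thesis by (simp flip: power_add)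
  qed
  have "scong S ?d (z ^ a) (z ^ 1)"
    using z_mod[of a] z_mod[of 1] am scong_trans[OF R] scong_sym[OF R] by metis
  then have za: "scong S ?d (z ^ a) z" by simp
  obtain g where g: "g \<in> poly_over \<int>" "y = poly g z" using y by (auto simp: adjoin_def)
  then have "g \<in> poly_over \<rat>" "g \<in> poly_over S"
    using poly_over_mono[OF Ints_subset_Rats] poly_over_mono[OF Ints_subset_sring[OF R]] by auto
  then show ?thesis
    using cmap_poly_Rats[OF a(2)] g scong_poly[OF R _ za sring_power[OF R z_S] z_S] by auto
qed

lemma ramified_trace:
  assumes l: "Factorial_Ring.prime l" and f: "f = l ^ k * m" "k > 0" "\<not> l dvd m"
    and a: "a \<in> conj_exps (adjoin \<rat> (zeta m))" "a \<in> conj_exps \<rat>" and y: "y \<in> S"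
    and T: "(\<Sum>i<l. (cmap a ^^ i) y) = of_int T"
  shows "int l dvd T"
proof -
  note R = S_sring
  let ?d = "1 - z ^ m"
  note d = prime_element_ramified[OF l f]
  have "scong S ?d ((cmap a ^^ i) y) y" for i
  proof (induction i)
    case (Suc i)
    have "scong S ?d (cmap a ((cmap a ^^ i) y)) ((cmap a ^^ i) y)"
      by (intro cmap_inertia[OF f(1) a] funpow_cmap_in_S a(2) y)
    then show ?case using scong_trans[OF R _ Suc.IH] by simp
  qed (simp add: scong_refl[OF R])
  then have "scong S ?d (of_int T) (\<Sum>i<l. y)" unfolding T[symmetric] by (intro scong_sum R)
  moreover have "scong S ?d (of_nat l * y) (0 * y)"
    by (intro scong_mult R d(3) scong_refl sring_0 y)
  ultimately have "scong S ?d (of_int T) 0" using scong_trans[OF R] by simp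
  then show ?thesis using d(4) scong_int_radical[OF l] by blast
qed

lemma sum_roots_of_unity:
  assumes "(w::complex) ^ f = 1"
  shows "(\<Sum>j<f. w ^ j) = (if w = 1 then of_nat f else 0)"
  using assms f_pos by (auto simp: sum_gp_strict)

text \<open>Fourier inversion: if the traces of all \<open>\<Sum>\<^sub>h \<zeta>\<^bsup>jh\<^esup>\<close> are divisible by \<open>p\<close>, then so is
  \<open>\<Sum>\<^sub>j \<zeta>\<^bsup>-j\<^esup> Tr(\<Sum>\<^sub>h \<zeta>\<^bsup>jh\<^esup>) = f\<close>.\<close>

lemma unramified_trace:
  assumes F: "sfield F" "F \<subseteq> K" and a: "a \<in> conj_exps \<rat>" and p: "p > 0"
    and move: "\<And>i. 0 < i \<Longrightarrow> i < p \<Longrightarrow> \<exists>y\<in>F. (cmap a ^^ i) y \<noteq> y"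
    and T: "\<And>y. y \<in> F \<Longrightarrow> y \<in> S \<Longrightarrow> \<exists>T. int p dvd T \<and> (\<Sum>i<p. (cmap a ^^ i) y) = of_int T"
  shows "p dvd f"
proof -
  note R = S_sring
  note E = conj_exps_Rats[OF F(1)]
  define H where "H = conj_exps F"
  \<comment> \<open>The identity has exponent \<open>1 mod f\<close> rather than 1: exponents lie
    below f, and f may be 1.\<close>
  have one: "1 mod f \<in> H"
    using f_pos zeta_power_mod[OF f_pos, of 1] by (auto simp: H_def conj_exps_def)
  define t where "t = (\<lambda>j. \<Sum>h\<in>H. cmap h (z ^ j))"
  have zjK: "z ^ j \<in> K" for j by (intro sring_power K_sring z_K)
  have t: "t j \<in> F" "t j \<in> S" for j
    unfolding t_def H_def
    by (intro conj_sum_in_subfield F zjK, intro sring_sum R cmap_in_S E sring_power z_S)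
  have tr: "(cmap a ^^ i) (t j) = (\<Sum>h\<in>H. z ^ (a ^ i * (h * j)))" for i j
  proof -
    have "(cmap a ^^ i) (t j) = (\<Sum>h\<in>H. (cmap a ^^ i) (cmap h (z ^ j)))"
      unfolding t_def H_def by (intro funpow_cmap_sum a cmap_in_K E zjK)
    also have "\<dots> = (\<Sum>h\<in>H. z ^ (a ^ i * (h * j)))"
    proof (intro sum.cong refl)
      fix h assume "h \<in> H"
      then have "cmap h (z ^ j) = poly [:0, 1:] (z ^ (h * j))"
        using cmap_z_power[OF E] by (simp add: H_def)
      moreover have "[:0, 1:] \<in> poly_over (\<rat> :: complex set)"
        by (simp add: poly_over_pCons poly_over_0 sfield_sring[OF sfield_Rats])
      ultimately show "(cmap a ^^ i) (cmap h (z ^ j)) = z ^ (a ^ i * (h * j))"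
        using cmap_iterate[OF a, of "[:0, 1:]" i "h * j"] by simp
    qed
    finally show ?thesis .
  qed
  have "\<forall>j. \<exists>T. int p dvd T \<and> (\<Sum>i<p. (cmap a ^^ i) (t j)) = of_int T" using T t by blast
  then obtain T where T: "\<And>j. int p dvd T j" "\<And>j. (\<Sum>i<p. (cmap a ^^ i) (t j)) = of_int (T j)"
    by metis
  have z_inv: "z ^ (f - 1) * z = 1" using z_f f_pos by (metis power_minus_mult)
  \<comment> \<open>Exponent f - 1 stands for -1. If a^i h fixed z, then h would carry the i-th
    image of y back to y; but that image lies in F and is fixed by h, so the i-th power of a would
    be trivial on F, which \<open>move\<close> excludes for 0 < i < p. Only the pair of identities
    survives the Fourier sum.\<close>
  have pair: "z ^ (f - 1) * z ^ (a ^ i * h) = 1 \<longleftrightarrow> i = 0 \<and> h = 1 mod f" if i: "i < p" and h: "h \<in> H" for i h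
  proof -
    have hf: "h < f" using h by (auto simp: H_def conj_exps_def)
    have "z \<noteq> 0" using z_inv by auto
    have *: "z ^ (f - 1) * z ^ (a ^ i * h) = 1 \<longleftrightarrow> z ^ (a ^ i * h) = z"
      using z_inv \<open>z \<noteq> 0\<close> by (metis mult.commute mult_left_cancel mult_zero_left zero_neq_one)
    have "i = 0 \<and> h = 1 mod f" if eq: "z ^ (a ^ i * h) = z"
    proof -
      have "i = 0"
      proof (rule ccontr)
        assume "i \<noteq> 0"
        then obtain y where y: "y \<in> F" "(cmap a ^^ i) y \<noteq> y" using move i by blast
        have yK: "y \<in> K" using y F by auto
        obtain g where g: "g \<in> poly_over \<rat>" "y = poly g z" using yK by (rule K_cases)
        have h': "h \<in> conj_exps F" using h by (simp add: H_def)
        have "cmap h ((cmap a ^^ i) y) = (cmap a ^^ i) y"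
          by (intro cmap_fix[OF F h'] funpow_cmap_in_subfield F a y)
        moreover have "(cmap a ^^ i) y = poly g (z ^ (a ^ i))"
          using cmap_iterate[OF a g(1), of i 1] g(2) by simp
        moreover have "cmap h (poly g (z ^ (a ^ i))) = poly g (z ^ (a ^ i * h))"
          using cmap_poly_power[OF E[OF h'] g(1)] by (simp add: mult.commute)
        ultimately show False using eq g(2) y(2) by simp
      qed
      moreover have "h = 1 mod f"
        using eq \<open>i = 0\<close> zeta_power_eq_iff[OF f_pos, of h 1] hf by simp
      ultimately show ?thesis by simp
    qed
    moreover have "z ^ (a ^ i * h) = z" if "i = 0 \<and> h = 1 mod f"
      using that zeta_power_mod[OF f_pos, of 1] by simp
    ultimately show ?thesis using * by blast
  qed
  have finH: "finite H" by (simp add: H_def finite_conj_exps)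
  have "(\<Sum>j<f. (z ^ (f - 1)) ^ j * of_int (T j)) =
      (\<Sum>j<f. \<Sum>i<p. \<Sum>h\<in>H. (z ^ (f - 1) * z ^ (a ^ i * h)) ^ j)"
    unfolding T(2)[symmetric] tr sum_distrib_left
    by (intro sum.cong refl) (simp add: power_mult_distrib mult.assoc flip: power_mult)
  also have "\<dots> = (\<Sum>i<p. \<Sum>j<f. \<Sum>h\<in>H. (z ^ (f - 1) * z ^ (a ^ i * h)) ^ j)"
    by (rule sum.swap)
  also have "\<dots> = (\<Sum>i<p. \<Sum>h\<in>H. \<Sum>j<f. (z ^ (f - 1) * z ^ (a ^ i * h)) ^ j)"
    by (intro sum.cong refl sum.swap)
  also have "\<dots> = (\<Sum>i<p. \<Sum>h\<in>H. if i = 0 then if h = 1 mod f then of_nat f else 0 else 0)"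
  proof (intro sum.cong refl)
    fix i h assume ih: "i \<in> {..<p}" "h \<in> H"
    have "(z ^ (f - 1) * z ^ (a ^ i * h)) ^ f = 1"
      using z_f by (simp add: power_mult_distrib flip: power_mult) (simp add: mult.commute power_mult)
    then show "(\<Sum>j<f. (z ^ (f - 1) * z ^ (a ^ i * h)) ^ j) =
        (if i = 0 then if h = 1 mod f then of_nat f else 0 else 0)"
      using sum_roots_of_unity pair[of i h] ih by auto
  qed
  also have "\<dots> = (\<Sum>i<p. if i = 0 then of_nat f else 0)"
  proof (intro sum.cong refl)
    fix i
    show "(\<Sum>h\<in>H. if i = 0 then if h = 1 mod f then of_nat f else 0 else 0) =
        (if i = 0 then of_nat f else (0 :: complex))"
      by (cases "i = 0") (simp_all only: simp_thms if_True if_False sum.delta[OF finH] one sum.neutral_const)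
  qed
  also have "\<dots> = of_nat f" using p by simp
  finally have "(of_nat f :: complex) = (\<Sum>j<f. (z ^ (f - 1)) ^ j * of_int (T j))" ..
  moreover have "scong S (of_nat p) (\<Sum>j<f. (z ^ (f - 1)) ^ j * of_int (T j)) (\<Sum>j<f. 0)"
  proof (intro scong_sum R)
    fix j
    obtain n where "T j = int p * n" using T(1) by (auto simp: dvd_def)
    then show "scong S (of_nat p) ((z ^ (f - 1)) ^ j * of_int (T j)) 0"
      unfolding scong_def
      by (intro bexI[of _ "(z ^ (f - 1)) ^ j * of_int n"] sring_mult sring_power sring_of_int R z_S) auto
  qed
  ultimately have "scong S (of_nat p) (of_int (int f)) 0" by simp
  then have "int p dvd int f" using scong_nat_int p by blast
  then show ?thesis by simp
qed

section \<open>Irreducibility of the cyclotomic polynomial of prime index\<close>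

lemma one_minus_zeta_power_scong: "scong S (1 - z) (1 - z ^ c) 0"
proof -
  obtain s where "s \<in> S" "z ^ c - 1 = (1 - z) * s"
    using zeta_scong_1[of 1 c] by (auto simp: scong_def)
  then have "1 - z ^ c - 0 = (1 - z) * (- s)" by (simp add: algebra_simps)
  then show ?thesis unfolding scong_def using sring_uminus[OF S_sring \<open>s \<in> S\<close>] by blast
qed

lemma poly_eq_0_of_roots:
  assumes deg: "degree u < f - 1" and root: "\<And>a. a \<in> {1..<f} \<Longrightarrow> poly u (z ^ a) = 0"
  shows "u = 0"
proof (rule ccontr)
  assume u0: "u \<noteq> 0"
  have "inj_on (\<lambda>a. z ^ a) {1..<f}" using zeta_bij_betw[OF f_pos]
    by (auto simp: bij_betw_def intro: inj_on_subset)
  then have "f - 1 = card ((\<lambda>a. z ^ a) ` {1..<f})" by (simp add: card_image)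
  also have "\<dots> \<le> card {x. poly u x = 0}"
    by (intro card_mono poly_roots_finite u0) (use root in auto)
  also have "\<dots> \<le> degree u" by (rule card_poly_roots_bound[OF u0])
  finally show False using deg by simp
qed

text \<open>Both \<open>N = \<Prod>\<^bsub>a\<in>E\<^esub> (1 - \<zeta>\<^sup>a)\<close>, the norm of \<open>1 - \<zeta>\<close>, and the cofactor \<open>p / N\<close> are integers;
  if both products were nonempty, both would lie in \<open>(1 - \<zeta>) \<inter> \<int> = p\<int>\<close>.\<close>

lemma conj_exps_Rats_prime:
  assumes p: "Factorial_Ring.prime f"
  shows "conj_exps \<rat> = {1..<f}"
proof -
  note R = S_sring
  define E where "E = conj_exps \<rat>"
  have f1: "f > 1" using p prime_gt_1_nat by blast
  have z1: "z \<noteq> 1" using zeta_power_eq_1_iff[OF f_pos, of 1] f1 by auto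
  define \<Phi> :: "complex poly" where "\<Phi> = (\<Sum>i<f. monom 1 i)"
  have \<Phi>: "poly \<Phi> w = (\<Sum>i<f. w ^ i)" for w by (simp add: \<Phi>_def poly_sum poly_monom)
  have c\<Phi>: "coeff \<Phi> i = (if i < f then 1 else 0)" for i
    by (simp add: \<Phi>_def coeff_sum)
  have \<Phi>Q: "\<Phi> \<in> poly_over \<rat>" by (auto simp: poly_over_def c\<Phi>)
  have root: "poly \<Phi> (z ^ a) = 0" if "a \<in> {1..<f}" for a
  proof -
    have "z ^ a \<noteq> 1" using zeta_power_eq_1_iff[OF f_pos, of a] that by (auto dest: dvd_imp_le)
    moreover have "(z ^ a) ^ f = 1" using z_f by (metis mult.commute power_mult power_one)
    ultimately show ?thesis using sum_roots_of_unity[of "z ^ a"] by (simp add: \<Phi>)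
  qed
  have "poly \<Phi> z = 0" using root[of 1] f1 by simp
  have E_sub: "E \<subseteq> {1..<f}"
  proof
    fix a assume a: "a \<in> E"
    have "a \<noteq> 0"
    proof
      assume "a = 0"
      then have "poly \<Phi> 1 = 0" using a \<open>poly \<Phi> z = 0\<close> \<Phi>Q by (auto simp: E_def conj_exps_def)
      then show False using f_pos by (simp add: \<Phi>)
    qed
    then show "a \<in> {1..<f}" using a by (auto simp: E_def conj_exps_def)
  qed
  define \<Psi> :: "complex poly" where "\<Psi> = (\<Prod>a\<in>{1..<f}. [:- (z ^ a), 1:])"
  \<comment> \<open>Both are monic of degree f - 1 with the same f - 1 roots, so their difference
    has too many roots for its degree. Evaluation at 1 then gives f as the product of all 1 -
    z^a.\<close>
  have "\<Phi> = \<Psi>"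
  proof (rule ccontr)
    assume "\<Phi> \<noteq> \<Psi>"
    then have n0: "\<Phi> - \<Psi> \<noteq> 0" by simp
    have "degree \<Psi> = f - 1"
      unfolding \<Psi>_def by (subst degree_prod_eq_sum_degree) auto
    moreover have "lead_coeff \<Psi> = 1" unfolding \<Psi>_def by (simp add: lead_coeff_prod)
    ultimately have \<Psi>c: "coeff \<Psi> (f - 1) = 1" "degree \<Psi> \<le> f - 1" by auto
    have "degree \<Phi> \<le> f - 1" by (rule degree_le) (auto simp: c\<Phi>)
    then have "degree (\<Phi> - \<Psi>) \<le> f - 1" using \<Psi>c by (intro degree_diff_le)
    moreover have "coeff (\<Phi> - \<Psi>) (f - 1) = 0" using \<Psi>c f_pos by (simp add: c\<Phi>)
    ultimately have "degree (\<Phi> - \<Psi>) < f - 1" using n0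
      by (metis le_neq_implies_less leading_coeff_0_iff)
    moreover have "poly (\<Phi> - \<Psi>) (z ^ a) = 0" if a: "a \<in> {1..<f}" for a
    proof -
      have "poly \<Psi> (z ^ a) = 0" unfolding \<Psi>_def poly_prod using a by (intro prod_zero) auto
      then show ?thesis using root[OF a] by simp
    qed
    ultimately have "\<Phi> - \<Psi> = 0" by (rule poly_eq_0_of_roots)
    then show False using n0 by simp
  qed
  then have "poly \<Phi> 1 = poly \<Psi> 1" by simp
  then have prod_eq: "(\<Prod>a\<in>{1..<f}. 1 - z ^ a) = of_nat f" by (simp add: \<Phi> \<Psi>_def poly_prod)
  define N where "N = (\<Prod>a\<in>E. 1 - z ^ a)"
  define N' where "N' = (\<Prod>a\<in>{1..<f} - E. 1 - z ^ a)"
  have NN: "N * N' = of_nat f"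
    unfolding N_def N'_def prod_eq[symmetric] using E_sub
    by (metis finite_atLeastLessThan mult.commute prod.subset_diff)
  have S_prod: "(\<Prod>a\<in>A. 1 - z ^ a) \<in> S" for A
    by (induction A rule: infinite_finite_induct) (auto intro!: sring_mult sring_1 sring_diff sring_power R z_S)
  have small: "scong S (1 - z) (\<Prod>a\<in>A. 1 - z ^ a) 0" if A: "A \<noteq> {}" "finite A" for A
  proof -
    obtain a where a: "a \<in> A" using A(1) by blast
    have "scong S (1 - z) ((1 - z ^ a) * (\<Prod>a\<in>A - {a}. 1 - z ^ a)) (0 * (\<Prod>a\<in>A - {a}. 1 - z ^ a))"
      by (intro scong_mult R one_minus_zeta_power_scong scong_refl sring_0 S_prod)
    then show ?thesis using prod.remove[OF A(2) a, of "\<lambda>a. 1 - z ^ a"] by simp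
  qed
  have rad: "\<exists>t. scong S (of_nat f) ((1 - z) ^ t) 0"
    using prime_element_ramified(4)[OF p, of 1 1] f1 by simp
  have "N \<in> \<rat>"
  proof (rule conj_fixed_in_subfield[OF sfield_Rats Rats_subset_K])
    show "N \<in> K" using S_prod S_subset_K by (auto simp: N_def)
    fix b assume b: "b \<in> conj_exps \<rat>"
    have in_K: "1 - z ^ a \<in> K" for a by (intro sring_diff sring_1 sring_power K_sring z_K)
    have one_z: "cmap b (1 - z ^ a) = 1 - z ^ (b * a mod f)" for a
    proof -
      have "[:1, -1:] \<in> poly_over (\<rat> :: complex set)"
        by (simp add: poly_over_pCons poly_over_0 sfield_sring[OF sfield_Rats])
      from cmap_poly_power[OF b this, of a] show ?thesis by (simp add: zeta_power_mod[OF f_pos])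
    qed
    have "cmap b N = (\<Prod>a\<in>E. cmap b (1 - z ^ a))"
      unfolding N_def using cmap_prod[OF b, of E "\<lambda>a. 1 - z ^ a"] in_K by simp
    also have "\<dots> = (\<Prod>a\<in>E. 1 - z ^ (b * a mod f))" by (simp add: one_z)
    also have "\<dots> = N"
      unfolding N_def E_def by (rule prod.reindex_bij_betw[OF conj_exps_bij[OF sfield_Rats b]])
    finally show "cmap b N = N" .
  qed
  then have "N \<in> \<int>" using S_rat_int S_prod by (auto simp: N_def)
  then obtain n where n: "N = of_int n" by (auto elim: Ints_cases)
  have "E \<noteq> {}"
  proof -
    have "1 \<in> E" using f1 by (auto simp: E_def conj_exps_def)
    then show ?thesis by auto
  qed
  moreover have "finite E" by (simp add: E_def finite_conj_exps)
  ultimately have "scong S (1 - z) N 0" unfolding N_def by (rule small)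
  then have fn: "int f dvd n" using rad n scong_int_radical[OF p] by metis
  have "N \<noteq> 0" using NN f_pos by auto
  then have "N' = of_nat f / N" using NN by (simp add: field_simps)
  then have "N' \<in> \<rat>" using \<open>N \<in> \<rat>\<close> by simp
  then have "N' \<in> \<int>" using S_rat_int S_prod by (auto simp: N'_def)
  then obtain n' where n': "N' = of_int n'" by (auto elim: Ints_cases)
  have "of_int (n * n') = (of_int (int f) :: complex)" using NN n n' by simp
  then have nn': "n * n' = int f" by (simp only: of_int_eq_iff)
  have "{1..<f} - E = {}"
  proof (rule ccontr)
    assume "{1..<f} - E \<noteq> {}"
    then have "scong S (1 - z) N' 0" unfolding N'_def by (intro small) auto
    then have "int f dvd n'" using rad n' scong_int_radical[OF p] by metis
    with fn have "int f * int f dvd int f" unfolding nn'[symmetric] by (rule mult_dvd_mono)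
    then show False using f1 by (simp flip: of_nat_mult)
  qed
  then show ?thesis using E_sub by (auto simp: E_def)
qed

text \<open>Subtracting the last coefficient times 1 + z + ... + z^(f-1) = 0 leaves a polynomial of
  degree below f - 1 that vanishes at all f - 1 conjugates of z, hence is zero.\<close>

lemma prime_relation_constant:
  assumes p: "Factorial_Ring.prime f"
    and c: "\<And>i. c i \<in> \<rat>" and rel: "(\<Sum>i<f. c i * z ^ i) = 0" and i: "i < f"
  shows "c i = c 0"
proof -
  have f1: "f > 1" using p prime_gt_1_nat by blast
  define e where "e = c (f - 1)"
  define u where "u = (\<Sum>i<f. monom (c i - e) i)"
  have cu: "coeff u i = (if i < f then c i - e else 0)" for i
    by (simp add: u_def coeff_sum)
  have uQ: "u \<in> poly_over \<rat>" by (auto simp: poly_over_def cu e_def intro!: Rats_diff c)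
  have "z \<noteq> 1" using zeta_power_eq_1_iff[OF f_pos, of 1] f1 by auto
  then have "(\<Sum>i<f. z ^ i) = 0" using sum_roots_of_unity[OF z_f] by simp
  then have uz: "poly u z = 0"
    using rel by (simp add: u_def poly_sum poly_monom left_diff_distrib sum_subtractf flip: sum_distrib_left)
  have "u = 0"
  proof (rule ccontr)
    assume u0: "u \<noteq> 0"
    have "degree u \<le> f - 1" by (rule degree_le) (auto simp: cu)
    moreover have "coeff u (f - 1) = 0" using f_pos by (simp add: cu e_def)
    ultimately have du: "degree u < f - 1" using u0
      by (metis le_neq_implies_less leading_coeff_0_iff)
    have "u = 0"
      using uQ uz conj_exps_Rats_prime[OF p]
      by (intro poly_eq_0_of_roots[OF du]) (auto simp: conj_exps_def)
    then show False using u0 by simp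
  qed
  then have "c i = e" if "i < f" for i using cu[of i] that by simp
  then show ?thesis using i f_pos by simp
qed

end

section \<open>Galois extensions of prime degree\<close>

lemma field_alg_simps [simp]:
  "carrier field_alg = UNIV" "mult field_alg = (*)" "one field_alg = 1"
  "zero field_alg = 0" "add field_alg = (+)" "module.smult field_alg = (\<lambda>q x. of_rat q * x)"
  by (simp_all add: field_alg_def)

lemma field_field_alg: "field (field_alg :: (rat, 'a::field_char_0) module)"
proof -
  have "cring (field_alg :: (rat, 'a) module)"
    by (intro cringI abelian_groupI comm_monoidI)
      (auto simp: algebra_simps intro: exI[of _ "- x" for x] add.right_inverse)
  then show ?thesis
  proof (rule cring.cring_fieldI)
    show "Units (field_alg :: (rat, 'a) module) = carrier field_alg - {\<zero>\<^bsub>field_alg\<^esub>}"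
      by (auto simp: Units_def) (metis left_inverse right_inverse)
  qed
qed

lemma field_alg_a_inv [simp]: "\<ominus>\<^bsub>field_alg\<^esub> x = - (x :: 'a::field_char_0)"
proof -
  interpret field "field_alg :: (rat, 'a) module" by (rule field_field_alg)
  show ?thesis using minus_equality[of "- x" x] by simp
qed

lemma field_alg_m_inv: "x \<noteq> 0 \<Longrightarrow> inv\<^bsub>field_alg\<^esub> x = inverse (x :: 'a::field_char_0)"
proof -
  interpret field "field_alg :: (rat, 'a) module" by (rule field_field_alg)
  show "x \<noteq> 0 \<Longrightarrow> inv\<^bsub>field_alg\<^esub> x = inverse x" using inv_char[of x "inverse x"] by simp
qed

lemma subfield_field_alg_iff:
  fixes L :: "'a::field_char_0 set"
  shows "subfield L field_alg \<longleftrightarrow> sfield L"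
proof
  interpret field "field_alg :: (rat, 'a) module" by (rule field_field_alg)
  assume L: "subfield L field_alg"
  have *: "inverse x \<in> L" if "x \<in> L" for x
    using subfield_m_inv(1)[OF L, of x] that field_alg_m_inv[of x] by (cases "x = 0") auto
  note S = subfieldE(1)[OF L]
  have "x - y \<in> L" if "x \<in> L" "y \<in> L" for x y
    using subringE(7)[OF S that(1)] subringE(5)[OF S that(2)] by force
  moreover have "x * y \<in> L" if "x \<in> L" "y \<in> L" for x y
    using subringE(6)[OF S that] by simp
  moreover have "1 \<in> L" using subringE(3)[OF S] by simp
  ultimately show "sfield L" using * by (auto simp: sfield_def sring_def)
next
  interpret field "field_alg :: (rat, 'a) module" by (rule field_field_alg)
  assume L: "sfield L"
  note R = sfield_sring[OF L]
  show "subfield L field_alg"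
  proof (rule subfieldI'[OF subringI])
    fix k assume "k \<in> L - {\<zero>\<^bsub>field_alg\<^esub>}"
    then show "inv\<^bsub>field_alg\<^esub> k \<in> L" using sfield_inverse[OF L] by (simp add: field_alg_m_inv)
  qed (auto intro: sring_1[OF R] sring_uminus[OF R] sring_mult[OF R] sring_add[OF R])
qed

lemma cyclotomic_field_eq:
  assumes "n > 0"
  shows "cyclotomic_field n = adjoin \<rat> (zeta n)"
proof
  interpret cyclotomic n by unfold_locales (rule assms)
  let ?G = "generate_field field_alg {zeta n}"
  show "cyclotomic_field n \<subseteq> K"
  proof
    fix x assume "x \<in> cyclotomic_field n"
    then show "x \<in> K" unfolding cyclotomic_field_def
      by (induction rule: generate_field.induct)
        (auto simp: field_alg_m_inv z_K intro: sring_1[OF K_sring] sring_uminus[OF K_sring]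
          sring_mult[OF K_sring] sring_add[OF K_sring] sfield_inverse[OF K_sfield])
  qed
  have minus: "- x \<in> ?G" if "x \<in> ?G" for x
    using generate_field.a_inv[OF that] by simp
  have add: "x + y \<in> ?G" if "x \<in> ?G" "y \<in> ?G" for x y
    using generate_field.eng_add[OF that] by simp
  have one: "1 \<in> ?G" using generate_field.one[of field_alg] by simp
  have "sfield ?G" unfolding sfield_def sring_def
  proof (intro conjI ballI one)
    fix x y assume xy: "x \<in> ?G" "y \<in> ?G"
    show "x - y \<in> ?G" using add[OF xy(1) minus[OF xy(2)]] by simp
    show "x * y \<in> ?G" using generate_field.eng_mult[OF xy] by simp
  next
    fix x assume x: "x \<in> ?G"
    show "inverse x \<in> ?G"
    proof (cases "x = 0")
      case False
      then show ?thesis using generate_field.m_inv[OF x] by (simp add: field_alg_m_inv)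
    qed (use x in simp)
  qed
  then show "K \<subseteq> cyclotomic_field n"
    unfolding cyclotomic_field_def
    by (intro adjoin_least sfield_sring Rats_subset_sfield generate_field.incl) auto
qed

lemma cyclotomic_integers_eq: "cyclotomic_integers n = adjoin \<int> (zeta n)"
proof
  let ?G = "generate_ring field_alg {zeta n}"
  have S: "sring (adjoin \<int> (zeta n))" by (rule sring_adjoin[OF sring_Ints])
  show "cyclotomic_integers n \<subseteq> adjoin \<int> (zeta n)"
  proof
    fix x assume "x \<in> cyclotomic_integers n"
    then show "x \<in> adjoin \<int> (zeta n)" unfolding cyclotomic_integers_def
      by (induction rule: generate_ring.induct)
        (auto simp: in_adjoin_self sring_Ints
          intro: sring_1[OF S] sring_uminus[OF S] sring_mult[OF S] sring_add[OF S])
  qed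
  have minus: "- x \<in> ?G" if "x \<in> ?G" for x
    using generate_ring.a_inv[OF that] by simp
  have add: "x + y \<in> ?G" if "x \<in> ?G" "y \<in> ?G" for x y
    using generate_ring.eng_add[OF that] by simp
  have one: "1 \<in> ?G" using generate_ring.one[of field_alg] by simp
  have "sring ?G" unfolding sring_def
  proof (intro conjI ballI one)
    fix x y assume xy: "x \<in> ?G" "y \<in> ?G"
    show "x - y \<in> ?G" using add[OF xy(1) minus[OF xy(2)]] by simp
    show "x * y \<in> ?G" using generate_ring.eng_mult[OF xy] by simp
  qed
  then show "adjoin \<int> (zeta n) \<subseteq> cyclotomic_integers n"
    unfolding cyclotomic_integers_def
    by (intro adjoin_least Ints_subset_sring generate_ring.incl) auto
qed

text \<open>The list is reversed because spans and independence recurse on the head, which should be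
  the highest power.\<close>

abbreviation pows :: "'a::field_char_0 \<Rightarrow> nat \<Rightarrow> 'a list" where
  "pows x n \<equiv> rev (map (\<lambda>i. x ^ i) [0..<n])"

text \<open>The bound is put on coefficients and not on the degree, so that n = 0 leaves only the
  zero polynomial.\<close>

lemma Span_pows:
  fixes x :: "'a::field_char_0"
  assumes F: "sfield F"
  shows "ring.Span field_alg F (pows x n) = (\<lambda>g. poly g x) ` {g \<in> poly_over F. \<forall>i\<ge>n. coeff g i = 0}"
proof -
  interpret field "field_alg :: (rat, 'a) module" by (rule field_field_alg)
  note R = sfield_sring[OF F]
  show ?thesis
  proof (induction n)
    case 0
    have "{g \<in> poly_over F. \<forall>i\<ge>0. coeff g i = 0} = {0}"
      by (auto simp: poly_eq_iff poly_over_0[OF R])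
    then show ?case by simp
  next
    case (Suc n)
    let ?P = "\<lambda>n. {g \<in> poly_over F. \<forall>i\<ge>n. coeff g i = 0}"
    have "Span F (pows x (Suc n)) = line_extension F (x ^ n) (Span F (pows x n))" by simp
    also have "\<dots> = {k * x ^ n + v | k v. k \<in> F \<and> v \<in> Span F (pows x n)}"
      unfolding set_eq_iff mem_Collect_eq line_extension_mem_iff field_alg_simps by blast
    also have "\<dots> = (\<lambda>g. poly g x) ` ?P (Suc n)" unfolding Suc.IH
    proof (intro equalityI subsetI)
      fix y assume "y \<in> {k * x ^ n + v | k v. k \<in> F \<and> v \<in> (\<lambda>g. poly g x) ` ?P n}"
      then obtain k g where kg: "k \<in> F" "g \<in> ?P n" "y = k * x ^ n + poly g x" by auto
      then have "monom k n + g \<in> ?P (Suc n)" by (auto intro!: poly_over_add poly_over_monom R)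
      moreover have "y = poly (monom k n + g) x" using kg by (simp add: poly_monom)
      ultimately show "y \<in> (\<lambda>g. poly g x) ` ?P (Suc n)" by blast
    next
      fix y assume "y \<in> (\<lambda>g. poly g x) ` ?P (Suc n)"
      then obtain g where g: "g \<in> ?P (Suc n)" "y = poly g x" by auto
      define u where "u = g - monom (coeff g n) n"
      have c: "coeff g n \<in> F" using g by (auto simp: poly_over_def)
      have "u \<in> ?P n"
        using g c by (auto simp: u_def intro!: poly_over_diff poly_over_monom R)
      moreover have "y = coeff g n * x ^ n + poly u x" using g by (simp add: u_def poly_monom)
      ultimately show "y \<in> {k * x ^ n + v | k v. k \<in> F \<and> v \<in> (\<lambda>g. poly g x) ` ?P n}"
        using c by blast
    qed
    finally show ?case .
  qed
qed

lemma independent_pows: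
  fixes x :: "'a::field_char_0"
  assumes F: "sfield F" and min: "\<And>g. g \<in> poly_over F \<Longrightarrow> g \<noteq> 0 \<Longrightarrow> poly g x = 0 \<Longrightarrow> n \<le> degree g"
  shows "ring.independent field_alg F (pows x n)"
proof -
  interpret field "field_alg :: (rat, 'a) module" by (rule field_field_alg)
  have "m \<le> n \<Longrightarrow> independent F (pows x m)" for m
  proof (induction m)
    case (Suc m)
    have "x ^ m \<notin> Span F (pows x m)"
    proof
      assume "x ^ m \<in> Span F (pows x m)"
      then obtain g where g: "g \<in> poly_over F" "\<forall>i\<ge>m. coeff g i = 0" "x ^ m = poly g x"
        unfolding Span_pows[OF F] by auto
      define u where "u = monom 1 m - g"
      have "u \<in> poly_over F" unfolding u_def
        by (intro poly_over_diff poly_over_monom sfield_sring F sring_1 g)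
      moreover have um: "coeff u m = 1" using g by (simp add: u_def)
      then have "u \<noteq> 0" by auto
      moreover have "poly u x = 0" using g by (simp add: u_def poly_monom)
      ultimately have "n \<le> degree u" using min by blast
      moreover have "degree u \<le> m" by (rule degree_le) (use g in \<open>auto simp: u_def\<close>)
      ultimately show False using Suc.prems by simp
    qed
    then show ?case using Suc by (auto simp del: Span.simps intro: li_Cons)
  qed simp
  then show ?thesis by simp
qed

text \<open>Since p + 1 powers of x cannot be independent, x is algebraic. By the tower law its
  degree divides p, and degree 1 would make x rational.\<close>

lemma prime_degree_generator:
  fixes L :: "'a::field_char_0 set"
  assumes L: "sfield L" and dim: "ring.dimension field_alg p \<rat> L" and p: "Factorial_Ring.prime p"
    and x: "x \<in> L" "x \<notin> \<rat>"
  shows "\<exists>h. is_min_poly \<rat> x h \<and> degree h = p \<and> adjoin \<rat> x = L"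
proof -
  interpret field "field_alg :: (rat, 'a) module" by (rule field_field_alg)
  have Q: "sfield (\<rat> :: 'a set)" "subfield (\<rat> :: 'a set) field_alg"
    using sfield_Rats subfield_field_alg_iff by auto
  have pows_L: "set (pows x n) \<subseteq> L" for n
    using x sring_power[OF sfield_sring[OF L]] by auto
  have "\<exists>g\<in>poly_over \<rat>. g \<noteq> 0 \<and> poly g x = 0"
  proof (rule ccontr)
    assume no: "\<not> ?thesis"
    have "independent \<rat> (pows x (Suc p))" by (rule independent_pows[OF Q(1)]) (use no in blast)
    then have "length (pows x (Suc p)) \<le> p"
      using independent_length_le_dimension[OF Q(2) dim _ pows_L] by blast
    then show False by simp
  qed
  then obtain h where h: "is_min_poly \<rat> x h" using min_poly_exists[OF Q(1)] by blast
  define d where "d = degree h"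
  define W where "W = adjoin \<rat> x"
  have W: "sfield W" unfolding W_def by (rule sfield_adjoin[OF Q(1) h])
  have QW: "\<rat> \<subseteq> W" by (rule Rats_subset_sfield[OF W])
  have WL: "W \<subseteq> L" unfolding W_def
    by (rule adjoin_least[OF sfield_sring[OF L] Rats_subset_sfield[OF L] x(1)])
  have ind: "independent \<rat> (pows x d)"
    by (rule independent_pows[OF Q(1)]) (use min_poly_degree_le[OF h] in \<open>auto simp: d_def\<close>)
  have "Span \<rat> (pows x d) = W"
    unfolding Span_pows[OF Q(1)] W_def
  proof (intro equalityI subsetI)
    fix y assume "y \<in> adjoin \<rat> x"
    then obtain g where "g \<in> poly_over \<rat>" "y = poly g x" "degree g < d"
      using adjoin_min_poly_rep[OF Q(1) h] by (auto simp: d_def)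
    then show "y \<in> (\<lambda>g. poly g x) ` {g \<in> poly_over \<rat>. \<forall>i\<ge>d. coeff g i = 0}"
      by (auto intro!: imageI coeff_eq_0)
  qed (auto simp: adjoin_def)
  then have dimW: "dimension d \<rat> W" using dimensionI[OF Q(2) ind] by simp
  \<comment> \<open>A Q-basis of L also spans L over the intermediate field W; this provides the
    finite dimension over W that the tower law needs.\<close>
  obtain Vs where Vs: "set Vs \<subseteq> carrier field_alg" "Span \<rat> Vs = L"
    using exists_base[OF Q(2) dim] by blast
  have WF: "subfield W field_alg" using W subfield_field_alg_iff by auto
  have "finite_dimension W (Span W Vs)" by (rule Span_finite_dimension[OF WF Vs(1)])
  moreover have "Span W Vs = L"
  proof
    have VL: "set Vs \<subseteq> L" using Span_base_incl[OF Q(2) Vs(1)] Vs(2) by simp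
    have LQ: "subalgebra \<rat> L field_alg"
      using finite_dimension_imp_subalgebra[OF Q(2) finite_dimensionI[OF dim]] .
    have "subalgebra W L field_alg"
    proof (intro subalgebra.intro subalgebra_axioms.intro)
      show "subgroup L (add_monoid field_alg)" using LQ by (rule subalgebra.axioms)
      fix k v assume "k \<in> W" "v \<in> L"
      then show "k \<otimes>\<^bsub>field_alg\<^esub> v \<in> L" using WL sring_mult[OF sfield_sring[OF L]] by auto
    qed
    then show "Span W Vs \<subseteq> L" by (rule subalgebra_Span_incl[OF WF _ VL])
    have SW: "subalgebra W (Span W Vs) field_alg" by (rule Span_is_subalgebra[OF WF Vs(1)])
    have "subalgebra \<rat> (Span W Vs) field_alg"
    proof (intro subalgebra.intro subalgebra_axioms.intro)
      show "subgroup (Span W Vs) (add_monoid field_alg)" using SW by (rule subalgebra.axioms)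
      fix k v assume "k \<in> (\<rat> :: 'a set)" "v \<in> Span W Vs"
      then show "k \<otimes>\<^bsub>field_alg\<^esub> v \<in> Span W Vs"
        using subalgebra.smult_closed[OF SW] QW by blast
    qed
    then have "Span \<rat> Vs \<subseteq> Span W Vs"
      by (rule subalgebra_Span_incl[OF Q(2)]) (rule Span_base_incl[OF WF Vs(1)])
    then show "L \<subseteq> Span W Vs" using Vs(2) by simp
  qed
  ultimately obtain m where m: "dimension m W L" by (auto simp: finite_dimension_def)
  have "dimension (d * m) \<rat> L" by (rule telescopic_base[OF Q(2) WF dimW m])
  then have "d * m = p" using dimension_is_inj[OF Q(2) _ dim] by blast
  then have "d = 1 \<or> d = p" using p by (metis dvd_triv_left prime_nat_iff)
  moreover have "d \<noteq> 1"
  proof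
    assume "d = 1"
    then obtain g where g: "g \<in> poly_over \<rat>" "x = poly g x" "degree g < 1"
      using adjoin_min_poly_rep[OF Q(1) h in_adjoin_self[OF sfield_sring[OF Q(1)]]]
      by (auto simp: d_def)
    then obtain c where "g = [:c:]" by (metis degree_eq_zeroE less_one)
    then have "x \<in> \<rat>" using g by (simp add: poly_over_pCons[OF sfield_sring[OF Q(1)]])
    then show False using x by simp
  qed
  ultimately have dp: "d = p" by simp
  have "length (pows x d) = p \<longleftrightarrow> Span \<rat> (pows x d) = L"
    by (rule independent_length_eq_dimension[OF Q(2) dim ind pows_L])
  then have "W = L" using \<open>Span \<rat> (pows x d) = W\<close> dp by simp
  then show ?thesis using h dp by (auto simp: d_def W_def)
qed

section \<open>Groups of prime order and the group of field automorphisms\<close>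

lemma (in group) prime_order_powers:
  assumes p: "Factorial_Ring.prime p" "card (carrier G) = p" and t: "t \<in> carrier G" "t \<noteq> \<one>"
  shows "bij_betw (\<lambda>i::nat. t [^] i) {..<p} (carrier G)" "\<And>i::nat. t [^] i = \<one> \<longleftrightarrow> p dvd i"
proof -
  have fin: "finite (carrier G)" using p prime_gt_0_nat[OF p(1)] by (metis card.infinite less_irrefl)
  have "ord t dvd p" using ord_dvd_group_order[OF t(1)] p(2) by (simp add: order_def)
  then have ord: "ord t = p" using p(1) ord_eq_1[OF t(1)] t(2) by (metis prime_nat_iff)
  have "{0..ord t - 1} = {..<p}" using ord prime_gt_0_nat[OF p(1)] by auto
  then have inj: "inj_on (\<lambda>i::nat. t [^] i) {..<p}" using ord_inj[OF t(1)] by simp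
  moreover have "(\<lambda>i::nat. t [^] i) ` {..<p} = carrier G"
    by (rule card_subset_eq[OF fin]) (use t card_image[OF inj] p(2) in auto)
  ultimately show "bij_betw (\<lambda>i::nat. t [^] i) {..<p} (carrier G)" by (simp add: bij_betw_def)
  show "t [^] i = \<one> \<longleftrightarrow> p dvd i" for i :: nat using pow_eq_id[OF t(1)] ord by simp
qed

text \<open>Fixing the rationals is not demanded, as \<open>hom_fixes_rats\<close> derives it from
  additivity and multiplicativity.\<close>

definition field_aut :: "'a::field set \<Rightarrow> ('a \<Rightarrow> 'a) \<Rightarrow> bool" where
  "field_aut L g \<longleftrightarrow> bij_betw g L L \<and> g 1 = 1 \<and>
     (\<forall>x\<in>L. \<forall>y\<in>L. g (x + y) = g x + g y \<and> g (x * y) = g x * g y)"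

lemma hom_fixes_rats:
  fixes L :: "'a::field_char_0 set" and g :: "'a \<Rightarrow> 'b::field_char_0"
  assumes L: "sfield L" and one: "g 1 = 1"
    and add: "\<And>x y. x \<in> L \<Longrightarrow> y \<in> L \<Longrightarrow> g (x + y) = g x + g y"
    and mult: "\<And>x y. x \<in> L \<Longrightarrow> y \<in> L \<Longrightarrow> g (x * y) = g x * g y"
  shows "g (of_rat q) = of_rat q"
proof -
  note R = sfield_sring[OF L]
  have zero: "g 0 = 0" using add[of 0 0] sring_0[OF R] by simp
  have nat: "g (of_nat n) = of_nat n" for n
    by (induction n) (auto simp: zero one add sring_1[OF R] sring_of_nat[OF R])
  have neg: "g (- x) = - g x" if "x \<in> L" for x
    using add[of x "- x"] that zero sring_uminus[OF R that] by (simp add: add_eq_0_iff)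
  have int: "g (of_int n) = of_int n" for n
    by (cases n rule: int_cases2) (auto simp: nat neg sring_of_nat[OF R])
  obtain a b where ab: "b > 0" "q = Rat.Fract a b" by (cases q rule: Rat_cases) auto
  have qL: "of_rat q \<in> L" using Rats_subset_sfield[OF L] by auto
  have e: "of_rat q * of_int b = (of_int a :: 'c::field_char_0)"
    using ab by (simp add: Fract_of_int_quotient of_rat_divide)
  have "g (of_rat q) * of_int b = of_int a"
    using mult[OF qL sring_of_int[OF R], of b] by (simp only: e int)
  also have "\<dots> = of_rat q * of_int b" by (simp only: e)
  finally show ?thesis using ab(1) by simp
qed

lemma galois_group_carrier:
  fixes L :: "'a::field_char_0 set"
  assumes L: "sfield L"
  shows "g \<in> carrier (galois_group \<rat> L) \<longleftrightarrow> g \<in> extensional L \<and> field_aut L g"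
proof -
  have *: "g \<in> ring_iso (sub_alg L) (sub_alg L) \<longleftrightarrow> field_aut L g" for g
    by (auto simp: ring_iso_def Ring.ring_hom_def field_aut_def bij_betw_def)
  have fix_Q: "g x = x" if g: "field_aut L g" and x: "x \<in> \<rat>" for x
  proof -
    obtain q where "x = of_rat q" using x by (auto elim: Rats_cases)
    then show ?thesis using hom_fixes_rats[OF L, of g q] g by (auto simp: field_aut_def)
  qed
  show ?thesis
    by (auto simp: galois_group_def * Bij_def fix_Q) (auto simp: field_aut_def)
qed

lemma galois_group_mult:
  "g \<in> carrier (galois_group F L) \<Longrightarrow> h \<in> carrier (galois_group F L) \<Longrightarrow>
     g \<otimes>\<^bsub>galois_group F L\<^esub> h = compose L g h"
  by (auto simp: galois_group_def BijGroup_def)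

lemma galois_group_one: "\<one>\<^bsub>galois_group F L\<^esub> = (\<lambda>x\<in>L. x)"
  by (simp add: galois_group_def BijGroup_def)

lemma galois_group_group:
  fixes L :: "'a::field_char_0 set"
  assumes L: "sfield L"
  shows "group (galois_group \<rat> L)"
proof -
  note R = sfield_sring[OF L]
  note iff = galois_group_carrier[OF L]
  interpret B: group "BijGroup L" by (rule group_BijGroup)
  have "subgroup (carrier (galois_group \<rat> L)) (BijGroup L)"
  proof (rule B.subgroupI)
    show "carrier (galois_group \<rat> L) \<subseteq> carrier (BijGroup L)"
      by (auto simp: galois_group_def BijGroup_def)
    have "(\<lambda>x\<in>L. x) \<in> carrier (galois_group \<rat> L)"
      unfolding iff by (auto simp: field_aut_def bij_betw_def inj_on_def intro: sring_1[OF R] sring_add[OF R] sring_mult[OF R])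
    then show "carrier (galois_group \<rat> L) \<noteq> {}" by blast
  next
    fix g assume g: "g \<in> carrier (galois_group \<rat> L)"
    then have gB: "g \<in> Bij L" by (auto simp: galois_group_def)
    have ga: "field_aut L g" using g iff by blast
    have bij: "bij_betw g L L" using ga by (simp add: field_aut_def)
    define h where "h = (\<lambda>x\<in>L. inv_into L g x)"
    have hg: "h x \<in> L" "g (h x) = x" if "x \<in> L" for x
      using that bij by (auto simp: h_def bij_betw_def inv_into_into f_inv_into_f)
    have hI: "h y = x" if "x \<in> L" "g x = y" for x y
      using that bij by (auto simp: h_def bij_betw_def)
    have "field_aut L h"
      unfolding field_aut_def
    proof (intro conjI ballI)
      show "bij_betw h L L" unfolding h_def using bij_betw_inv_into[OF bij] by simp
      show "h 1 = 1" using ga by (intro hI sring_1[OF R]) (auto simp: field_aut_def)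
      fix x y assume xy: "x \<in> L" "y \<in> L"
      have "g (h x + h y) = g (h x) + g (h y)" "g (h x * h y) = g (h x) * g (h y)"
        using ga hg(1)[OF xy(1)] hg(1)[OF xy(2)] by (auto simp: field_aut_def)
      then have "g (h x + h y) = x + y" "g (h x * h y) = x * y" by (simp_all only: hg(2) xy)
      then show "h (x + y) = h x + h y" "h (x * y) = h x * h y"
        using hg(1)[OF xy(1)] hg(1)[OF xy(2)] by (blast intro: hI sring_add[OF R] sring_mult[OF R])+
    qed
    then have "h \<in> carrier (galois_group \<rat> L)" unfolding iff by (simp add: h_def)
    moreover have "inv\<^bsub>BijGroup L\<^esub> g = h" unfolding h_def by (rule inv_BijGroup[OF gB])
    ultimately show "inv\<^bsub>BijGroup L\<^esub> g \<in> carrier (galois_group \<rat> L)" by simp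
  next
    fix g h assume gh: "g \<in> carrier (galois_group \<rat> L)" "h \<in> carrier (galois_group \<rat> L)"
    then have B: "g \<in> Bij L" "h \<in> Bij L" by (auto simp: galois_group_def)
    have hL: "h x \<in> L" if "x \<in> L" for x using B(2) that by (auto simp: Bij_def bij_betw_def)
    have "bij_betw (compose L g h) L L"
      using B by (intro bij_betw_compose[of _ _ L]) (simp_all add: Bij_def)
    moreover have "compose L g h 1 = 1"
    proof -
      have "h 1 = 1" "g 1 = 1" using gh by (auto simp: iff field_aut_def)
      then show ?thesis using sring_1[OF R] by (simp only: compose_eq)
    qed
    moreover have "compose L g h (x + y) = compose L g h x + compose L g h y \<and>
        compose L g h (x * y) = compose L g h x * compose L g h y" if "x \<in> L" "y \<in> L" for x y
    proof -
      have "h (x + y) = h x + h y" "h (x * y) = h x * h y" using gh(2) that by (auto simp: iff field_aut_def)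
      moreover have "g (h x + h y) = g (h x) + g (h y)" "g (h x * h y) = g (h x) * g (h y)"
        using gh(1) hL that by (auto simp: iff field_aut_def)
      ultimately show ?thesis using sring_add[OF R that] sring_mult[OF R that] that
        by (simp only: compose_eq)
    qed
    ultimately have "compose L g h \<in> carrier (galois_group \<rat> L)"
      unfolding iff field_aut_def by simp
    then show "g \<otimes>\<^bsub>BijGroup L\<^esub> h \<in> carrier (galois_group \<rat> L)"
      using B by (simp add: BijGroup_def)
  qed
  from B.subgroup_imp_group[OF this] show ?thesis by (simp add: galois_group_def)
qed

section \<open>Traces of integers and the conductor\<close>

locale prime_galois =
  fixes p :: nat and L :: "'a::field_char_0 set"
  assumes p_prime: "Factorial_Ring.prime p" and galois: "galois_extension \<rat> L p"
begin

abbreviation "G \<equiv> galois_group \<rat> L"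

lemma p_pos: "p > 0" by (rule prime_gt_0_nat[OF p_prime])

lemma L_sfield: "sfield L"
  using galois by (simp add: galois_extension_def subfield_field_alg_iff)

lemma L_sring: "sring L" by (rule sfield_sring[OF L_sfield])

lemma Rats_subset_L: "\<rat> \<subseteq> L" by (rule Rats_subset_sfield[OF L_sfield])

lemma G_fixed: "x \<in> L \<Longrightarrow> (\<And>g. g \<in> carrier G \<Longrightarrow> g x = x) \<Longrightarrow> x \<in> \<rat>"
  using galois by (auto simp: galois_extension_def)

lemmas G_carrier = galois_group_carrier[OF L_sfield]

sublocale G: group G by (rule galois_group_group[OF L_sfield])

lemma G_closed: "g \<in> carrier G \<Longrightarrow> x \<in> L \<Longrightarrow> g x \<in> L"
  and G_1: "g \<in> carrier G \<Longrightarrow> g 1 = 1"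
  and G_add: "g \<in> carrier G \<Longrightarrow> x \<in> L \<Longrightarrow> y \<in> L \<Longrightarrow> g (x + y) = g x + g y"
  and G_mult: "g \<in> carrier G \<Longrightarrow> x \<in> L \<Longrightarrow> y \<in> L \<Longrightarrow> g (x * y) = g x * g y"
  by (auto simp: G_carrier field_aut_def bij_betw_def)

lemma G_rat: "g \<in> carrier G \<Longrightarrow> x \<in> \<rat> \<Longrightarrow> g x = x"
  by (auto elim!: Rats_cases intro!: hom_fixes_rats[OF L_sfield] G_1 G_add G_mult)

lemma G_zero: "g \<in> carrier G \<Longrightarrow> g 0 = 0"
  by (rule G_rat) auto

lemma G_sum: "g \<in> carrier G \<Longrightarrow> (\<And>i. i \<in> I \<Longrightarrow> u i \<in> L) \<Longrightarrow> g (sum u I) = (\<Sum>i\<in>I. g (u i))"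
  by (induction I rule: infinite_finite_induct)
    (auto simp: G_zero G_add sring_sum[OF L_sring])

lemma G_apply_mult: "g \<in> carrier G \<Longrightarrow> h \<in> carrier G \<Longrightarrow> x \<in> L \<Longrightarrow> (g \<otimes>\<^bsub>G\<^esub> h) x = g (h x)"
  by (simp add: galois_group_mult compose_eq)

lemma G_apply_one: "x \<in> L \<Longrightarrow> \<one>\<^bsub>G\<^esub> x = x"
  by (simp add: galois_group_one)

lemma G_neq_one:
  assumes "g \<in> carrier G" "g \<noteq> \<one>\<^bsub>G\<^esub>"
  shows "\<exists>y\<in>L. g y \<noteq> y"
proof (rule ccontr)
  assume no: "\<not> ?thesis"
  have "g \<in> extensional L" using assms(1) by (simp add: G_carrier)
  moreover have "\<one>\<^bsub>G\<^esub> \<in> extensional L" using G.one_closed unfolding G_carrier by blast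
  moreover have "g x = \<one>\<^bsub>G\<^esub> x" if "x \<in> L" for x using no that G_apply_one by auto
  ultimately have "g = \<one>\<^bsub>G\<^esub>" by (rule extensionalityI)
  then show False using assms(2) by simp
qed

lemma G_poly:
  assumes g: "g \<in> carrier G" and u: "u \<in> poly_over \<rat>" and x: "x \<in> L"
  shows "g (poly u x) = poly u (g x)"
  using u
proof (induction u)
  case (pCons a u)
  then have a: "a \<in> \<rat>" and u: "u \<in> poly_over \<rat>"
    by (auto simp: poly_over_pCons[OF sfield_sring[OF sfield_Rats]])
  have "poly u x \<in> L"
    using u x poly_over_mono[OF Rats_subset_L] by (intro poly_in_sring[OF L_sring]) auto
  then show ?case
    using a x pCons.IH[OF u] Rats_subset_L sring_mult[OF L_sring]
    by (auto simp: G_add[OF g] G_mult[OF g] G_rat[OF g])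
qed (simp add: G_zero[OF g])

lemma G_algebraic_int:
  assumes g: "g \<in> carrier G" and x: "x \<in> L" "algebraic_int x"
  shows "algebraic_int (g x)"
proof -
  obtain u where u: "lead_coeff u = 1" "\<forall>i. coeff u i \<in> \<int>" "poly u x = 0"
    using x(2) by (auto elim: algebraic_int.cases)
  then have "u \<in> poly_over \<rat>" using Ints_subset_Rats by (auto simp: poly_over_def)
  then have "poly u (g x) = 0" using G_poly[OF g _ x(1)] u(3) G_zero[OF g] by metis
  then show ?thesis using u by (intro algebraic_int.intros)
qed

lemma generator_exists:
  "\<exists>x h. x \<in> L \<and> x \<notin> \<rat> \<and> is_min_poly \<rat> x h \<and> degree h = p \<and> adjoin \<rat> x = L"
proof -
  interpret field "field_alg :: (rat, 'a) module" by (rule field_field_alg)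
  have dim: "dimension p \<rat> L" and Q: "subfield (\<rat> :: 'a set) field_alg"
    using galois by (auto simp: galois_extension_def)
  have "L \<noteq> \<rat>"
  proof
    assume "L = \<rat>"
    then have "p = 1" using dimension_is_inj[OF Q dim] dimension_one[OF Q] by simp
    then show False using p_prime by simp
  qed
  then obtain x where "x \<in> L" "x \<notin> \<rat>" using Rats_subset_L by blast
  then show ?thesis using prime_degree_generator[OF L_sfield dim p_prime] by blast
qed

lemma G_eqI:
  assumes x: "x \<in> L" "adjoin \<rat> x = L" and gh: "g \<in> carrier G" "h \<in> carrier G" "g x = h x"
  shows "g = h"
proof
  fix y
  show "g y = h y"
  proof (cases "y \<in> L")
    case True
    then obtain u where "u \<in> poly_over \<rat>" "y = poly u x" using x(2) by (auto simp: adjoin_def)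
    then show ?thesis using G_poly[OF _ _ x(1)] gh by metis
  next
    case False
    then show ?thesis using gh by (auto simp: G_carrier extensional_def)
  qed
qed

text \<open>Applying g to the coefficients of a product of linear factors applies g to its roots; a
  product over a whole orbit therefore has coefficients fixed by G.\<close>

lemma G_coeff_prod:
  assumes g: "g \<in> carrier G" and u: "\<And>i. i \<in> I \<Longrightarrow> u i \<in> L"
  shows "coeff (\<Prod>i\<in>I. [:- u i, 1:]) k \<in> L \<and>
    g (coeff (\<Prod>i\<in>I. [:- u i, 1:]) k) = coeff (\<Prod>i\<in>I. [:- g (u i), 1:]) k"
  using u
proof (induction I arbitrary: k rule: infinite_finite_induct)
  case (insert i I)
  define P where "P = (\<Prod>i\<in>I. [:- u i, 1:])"
  define Q where "Q = (\<Prod>i\<in>I. [:- g (u i), 1:])"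
  have IH: "coeff P k \<in> L" "g (coeff P k) = coeff Q k" for k
    using insert by (auto simp: P_def Q_def)
  have ui: "u i \<in> L" "- u i \<in> L" using insert.prems sring_uminus[OF L_sring] by auto
  have neg: "g (- u i) = - g (u i)"
    using G_add[OF g ui] G_zero[OF g] by (simp add: add_eq_0_iff)
  have mem: "- u i * coeff P k \<in> L" for k by (rule sring_mult[OF L_sring ui(2) IH(1)])
  have gm: "g (- u i * coeff P k) = - g (u i) * coeff Q k" for k
    using G_mult[OF g ui(2) IH(1)] neg IH(2) by simp
  have e: "(\<Prod>i\<in>insert i I. [:- u i, 1:]) = [:- u i, 1:] * P"
    "(\<Prod>i\<in>insert i I. [:- g (u i), 1:]) = [:- g (u i), 1:] * Q"
    using insert.hyps by (simp_all add: P_def Q_def)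
  have c: "coeff ([:- a, 1:] * R) k = - a * coeff R k + (case k of 0 \<Rightarrow> 0 | Suc j \<Rightarrow> coeff R j)"
    for a :: 'a and R by (simp add: coeff_pCons split: nat.splits)
  show ?case unfolding e c
    using mem gm IH by (cases k) (auto simp: G_add[OF g mem IH(1)] simp del: mult_minus_left intro: sring_add[OF L_sring mem])
qed (auto simp: G_zero[OF g] G_1[OF g] sring_0[OF L_sring] sring_1[OF L_sring])

text \<open>Evaluation at a generator x embeds G into the roots of its minimal polynomial, which has
  degree p. Conversely, the product of X - g x over G has G-fixed, hence rational, coefficients and
  vanishes at x, so its degree is at least p.\<close>

lemma finite_G: "finite (carrier G)" and card_G: "card (carrier G) = p"
proof -
  obtain x h where x: "x \<in> L" "x \<notin> \<rat>" "adjoin \<rat> x = L" and h: "is_min_poly \<rat> x h" "degree h = p"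
    using generator_exists by blast
  have h0: "h \<noteq> 0" "h \<in> poly_over \<rat>" "poly h x = 0" using h(1) by (auto simp: is_min_poly_def)
  have inj: "inj_on (\<lambda>g. g x) (carrier G)" by (rule inj_onI) (rule G_eqI[OF x(1,3)])
  have sub: "(\<lambda>g. g x) ` carrier G \<subseteq> {r. poly h r = 0}"
  proof
    fix r assume "r \<in> (\<lambda>g. g x) ` carrier G"
    then obtain g where g: "g \<in> carrier G" "r = g x" by auto
    then have "poly h r = g (poly h x)" using G_poly[OF g(1) h0(2) x(1)] by simp
    then show "r \<in> {r. poly h r = 0}" using h0(3) G_zero[OF g(1)] by simp
  qed
  have finR: "finite {r. poly h r = 0}" by (rule poly_roots_finite[OF h0(1)])
  show fin: "finite (carrier G)" using finite_imageD[OF finite_subset[OF sub finR] inj] .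
  have le: "card (carrier G) \<le> p"
  proof -
    have "card (carrier G) \<le> card {r. poly h r = 0}" using card_inj_on_le[OF inj sub finR] .
    also have "\<dots> \<le> p" using card_poly_roots_bound[OF h0(1)] h(2) by simp
    finally show ?thesis .
  qed
  define P where "P = (\<Prod>g\<in>carrier G. [:- g x, 1:])"
  have "P \<in> poly_over \<rat>" unfolding poly_over_def
  proof (intro CollectI allI G_fixed)
    fix k
    show "coeff P k \<in> L" unfolding P_def using G_coeff_prod[OF G.one_closed, of "carrier G" "\<lambda>g. g x"] G_closed x by simp
    fix g assume g: "g \<in> carrier G"
    have "bij_betw (\<lambda>h. g \<otimes>\<^bsub>G\<^esub> h) (carrier G) (carrier G)"
      unfolding bij_betw_def using G.inj_on_cmult[OF g] G.surj_const_mult[OF g] by auto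
    have "g (coeff P k) = coeff (\<Prod>h\<in>carrier G. [:- g (h x), 1:]) k"
      unfolding P_def using G_coeff_prod[OF g, of "carrier G" "\<lambda>h. h x"] G_closed x by simp
    also have "(\<Prod>h\<in>carrier G. [:- g (h x), 1:]) = (\<Prod>h\<in>carrier G. [:- (g \<otimes>\<^bsub>G\<^esub> h) x, 1:])"
      using x g by (intro prod.cong refl) (simp add: G_apply_mult)
    also have "\<dots> = P" unfolding P_def by (rule prod.reindex_bij_betw) fact
    finally show "g (coeff P k) = coeff P k" .
  qed
  moreover have "P \<noteq> 0" unfolding P_def using fin by auto
  moreover have "poly P x = 0"
    unfolding P_def poly_prod using G_apply_one[OF x(1)]
    by (intro prod_zero[OF fin] bexI[of _ "\<one>\<^bsub>G\<^esub>"]) auto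
  ultimately have "p \<le> degree P" using min_poly_degree_le[OF h(1)] h(2) by blast
  moreover have "degree P = card (carrier G)"
    unfolding P_def by (subst degree_prod_eq_sum_degree) auto
  ultimately show "card (carrier G) = p" using le by simp
qed

lemmas G_powers = G.prime_order_powers[OF p_prime card_G]

lemma G_pow_apply: "t \<in> carrier G \<Longrightarrow> y \<in> L \<Longrightarrow> (t [^]\<^bsub>G\<^esub> (i::nat)) y = (t ^^ i) y"
proof (induction i arbitrary: y)
  case (Suc i)
  then show ?case using G_closed by (simp add: G_apply_mult funpow_swap1)
qed (simp add: G_apply_one)

text \<open>Any nontrivial t generates, the order being prime. So the trace can be computed from
  whichever automorphism the cyclotomic field supplies, not just from a fixed generator.\<close>

lemma trace_powers:
  assumes t: "t \<in> carrier G" "t \<noteq> \<one>\<^bsub>G\<^esub>" and y: "y \<in> L"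
  shows "(\<Sum>g\<in>carrier G. g y) = (\<Sum>i<p. (t ^^ i) y)"
  using sum.reindex_bij_betw[OF G_powers(1)[OF t], of "\<lambda>g. g y"] G_pow_apply[OF t(1) y] by simp

lemma trace_in_Rats:
  assumes y: "y \<in> L"
  shows "(\<Sum>g\<in>carrier G. g y) \<in> \<rat>"
proof (rule G_fixed)
  show "(\<Sum>g\<in>carrier G. g y) \<in> L" by (rule sring_sum[OF L_sring]) (rule G_closed[OF _ y])
  fix g assume g: "g \<in> carrier G"
  have "bij_betw (\<lambda>h. g \<otimes>\<^bsub>G\<^esub> h) (carrier G) (carrier G)"
    unfolding bij_betw_def using G.inj_on_cmult[OF g] G.surj_const_mult[OF g] by auto
  from sum.reindex_bij_betw[OF this, of "\<lambda>h. h y"]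
  show "g (\<Sum>h\<in>carrier G. h y) = (\<Sum>h\<in>carrier G. h y)"
    using y G_apply_mult[OF g] G_sum[OF g, of "carrier G" "\<lambda>h. h y"] G_closed by simp
qed

end

section \<open>Comparison of the automorphisms of L with those of a cyclotomic field\<close>

lemma (in cyclotomic) cmap_right_inverse:
  assumes a: "a \<in> conj_exps \<rat>"
  shows "\<exists>b\<in>conj_exps \<rat>. \<forall>y\<in>K. cmap a (cmap b y) = y"
proof -
  have "1 mod f \<in> conj_exps \<rat>"
    using f_pos zeta_power_mod[OF f_pos, of 1] by (auto simp: conj_exps_def)
  then obtain b where b: "b \<in> conj_exps \<rat>" "a * b mod f = 1 mod f"
    using conj_exps_bij[OF sfield_Rats a] unfolding bij_betw_def by (metis (no_types, lifting) imageE)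
  have "cmap a (cmap b y) = y" if y: "y \<in> K" for y
  proof -
    obtain g where g: "g \<in> poly_over \<rat>" "y = poly g z" using y by (rule K_cases)
    have "z ^ (a * b) = z" using b(2) zeta_power_eq_iff[OF f_pos, of "a * b" 1] by simp
    then show ?thesis using g a b(1) by (simp add: cmap_poly_Rats cmap_poly_power)
  qed
  then show ?thesis using b(1) by blast
qed

text \<open>L lives on an arbitrary type and cyclotomic fields on the complex numbers, so statements
  are transported along \<phi>. Here f is any index admitting an embedding; minimality is added
  where it is used.\<close>

locale prime_galois_embedding = prime_galois p L + cyclotomic f
  for p L f +
  fixes \<phi> :: "'a::field_char_0 \<Rightarrow> complex"
  assumes phi: "\<phi> \<in> Ring.ring_hom (sub_alg L) (sub_alg (cyclotomic_field f))"
begin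

lemma phi_in_K: "x \<in> L \<Longrightarrow> \<phi> x \<in> K"
  and phi_1: "\<phi> 1 = 1"
  and phi_add: "x \<in> L \<Longrightarrow> y \<in> L \<Longrightarrow> \<phi> (x + y) = \<phi> x + \<phi> y"
  and phi_mult: "x \<in> L \<Longrightarrow> y \<in> L \<Longrightarrow> \<phi> (x * y) = \<phi> x * \<phi> y"
  using phi by (auto simp: Ring.ring_hom_def cyclotomic_field_eq[OF f_pos])

lemma phi_of_rat: "\<phi> (of_rat q) = of_rat q"
  by (intro hom_fixes_rats[OF L_sfield] phi_1 phi_add phi_mult)

lemma phi_0: "\<phi> 0 = 0" using phi_of_rat[of 0] by simp

lemma phi_of_int: "\<phi> (of_int n) = of_int n" using phi_of_rat[of "of_int n"] by simp

lemma phi_sum: "(\<And>i. i \<in> I \<Longrightarrow> u i \<in> L) \<Longrightarrow> \<phi> (sum u I) = (\<Sum>i\<in>I. \<phi> (u i))"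
  by (induction I rule: infinite_finite_induct) (auto simp: phi_0 phi_add sring_sum[OF L_sring])

lemma phi_uminus: "x \<in> L \<Longrightarrow> \<phi> (- x) = - \<phi> x"
  using phi_add[of x "- x"] sring_uminus[OF L_sring, of x] phi_0 by (simp add: add_eq_0_iff)

lemma phi_diff: "x \<in> L \<Longrightarrow> y \<in> L \<Longrightarrow> \<phi> (x - y) = \<phi> x - \<phi> y"
  using phi_add[of x "- y"] phi_uminus[of y] sring_uminus[OF L_sring, of y] by simp

lemma phi_inj: "x \<in> L \<Longrightarrow> y \<in> L \<Longrightarrow> \<phi> x = \<phi> y \<Longrightarrow> x = y"
proof (rule ccontr)
  assume xy: "x \<in> L" "y \<in> L" "\<phi> x = \<phi> y" "x \<noteq> y"
  then have "\<phi> ((x - y) * inverse (x - y)) = \<phi> (x - y) * \<phi> (inverse (x - y))"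
    by (intro phi_mult sfield_inverse[OF L_sfield] sring_diff[OF L_sring])
  then show False using xy phi_diff[of x y] phi_1 by simp
qed

lemma phi_int_poly:
  assumes x: "x \<in> L"
  shows "\<phi> (poly (map_poly of_int q) x) = poly (map_poly of_int q) (\<phi> x)"
proof (induction q)
  case (pCons a q)
  have "map_poly of_int q \<in> poly_over L" by (auto simp: poly_over_def coeff_map_poly sring_of_int[OF L_sring])
  then have "poly (map_poly of_int q) x \<in> L" using x by (intro poly_in_sring L_sring)
  then show ?case using pCons x
    by (simp add: map_poly_pCons phi_add phi_mult phi_of_int sring_of_int[OF L_sring] sring_mult[OF L_sring])
qed (simp add: phi_0)

lemma phi_algebraic_int: "x \<in> L \<Longrightarrow> algebraic_int (\<phi> x) \<longleftrightarrow> algebraic_int x"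
proof -
  assume x: "x \<in> L"
  have "poly (map_poly of_int q) (\<phi> x) = 0 \<longleftrightarrow> poly (map_poly of_int q) x = 0" for q
  proof -
    have "map_poly of_int q \<in> poly_over L" by (auto simp: poly_over_def coeff_map_poly sring_of_int[OF L_sring])
    then have "poly (map_poly of_int q) x \<in> L" using x by (intro poly_in_sring L_sring)
    then show ?thesis using phi_int_poly[OF x, of q] phi_inj[of _ 0] phi_0 sring_0[OF L_sring] by metis
  qed
  then show ?thesis unfolding algebraic_int_altdef_ipoly by simp
qed

text \<open>Through \<phi> the integers of L are the part of L' lying in S = Z[zeta_f]; ring laws
  and congruences for them come from S.\<close>

lemma ring_of_integers_iff: "x \<in> ring_of_integers L \<longleftrightarrow> x \<in> L \<and> \<phi> x \<in> S"
  using phi_algebraic_int phi_in_K algebraic_int_in_S S_algebraic_int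
  by (auto simp: ring_of_integers_def)

lemma ring_of_integers_sring: "sring (ring_of_integers L)"
  unfolding sring_def
  by (auto simp: ring_of_integers_iff phi_1 phi_diff phi_mult sring_1[OF L_sring] sring_diff[OF L_sring] sring_mult[OF L_sring]
     sring_1[OF S_sring] sring_diff[OF S_sring] sring_mult[OF S_sring])

lemma G_ring_of_integers: "g \<in> carrier G \<Longrightarrow> x \<in> ring_of_integers L \<Longrightarrow> g x \<in> ring_of_integers L"
  using G_algebraic_int G_closed by (auto simp: ring_of_integers_def)

lemma ring_of_integers_rat: "x \<in> ring_of_integers L \<Longrightarrow> x \<in> \<rat> \<Longrightarrow> x \<in> \<int>"
  using rational_algebraic_int_is_int by (auto simp: ring_of_integers_def)

lemma trace_integral:
  assumes y: "y \<in> ring_of_integers L"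
  shows "\<exists>T. (\<Sum>g\<in>carrier G. g y) = of_int T"
proof -
  have "(\<Sum>g\<in>carrier G. g y) \<in> ring_of_integers L"
    by (rule sring_sum[OF ring_of_integers_sring]) (rule G_ring_of_integers[OF _ y])
  then have "(\<Sum>g\<in>carrier G. g y) \<in> \<int>"
    using y trace_in_Rats by (intro ring_of_integers_rat) (auto simp: ring_of_integers_def)
  then show ?thesis by (auto elim: Ints_cases)
qed

abbreviation "L' \<equiv> \<phi> ` L"

lemma L'_sfield: "sfield L'"
proof -
  have "inverse (\<phi> x) = \<phi> (inverse x)" if "x \<in> L" for x
  proof (cases "x = 0")
    case False
    then have "\<phi> x * \<phi> (inverse x) = 1"
      using phi_mult[OF that sfield_inverse[OF L_sfield that]] phi_1 by simp
    then show ?thesis by (metis inverse_unique)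
  qed (simp add: phi_0)
  moreover have "1 = \<phi> 1" by (simp add: phi_1)
  ultimately show ?thesis
    unfolding sfield_def sring_def
    by (auto simp flip: phi_diff phi_mult intro!: imageI sfield_inverse[OF L_sfield]
        sring_1[OF L_sring] sring_diff[OF L_sring] sring_mult[OF L_sring])
qed

lemma L'_subset_K: "L' \<subseteq> K" using phi_in_K by auto

text \<open>Restriction of \<open>cmap a\<close> to the normal subfield L', pulled back along
  \<phi>; it is made extensional because elements of G are.\<close>

definition conj_aut :: "nat \<Rightarrow> 'a \<Rightarrow> 'a" where
  "conj_aut a = (\<lambda>y\<in>L. inv_into L \<phi> (cmap a (\<phi> y)))"

lemma conj_aut:
  assumes a: "a \<in> conj_exps \<rat>" and y: "y \<in> L"
  shows "conj_aut a y \<in> L" "\<phi> (conj_aut a y) = cmap a (\<phi> y)"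
proof -
  have "cmap a (\<phi> y) \<in> L'" using cmap_in_subfield[OF L'_sfield L'_subset_K a] y by blast
  then show "conj_aut a y \<in> L" "\<phi> (conj_aut a y) = cmap a (\<phi> y)"
    using y by (auto simp: conj_aut_def inv_into_into f_inv_into_f)
qed

lemma conj_aut_in_G:
  assumes a: "a \<in> conj_exps \<rat>"
  shows "conj_aut a \<in> carrier G"
  unfolding G_carrier field_aut_def
proof (intro conjI ballI)
  note c = conj_aut[OF a]
  show "conj_aut a \<in> extensional L" by (simp add: conj_aut_def)
  show "bij_betw (conj_aut a) L L"
    unfolding bij_betw_def
  proof
    show "inj_on (conj_aut a) L"
    proof (rule inj_onI)
      fix x y assume xy: "x \<in> L" "y \<in> L" "conj_aut a x = conj_aut a y"
      then have "cmap a (\<phi> x) = cmap a (\<phi> y)" using c(2) by metis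
      then show "x = y" using cmap_inj[OF a] phi_in_K phi_inj xy by metis
    qed
    show "conj_aut a ` L = L"
    proof
      show "conj_aut a ` L \<subseteq> L" using c(1) by auto
      obtain b where b: "b \<in> conj_exps \<rat>" "\<And>y. y \<in> K \<Longrightarrow> cmap a (cmap b y) = y"
        using cmap_right_inverse[OF a] by blast
      show "L \<subseteq> conj_aut a ` L"
      proof
        fix y assume y: "y \<in> L"
        have "\<phi> (conj_aut a (conj_aut b y)) = \<phi> y"
          using c(2) conj_aut[OF b(1) y] b(2) phi_in_K[OF y] by simp
        then have "conj_aut a (conj_aut b y) = y"
          using phi_inj c(1) conj_aut(1)[OF b(1) y] y by blast
        then show "y \<in> conj_aut a ` L" using conj_aut(1)[OF b(1) y] by (metis imageI)
      qed
    qed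
  qed
  have one: "1 \<in> L" by (rule sring_1[OF L_sring])
  have "\<phi> (conj_aut a 1) = \<phi> 1" using c(2)[OF one] cmap_rat[OF a] phi_1 by simp
  then show "conj_aut a 1 = 1" using phi_inj c(1)[OF one] one by blast
  fix x y assume xy: "x \<in> L" "y \<in> L"
  note m = c(1)[OF xy(1)] c(1)[OF xy(2)]
  have "\<phi> (conj_aut a (x + y)) = \<phi> (conj_aut a x + conj_aut a y)"
    using c(2)[OF sring_add[OF L_sring xy]] c(2)[OF xy(1)] c(2)[OF xy(2)] phi_add[OF m]
      phi_add[OF xy] cmap_add[OF a] phi_in_K xy by simp
  then show "conj_aut a (x + y) = conj_aut a x + conj_aut a y"
    using phi_inj c(1)[OF sring_add[OF L_sring xy]] sring_add[OF L_sring m] by blast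
  have "\<phi> (conj_aut a (x * y)) = \<phi> (conj_aut a x * conj_aut a y)"
    using c(2)[OF sring_mult[OF L_sring xy]] c(2)[OF xy(1)] c(2)[OF xy(2)] phi_mult[OF m]
      phi_mult[OF xy] cmap_mult[OF a] phi_in_K xy by simp
  then show "conj_aut a (x * y) = conj_aut a x * conj_aut a y"
    using phi_inj c(1)[OF sring_mult[OF L_sring xy]] sring_mult[OF L_sring m] by blast
qed

lemma conj_aut_funpow:
  assumes a: "a \<in> conj_exps \<rat>" and y: "y \<in> L"
  shows "(conj_aut a ^^ i) y \<in> L \<and> \<phi> ((conj_aut a ^^ i) y) = (cmap a ^^ i) (\<phi> y)"
  by (induction i) (auto simp: conj_aut[OF a] y)

lemma conj_aut_trace:
  assumes a: "a \<in> conj_exps \<rat>" "conj_aut a \<noteq> \<one>\<^bsub>G\<^esub>" and y: "y \<in> L"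
  shows "\<phi> (\<Sum>g\<in>carrier G. g y) = (\<Sum>i<p. (cmap a ^^ i) (\<phi> y))"
  using trace_powers[OF conj_aut_in_G[OF a(1)] a(2) y] conj_aut_funpow[OF a(1) y]
  by (simp add: phi_sum)

lemma conj_aut_neq_one:
  assumes a: "a \<in> conj_exps \<rat>" and y: "y \<in> L" "cmap a (\<phi> y) \<noteq> \<phi> y"
  shows "conj_aut a \<noteq> \<one>\<^bsub>G\<^esub>"
  using conj_aut[OF a y(1)] y G_apply_one by metis

text \<open>A conjugation moving a nonrational element of L' restricts to a generator of G, so its
  powers below p move L' and \<open>unramified_trace\<close> applies.\<close>

lemma trace_dvd_imp_dvd_conductor:
  assumes T: "\<And>y. y \<in> ring_of_integers L \<Longrightarrow> \<exists>T. int p dvd T \<and> (\<Sum>g\<in>carrier G. g y) = of_int T"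
  shows "p dvd f"
proof -
  obtain x where x: "x \<in> L" "x \<notin> \<rat>" using generator_exists by blast
  have "\<phi> x \<notin> \<rat>"
  proof
    assume "\<phi> x \<in> \<rat>"
    then obtain q where "\<phi> x = of_rat q" by (auto elim: Rats_cases)
    then have "\<phi> x = \<phi> (of_rat q)" by (simp add: phi_of_rat)
    then have "x = of_rat q" using x Rats_subset_L by (intro phi_inj) auto
    then show False using x by simp
  qed
  then obtain a where a: "a \<in> conj_exps \<rat>" "cmap a (\<phi> x) \<noteq> \<phi> x"
    using conj_fixed_in_subfield[OF sfield_Rats Rats_subset_K phi_in_K[OF x(1)]] by blast
  have n1: "conj_aut a \<noteq> \<one>\<^bsub>G\<^esub>" by (rule conj_aut_neq_one[OF a(1) x(1) a(2)])
  have aG: "conj_aut a \<in> carrier G" by (rule conj_aut_in_G[OF a(1)])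
  show ?thesis
  proof (rule unramified_trace[OF L'_sfield L'_subset_K a(1) p_pos])
    fix i assume i: "0 < i" "i < p"
    then have "conj_aut a [^]\<^bsub>G\<^esub> i \<noteq> \<one>\<^bsub>G\<^esub>"
      using G_powers(2)[OF aG n1, of i] by (auto dest: dvd_imp_le)
    moreover have "conj_aut a [^]\<^bsub>G\<^esub> i \<in> carrier G" using aG by simp
    ultimately obtain y where y: "y \<in> L" "(conj_aut a [^]\<^bsub>G\<^esub> i) y \<noteq> y"
      using G_neq_one by blast
    then have "(conj_aut a ^^ i) y \<noteq> y" using G_pow_apply[OF aG] by simp
    then have "(cmap a ^^ i) (\<phi> y) \<noteq> \<phi> y"
      using conj_aut_funpow[OF a(1) y(1)] y(1) phi_inj by metis
    then show "\<exists>y\<in>L'. (cmap a ^^ i) y \<noteq> y" using y(1) by blast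
  next
    fix y assume "y \<in> L'" "y \<in> S"
    then obtain w where w: "w \<in> L" "y = \<phi> w" "w \<in> ring_of_integers L"
      by (auto simp: ring_of_integers_iff)
    then obtain T where "int p dvd T" "(\<Sum>g\<in>carrier G. g w) = of_int T" using T by blast
    then show "\<exists>T. int p dvd T \<and> (\<Sum>i<p. (cmap a ^^ i) y) = of_int T"
      using conj_aut_trace[OF a(1) n1 w(1)] w(2) phi_of_int by metis
  qed
qed

lemma dvd_conductor_imp_trace_dvd:
  assumes f: "is_conductor L f" "p dvd f" and y: "y \<in> ring_of_integers L"
    and T: "(\<Sum>g\<in>carrier G. g y) = of_int T"
  shows "int p dvd T"
proof -
  define k where "k = multiplicity p f"
  obtain m where fm: "f = p ^ k * m" "\<not> p dvd m"
    using multiplicity_decompose'[of f p] p_prime f_pos unfolding k_def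
    by (metis neq0_conv not_prime_unit)
  have k: "k > 0" unfolding k_def using f(2) p_prime f_pos by (simp add: prime_multiplicity_gt_zero_iff)
  have m0: "m > 0" using fm f_pos by (cases m) auto
  have pk: "p ^ k > 1" by (rule one_less_power[OF prime_gt_1_nat[OF p_prime] k])
  have mf: "m < f" using fm(1) pk m0 by simp
  interpret m: cyclotomic m by unfold_locales (rule m0)
  define Km where "Km = adjoin \<rat> (zeta m)"
  have Km: "sfield Km" "Km \<subseteq> K"
  proof -
    show "sfield Km" unfolding Km_def by (rule m.K_sfield)
    have "zeta m = z ^ (p ^ k)" using zeta_mult_power[of "p ^ k" m] pk fm(1) p_pos by simp
    then show "Km \<subseteq> K" unfolding Km_def
      by (intro adjoin_least K_sring Rats_subset_K) (simp add: sring_power[OF K_sring] z_K)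
  qed
  \<comment> \<open>Minimality of f enters here: if L' lay in Q(zeta_m) with m < f, then \<phi>
    itself would be a forbidden embedding.\<close>
  have "\<not> embeds_cyclotomic L m" using f(1) mf m0 by (metis is_conductor_def not_le)
  then have "\<phi> \<notin> Ring.ring_hom (sub_alg L) (sub_alg (cyclotomic_field m))"
    by (auto simp: embeds_cyclotomic_def)
  then obtain w where w: "w \<in> L" "\<phi> w \<notin> Km"
    using phi by (auto simp: Ring.ring_hom_def cyclotomic_field_eq[OF m0] Km_def)
  then obtain a where a: "a \<in> conj_exps Km" "cmap a (\<phi> w) \<noteq> \<phi> w"
    using conj_fixed_in_subfield[OF Km phi_in_K[OF w(1)]] by blast
  have aQ: "a \<in> conj_exps \<rat>" by (rule conj_exps_Rats[OF Km(1) a(1)])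
  have n1: "conj_aut a \<noteq> \<one>\<^bsub>G\<^esub>" by (rule conj_aut_neq_one[OF aQ w(1) a(2)])
  have yL: "y \<in> L" "\<phi> y \<in> S" using y by (auto simp: ring_of_integers_iff)
  have "(\<Sum>i<p. (cmap a ^^ i) (\<phi> y)) = of_int T"
    using conj_aut_trace[OF aQ n1 yL(1)] T phi_of_int by simp
  then show ?thesis
    using ramified_trace[OF p_prime fm(1) k fm(2) a(1)[unfolded Km_def] aQ yL(2)] by blast
qed

end

section \<open>The associated order\<close>

lemma (in comm_group) subgroup_comm_group:
  assumes H: "subgroup H G"
  shows "comm_group (G\<lparr>carrier := H\<rparr>)"
  by (rule group.group_comm_groupI[OF subgroup_imp_group[OF H]])
    (use subgroup.subset[OF H] m_comm in auto)

locale cyclic_prime_extension = prime_galois_embedding p L f \<phi>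
  for p and L :: "'a::field_char_0 set" and f \<phi> +
  fixes \<sigma> :: "'a \<Rightarrow> 'a"
  assumes sigma: "\<sigma> \<in> carrier G" and generate_sigma: "generate G {\<sigma>} = carrier G"
    and p_odd: "odd p" and conductor: "is_conductor L f"
begin

section \<open>The character of G sending the generator to a primitive p-th root of unity\<close>

sublocale P: cyclotomic p by unfold_locales (rule p_pos)

abbreviation "\<omega> \<equiv> zeta p"

lemma p_gt_1: "p > 1" by (rule prime_gt_1_nat[OF p_prime])

lemma sigma_neq_one: "\<sigma> \<noteq> \<one>\<^bsub>G\<^esub>"
proof
  assume "\<sigma> = \<one>\<^bsub>G\<^esub>"
  then have "card (carrier G) = card {\<one>\<^bsub>G\<^esub>}" using generate_sigma G.generate_one by metis
  then show False using card_G p_gt_1 by simp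
qed

lemmas sigma_powers = G_powers[OF sigma sigma_neq_one]

lemma sigma_pow_mod: "\<sigma> [^]\<^bsub>G\<^esub> (i mod p) = \<sigma> [^]\<^bsub>G\<^esub> (i::nat)"
proof -
  have "\<sigma> [^]\<^bsub>G\<^esub> i = \<sigma> [^]\<^bsub>G\<^esub> (p * (i div p) + i mod p)" by simp
  also have "\<dots> = \<sigma> [^]\<^bsub>G\<^esub> (p * (i div p)) \<otimes>\<^bsub>G\<^esub> \<sigma> [^]\<^bsub>G\<^esub> (i mod p)"
    by (simp add: G.nat_pow_mult sigma)
  also have "\<sigma> [^]\<^bsub>G\<^esub> (p * (i div p)) = \<one>\<^bsub>G\<^esub>" using sigma_powers(2) by simp
  finally show ?thesis using sigma by simp
qed

text \<open>The discrete logarithm to base \<sigma>.\<close>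

definition idx :: "('a \<Rightarrow> 'a) \<Rightarrow> nat" where
  "idx = inv_into {..<p} (\<lambda>i. \<sigma> [^]\<^bsub>G\<^esub> i)"

lemma idx: "g \<in> carrier G \<Longrightarrow> idx g < p" "g \<in> carrier G \<Longrightarrow> \<sigma> [^]\<^bsub>G\<^esub> idx g = g"
proof -
  assume "g \<in> carrier G"
  then have "g \<in> (\<lambda>i. \<sigma> [^]\<^bsub>G\<^esub> i) ` {..<p}" using sigma_powers(1) by (simp add: bij_betw_def)
  from inv_into_into[OF this] f_inv_into_f[OF this]
  show "idx g < p" "\<sigma> [^]\<^bsub>G\<^esub> idx g = g" by (auto simp: idx_def)
qed

lemma idx_pow: "idx (\<sigma> [^]\<^bsub>G\<^esub> (i::nat)) = i mod p"
proof -
  have "idx (\<sigma> [^]\<^bsub>G\<^esub> (i mod p)) = i mod p"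
    unfolding idx_def using sigma_powers(1) p_pos by (intro inv_into_f_f) (auto simp: bij_betw_def)
  then show ?thesis by (simp add: sigma_pow_mod)
qed

definition \<chi> :: "('a \<Rightarrow> 'a) \<Rightarrow> complex" where
  "\<chi> g = \<omega> ^ idx g"

lemma chi_pow: "\<chi> (\<sigma> [^]\<^bsub>G\<^esub> (i::nat)) = \<omega> ^ i"
  by (simp add: \<chi>_def idx_pow zeta_power_mod[OF p_pos])

lemma chi_mult: 
  assumes "g \<in> carrier G" "h \<in> carrier G"
  shows "\<chi> (g \<otimes>\<^bsub>G\<^esub> h) = \<chi> g * \<chi> h"
proof -
  have "g \<otimes>\<^bsub>G\<^esub> h = \<sigma> [^]\<^bsub>G\<^esub> (idx g + idx h)"
    using idx(2)[OF assms(1)] idx(2)[OF assms(2)] sigma by (simp flip: G.nat_pow_mult)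
  then show ?thesis by (simp only: chi_pow power_add) (simp add: \<chi>_def)
qed

lemma chi_one: "\<chi> \<one>\<^bsub>G\<^esub> = 1" using chi_pow[of 0] by simp

lemma chi_sigma: "\<chi> \<sigma> = \<omega>" using chi_pow[of 1] sigma by simp

lemma sum_G: "(\<Sum>g\<in>carrier G. u g) = (\<Sum>i<p. u (\<sigma> [^]\<^bsub>G\<^esub> i))"
  using sum.reindex_bij_betw[OF sigma_powers(1), of u] by simp

lemma sum_omega: "(\<Sum>i<p. \<omega> ^ i) = 0"
proof -
  have "\<omega> \<noteq> 1" using zeta_power_eq_1_iff[OF p_pos, of 1] p_gt_1 by auto
  then show ?thesis using P.sum_roots_of_unity[OF P.z_f] by simp
qed

lemma left_mult_bij: "h \<in> carrier G \<Longrightarrow> bij_betw (\<lambda>k. h \<otimes>\<^bsub>G\<^esub> k) (carrier G) (carrier G)"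
  unfolding bij_betw_def using G.inj_on_cmult G.surj_const_mult by auto

lemma right_mult_bij:
  assumes h: "h \<in> carrier G"
  shows "bij_betw (\<lambda>k. k \<otimes>\<^bsub>G\<^esub> h) (carrier G) (carrier G)"
proof -
  have inj: "inj_on (\<lambda>k. k \<otimes>\<^bsub>G\<^esub> h) (carrier G)" using h by (auto intro!: inj_onI)
  moreover have "(\<lambda>k. k \<otimes>\<^bsub>G\<^esub> h) ` carrier G = carrier G"
    by (rule endo_inj_surj[OF finite_G _ inj]) (use h in auto)
  ultimately show ?thesis by (simp add: bij_betw_def)
qed

section \<open>The group algebra and its embedding by the two coordinates\<close>

lemma QG_simps [simp]:
  "x \<in> carrier (QG L) \<longleftrightarrow> (\<forall>g. g \<notin> carrier G \<longrightarrow> x g = 0)"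
  "\<one>\<^bsub>QG L\<^esub> = (\<lambda>g. if g = \<one>\<^bsub>G\<^esub> then 1 else 0)"
  "\<zero>\<^bsub>QG L\<^esub> = (\<lambda>g. 0)"
  "x \<oplus>\<^bsub>QG L\<^esub> y = (\<lambda>g. x g + y g)"
  "q \<odot>\<^bsub>QG L\<^esub> x = (\<lambda>g. q * x g)"
  by (simp_all add: group_alg_def)

lemma QG_mult:
  "x \<otimes>\<^bsub>QG L\<^esub> y = (\<lambda>g. if g \<in> carrier G
     then \<Sum>h\<in>carrier G. x h * y (inv\<^bsub>G\<^esub> h \<otimes>\<^bsub>G\<^esub> g) else 0)"
  by (simp add: group_alg_def)

lemma QG_mult_closed: "x \<otimes>\<^bsub>QG L\<^esub> y \<in> carrier (QG L)"
  by (simp add: QG_mult)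

text \<open>The substitution g = h k untwists the convolution. The target field is left open, so
  that the identity serves both complex characters and the action on L.\<close>

lemma convolution_sum:
  fixes u :: "('a \<Rightarrow> 'a) \<Rightarrow> 'b::field_char_0"
  shows "(\<Sum>g\<in>carrier G. of_rat ((x \<otimes>\<^bsub>QG L\<^esub> y) g) * u g) =
    (\<Sum>h\<in>carrier G. \<Sum>k\<in>carrier G. of_rat (x h) * of_rat (y k) * u (h \<otimes>\<^bsub>G\<^esub> k))"
proof -
  have "(\<Sum>g\<in>carrier G. of_rat ((x \<otimes>\<^bsub>QG L\<^esub> y) g) * u g) =
    (\<Sum>g\<in>carrier G. \<Sum>h\<in>carrier G. of_rat (x h) * of_rat (y (inv\<^bsub>G\<^esub> h \<otimes>\<^bsub>G\<^esub> g)) * u g)"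
    by (intro sum.cong refl) (simp add: QG_mult of_rat_sum of_rat_mult sum_distrib_right)
  also have "\<dots> = (\<Sum>h\<in>carrier G. \<Sum>g\<in>carrier G. of_rat (x h) * of_rat (y (inv\<^bsub>G\<^esub> h \<otimes>\<^bsub>G\<^esub> g)) * u g)"
    by (rule sum.swap)
  also have "\<dots> = (\<Sum>h\<in>carrier G. \<Sum>k\<in>carrier G. of_rat (x h) * of_rat (y k) * u (h \<otimes>\<^bsub>G\<^esub> k))"
  proof (rule sum.cong[OF refl])
    fix h assume h: "h \<in> carrier G"
    have "(\<Sum>g\<in>carrier G. of_rat (x h) * of_rat (y (inv\<^bsub>G\<^esub> h \<otimes>\<^bsub>G\<^esub> g)) * u g) =
      (\<Sum>k\<in>carrier G. of_rat (x h) * of_rat (y (inv\<^bsub>G\<^esub> h \<otimes>\<^bsub>G\<^esub> (h \<otimes>\<^bsub>G\<^esub> k))) * u (h \<otimes>\<^bsub>G\<^esub> k))"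
      by (rule sum.reindex_bij_betw[OF left_mult_bij[OF h], symmetric])
    also have "\<dots> = (\<Sum>k\<in>carrier G. of_rat (x h) * of_rat (y k) * u (h \<otimes>\<^bsub>G\<^esub> k))"
      using h by (intro sum.cong refl) (simp flip: G.m_assoc)
    finally show "(\<Sum>g\<in>carrier G. of_rat (x h) * of_rat (y (inv\<^bsub>G\<^esub> h \<otimes>\<^bsub>G\<^esub> g)) * u g) =
      (\<Sum>k\<in>carrier G. of_rat (x h) * of_rat (y k) * u (h \<otimes>\<^bsub>G\<^esub> k))" .
  qed
  finally show ?thesis .
qed

definition ev :: "(('a \<Rightarrow> 'a) \<Rightarrow> complex) \<Rightarrow> (('a \<Rightarrow> 'a) \<Rightarrow> rat) \<Rightarrow> complex" where
  "ev u x = (\<Sum>g\<in>carrier G. of_rat (x g) * u g)"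

definition character :: "(('a \<Rightarrow> 'a) \<Rightarrow> complex) \<Rightarrow> bool" where
  "character u \<longleftrightarrow> u \<one>\<^bsub>G\<^esub> = 1 \<and> (\<forall>g\<in>carrier G. \<forall>h\<in>carrier G. u (g \<otimes>\<^bsub>G\<^esub> h) = u g * u h)"

lemma character_trivial: "character (\<lambda>g. 1)" by (simp add: character_def)

lemma character_chi: "character \<chi>" by (simp add: character_def chi_mult chi_one)

abbreviation "\<epsilon> \<equiv> ev (\<lambda>g. 1)"
abbreviation "\<psi> \<equiv> ev \<chi>"

lemma ev_mult: "character u \<Longrightarrow> ev u (x \<otimes>\<^bsub>QG L\<^esub> y) = ev u x * ev u y"
  unfolding ev_def convolution_sum
  by (simp add: sum_product character_def mult_ac cong: sum.cong)

lemma ev_add: "ev u (x \<oplus>\<^bsub>QG L\<^esub> y) = ev u x + ev u y"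
  by (simp add: ev_def of_rat_add distrib_right sum.distrib)

lemma ev_zero: "ev u \<zero>\<^bsub>QG L\<^esub> = 0"
  by (simp add: ev_def)

lemma ev_smult: "ev u (q \<odot>\<^bsub>QG L\<^esub> x) = of_rat q * ev u x"
  by (simp add: ev_def of_rat_mult sum_distrib_left mult.assoc)

lemma ev_elt: "g \<in> carrier G \<Longrightarrow> ev u (group_elt g) = u g"
proof -
  assume g: "g \<in> carrier G"
  have "ev u (group_elt g) = (\<Sum>h\<in>carrier G. if h = g then u h else 0)"
    unfolding ev_def group_elt_def by (intro sum.cong refl) auto
  then show ?thesis using finite_G g by simp
qed

lemma one_eq_elt: "\<one>\<^bsub>QG L\<^esub> = group_elt \<one>\<^bsub>G\<^esub>"
  by (simp add: group_elt_def)

lemma ev_one: "character u \<Longrightarrow> ev u \<one>\<^bsub>QG L\<^esub> = 1"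
  unfolding one_eq_elt by (simp add: ev_elt character_def)

text \<open>The kernel of \<psi> consists of the multiples of the sum of all group elements: an
  element of it is a rational relation between the powers of \<omega>.\<close>

lemma psi_eq_imp_diff_constant:
  assumes "\<psi> x = \<psi> y"
  shows "\<exists>c. \<forall>g\<in>carrier G. x g - y g = c"
proof -
  define d where "d = (\<lambda>i::nat. x (\<sigma> [^]\<^bsub>G\<^esub> i) - y (\<sigma> [^]\<^bsub>G\<^esub> i))"
  have "(\<Sum>i<p. of_rat (d i) * \<omega> ^ i) = \<psi> x - \<psi> y"
    by (simp add: ev_def sum_G chi_pow d_def of_rat_diff left_diff_distrib sum_subtractf)
  then have rel: "(\<Sum>i<p. of_rat (d i) * \<omega> ^ i) = 0" using assms by simp
  have const: "d i = d 0" if i: "i < p" for i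
  proof -
    have "(of_rat (d i) :: complex) = of_rat (d 0)"
      by (rule P.prime_relation_constant[OF p_prime _ rel i]) simp
    then show ?thesis by simp
  qed
  have "x g - y g = d 0" if g: "g \<in> carrier G" for g
  proof -
    have "x g - y g = d (idx g)" by (simp only: d_def idx(2)[OF g])
    then show ?thesis using const[OF idx(1)[OF g]] by simp
  qed
  then show ?thesis by blast
qed

text \<open>On the kernel of \<psi> all coefficients equal one c, and \<epsilon> takes the value p c
  there; so the two coordinates together are injective.\<close>

lemma QG_eqI:
  assumes xy: "x \<in> carrier (QG L)" "y \<in> carrier (QG L)" and e: "\<epsilon> x = \<epsilon> y" "\<psi> x = \<psi> y"
  shows "x = y"
proof -
  obtain c where c: "\<And>g. g \<in> carrier G \<Longrightarrow> x g - y g = c"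
    using psi_eq_imp_diff_constant[OF e(2)] by blast
  have "\<epsilon> x - \<epsilon> y = (\<Sum>g\<in>carrier G. of_rat (x g - y g))"
    by (simp add: ev_def sum_subtractf of_rat_diff)
  also have "\<dots> = of_nat p * of_rat c" by (simp add: c card_G)
  finally have "c = 0" using e(1) p_pos by simp
  then show ?thesis using c xy by (intro ext) (metis QG_simps(1) eq_iff_diff_eq_0)
qed

text \<open>Identities involving convolution are checked on the coordinates \<epsilon> and \<psi>,
  where they become identities of complex numbers.\<close>

lemma QG_cring: "cring (QG L)"
proof (intro cringI abelian_groupI comm_monoidI)
  note ev = ev_mult[OF character_trivial] ev_mult[OF character_chi]
    ev_one[OF character_trivial] ev_one[OF character_chi] ev_add
  fix x y w assume xyw: "x \<in> carrier (QG L)" "y \<in> carrier (QG L)" "w \<in> carrier (QG L)"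
  have one: "\<one>\<^bsub>QG L\<^esub> \<in> carrier (QG L)" by auto
  have add: "v \<oplus>\<^bsub>QG L\<^esub> v' \<in> carrier (QG L)" if "v \<in> carrier (QG L)" "v' \<in> carrier (QG L)" for v v'
    using that by simp
  show "x \<otimes>\<^bsub>QG L\<^esub> y \<in> carrier (QG L)" by (rule QG_mult_closed)
  show "x \<otimes>\<^bsub>QG L\<^esub> y \<otimes>\<^bsub>QG L\<^esub> w = x \<otimes>\<^bsub>QG L\<^esub> (y \<otimes>\<^bsub>QG L\<^esub> w)"
    by (rule QG_eqI[OF QG_mult_closed QG_mult_closed]) (simp_all only: ev mult.assoc)
  show "\<one>\<^bsub>QG L\<^esub> \<otimes>\<^bsub>QG L\<^esub> x = x"
    by (rule QG_eqI[OF QG_mult_closed xyw(1)]) (simp_all only: ev mult_1)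
  show "x \<otimes>\<^bsub>QG L\<^esub> y = y \<otimes>\<^bsub>QG L\<^esub> x"
    by (rule QG_eqI[OF QG_mult_closed QG_mult_closed]) (simp_all only: ev mult.commute)
  show "(x \<oplus>\<^bsub>QG L\<^esub> y) \<otimes>\<^bsub>QG L\<^esub> w = x \<otimes>\<^bsub>QG L\<^esub> w \<oplus>\<^bsub>QG L\<^esub> y \<otimes>\<^bsub>QG L\<^esub> w"
    by (rule QG_eqI[OF QG_mult_closed add[OF QG_mult_closed QG_mult_closed]])
      (simp_all only: ev distrib_right)
  show "\<exists>y\<in>carrier (QG L). y \<oplus>\<^bsub>QG L\<^esub> x = \<zero>\<^bsub>QG L\<^esub>"
    using xyw(1) by (intro bexI[of _ "\<lambda>g. - x g"]) auto
qed (auto simp: add_ac)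

sublocale QG: cring "QG L" by (rule QG_cring)

lemma ev_minus:
  assumes "x \<in> carrier (QG L)" "y \<in> carrier (QG L)"
  shows "ev u (x \<ominus>\<^bsub>QG L\<^esub> y) = ev u x - ev u y"
proof -
  have "ev u (\<ominus>\<^bsub>QG L\<^esub> y) + ev u y = 0"
    using ev_add[of u "\<ominus>\<^bsub>QG L\<^esub> y" y] QG.l_neg[OF assms(2)] ev_zero by metis
  then show ?thesis unfolding a_minus_def ev_add by (simp add: add_eq_0_iff2)
qed

lemma elt_closed: "g \<in> carrier G \<Longrightarrow> group_elt g \<in> carrier (QG L)"
  by (auto simp: group_elt_def)

lemma ev_pow: "character u \<Longrightarrow> ev u (x [^]\<^bsub>QG L\<^esub> (n::nat)) = ev u x ^ n"
  by (induction n) (simp_all only: QG.nat_pow_0 QG.nat_pow_Suc ev_one ev_mult power_0 power_Suc mult.commute)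

lemma ev_finsum:
  assumes "finite I" "\<And>i. i \<in> I \<Longrightarrow> v i \<in> carrier (QG L)"
  shows "ev u (\<Oplus>\<^bsub>QG L\<^esub>i\<in>I. v i) = (\<Sum>i\<in>I. ev u (v i))"
  using assms
proof (induction I rule: finite_induct)
  case empty
  then show ?case by (simp only: QG.finsum_empty ev_zero sum.empty)
next
  case (insert i I)
  then have "ev u (\<Oplus>\<^bsub>QG L\<^esub>i\<in>insert i I. v i) = ev u (v i \<oplus>\<^bsub>QG L\<^esub> (\<Oplus>\<^bsub>QG L\<^esub>i\<in>I. v i))"
    by (subst QG.finsum_insert) (auto simp: Pi_iff simp del: QG_simps)
  then show ?case using insert by (simp only: ev_add) simp
qed

abbreviation "e\<^sub>1 \<equiv> trivial_idempotent L \<sigma> p"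

lemma smult_closed: "x \<in> carrier (QG L) \<Longrightarrow> q \<odot>\<^bsub>QG L\<^esub> x \<in> carrier (QG L)"
  by simp

lemma idempotent_closed: "e\<^sub>1 \<in> carrier (QG L)"
  unfolding trivial_idempotent_def
  by (intro smult_closed QG.finsum_closed) (simp add: Pi_iff QG.nat_pow_closed elt_closed[OF sigma] del: QG_simps)

lemma ev_idempotent: "character u \<Longrightarrow> ev u e\<^sub>1 = (\<Sum>i<p. u \<sigma> ^ i) / of_nat p"
  unfolding trivial_idempotent_def ev_smult
  by (subst ev_finsum)
    (simp_all add: QG.nat_pow_closed elt_closed[OF sigma] ev_pow ev_elt sigma of_rat_divide del: QG_simps)

lemma idempotent_values: "\<epsilon> e\<^sub>1 = 1" "\<psi> e\<^sub>1 = 0"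
  using p_pos by (simp_all add: ev_idempotent character_trivial character_chi chi_sigma sum_omega)

lemma idempotent_eq: "e\<^sub>1 = (\<lambda>g. if g \<in> carrier G then 1 / of_nat p else 0)"
proof (rule QG_eqI[OF idempotent_closed])
  let ?e = "\<lambda>g. if g \<in> carrier G then 1 / of_nat p else (0::rat)"
  show "?e \<in> carrier (QG L)" by simp
  have "ev u ?e = (\<Sum>g\<in>carrier G. u g) / of_nat p" for u
    by (simp add: ev_def of_rat_divide sum_divide_distrib)
  then show "\<epsilon> e\<^sub>1 = \<epsilon> ?e" "\<psi> e\<^sub>1 = \<psi> ?e"
    unfolding idempotent_values using p_pos by (simp_all add: card_G) (simp add: sum_G chi_pow sum_omega)
qed

section \<open>The action on L and integrality of the two coordinates\<close>

abbreviation "act \<equiv> galois_action L"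
abbreviation "A \<equiv> associated_order L"

lemma act_mult:
  assumes a: "a \<in> L"
  shows "act (x \<otimes>\<^bsub>QG L\<^esub> y) a = act x (act y a)"
proof -
  have "of_rat (x h) * h (act y a) = (\<Sum>k\<in>carrier G. of_rat (x h) * of_rat (y k) * (h \<otimes>\<^bsub>G\<^esub> k) a)"
    if h: "h \<in> carrier G" for h
  proof -
    have Lk: "of_rat (y k) \<in> L" "k a \<in> L" if "k \<in> carrier G" for k
      using G_closed[OF that a] Rats_subset_L by auto
    have "h (act y a) = (\<Sum>k\<in>carrier G. h (of_rat (y k) * k a))"
      unfolding galois_action_def by (rule G_sum[OF h]) (rule sring_mult[OF L_sring Lk])
    also have "\<dots> = (\<Sum>k\<in>carrier G. of_rat (y k) * (h \<otimes>\<^bsub>G\<^esub> k) a)"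
      using Lk by (intro sum.cong refl) (simp add: G_mult[OF h] G_rat[OF h] G_apply_mult[OF h _ a])
    finally show ?thesis by (simp add: sum_distrib_left mult.assoc)
  qed
  then show ?thesis
    using convolution_sum[of x y "\<lambda>g. g a"] unfolding galois_action_def by simp
qed

lemma act_add: "act (x \<oplus>\<^bsub>QG L\<^esub> y) a = act x a + act y a"
  by (simp add: galois_action_def of_rat_add distrib_right sum.distrib)

lemma act_one: "a \<in> L \<Longrightarrow> act \<one>\<^bsub>QG L\<^esub> a = a"
proof -
  assume a: "a \<in> L"
  have "act \<one>\<^bsub>QG L\<^esub> a = (\<Sum>g\<in>carrier G. if g = \<one>\<^bsub>G\<^esub> then g a else 0)"
    unfolding galois_action_def by (intro sum.cong refl) auto
  then show ?thesis using finite_G G_apply_one[OF a] by simp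
qed

lemma A_iff: "x \<in> A \<longleftrightarrow> x \<in> carrier (QG L) \<and> (\<forall>a\<in>ring_of_integers L. act x a \<in> ring_of_integers L)"
  by (auto simp: associated_order_def)

lemma integers_in_L: "a \<in> ring_of_integers L \<Longrightarrow> a \<in> L" by (simp add: ring_of_integers_def)

lemma A_closed: "x \<in> A \<Longrightarrow> x \<in> carrier (QG L)" using A_iff by blast

lemma A_mult: "x \<in> A \<Longrightarrow> y \<in> A \<Longrightarrow> x \<otimes>\<^bsub>QG L\<^esub> y \<in> A"
  unfolding A_iff using QG_mult_closed act_mult integers_in_L by auto

lemma A_add: "x \<in> A \<Longrightarrow> y \<in> A \<Longrightarrow> x \<oplus>\<^bsub>QG L\<^esub> y \<in> A"
  unfolding A_iff act_add using sring_add[OF ring_of_integers_sring] QG.a_closed by blast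

lemma A_one: "\<one>\<^bsub>QG L\<^esub> \<in> A"
  unfolding A_iff using act_one integers_in_L QG.one_closed by auto

lemma A_integral_coeffs:
  assumes "x \<in> carrier (QG L)" "\<And>g. x g \<in> \<int>"
  shows "x \<in> A"
  unfolding A_iff
proof (intro conjI ballI assms(1))
  note R = ring_of_integers_sring
  fix a assume a: "a \<in> ring_of_integers L"
  have "of_rat (x g) \<in> ring_of_integers L" for g
  proof -
    obtain n where "x g = of_int n" using assms(2)[of g] by (auto elim: Ints_cases)
    then show ?thesis by (simp add: sring_of_int[OF R])
  qed
  then show "act x a \<in> ring_of_integers L"
    unfolding galois_action_def
    by (intro sring_sum[OF R] sring_mult[OF R]) (auto intro: G_ring_of_integers[OF _ a])
qed

lemma eps_of_rat: "\<epsilon> x = of_rat (\<Sum>g\<in>carrier G. x g)"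
  by (simp add: ev_def of_rat_sum)

text \<open>Acting on 1 returns the sum of the coefficients, which is thus a rational algebraic
  integer.\<close>

lemma A_eps:
  assumes x: "x \<in> A"
  shows "\<exists>n. \<epsilon> x = of_int n"
proof -
  have "act x 1 \<in> ring_of_integers L"
    using x sring_1[OF ring_of_integers_sring] by (simp add: A_iff)
  moreover have "act x 1 = of_rat (\<Sum>g\<in>carrier G. x g)"
    by (simp add: galois_action_def G_1 of_rat_sum)
  ultimately have "(of_rat (\<Sum>g\<in>carrier G. x g) :: 'a) \<in> \<int>"
    using ring_of_integers_rat by simp
  then obtain n where "(of_rat (\<Sum>g\<in>carrier G. x g) :: 'a) = of_rat (of_int n)"
    by (auto elim: Ints_cases)
  then have "(\<Sum>g\<in>carrier G. x g) = of_int n" by (simp only: of_rat_eq_iff)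
  then show ?thesis by (simp only: eps_of_rat) auto
qed

text \<open>The Lagrange resolvent attached to \<open>\<chi>\<inverse> = \<chi>\<^bsup>p-1\<^esup>\<close>.\<close>

definition resolvent :: "'a \<Rightarrow> complex" where
  "resolvent a = (\<Sum>g\<in>carrier G. \<chi> g ^ (p - 1) * \<phi> (g a))"

lemma chi_power_p: "\<chi> g ^ (p - 1) * \<chi> g = 1"
proof -
  have "\<chi> g ^ (p - 1) * \<chi> g = \<chi> g ^ p" using p_pos by (metis power_minus_mult)
  also have "\<dots> = 1" unfolding \<chi>_def using P.z_f by (metis mult.commute power_mult power_one)
  finally show ?thesis .
qed

text \<open>Substituting g h for g in the resolvent extracts the factor \<chi>(h), because the
  inverse character at g is its value at g h times \<chi>(h).\<close>

lemma resolvent_act: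
  assumes a: "a \<in> L"
  shows "resolvent (act x a) = \<psi> x * resolvent a"
proof -
  have "\<phi> (g (act x a)) = (\<Sum>h\<in>carrier G. of_rat (x h) * \<phi> ((g \<otimes>\<^bsub>G\<^esub> h) a))" if g: "g \<in> carrier G" for g
  proof -
    have Lh: "of_rat (x h) \<in> L" "h a \<in> L" "g (h a) \<in> L" if "h \<in> carrier G" for h
      using G_closed[OF that a] G_closed[OF g G_closed[OF that a]] Rats_subset_L by auto
    have "g (act x a) = (\<Sum>h\<in>carrier G. g (of_rat (x h) * h a))"
      unfolding galois_action_def by (rule G_sum[OF g]) (rule sring_mult[OF L_sring Lh(1,2)])
    also have "\<dots> = (\<Sum>h\<in>carrier G. of_rat (x h) * g (h a))"
      using Lh by (intro sum.cong refl) (simp add: G_mult[OF g] G_rat[OF g])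
    also have "\<phi> \<dots> = (\<Sum>h\<in>carrier G. \<phi> (of_rat (x h) * g (h a)))"
      by (rule phi_sum) (rule sring_mult[OF L_sring Lh(1,3)])
    also have "\<dots> = (\<Sum>h\<in>carrier G. of_rat (x h) * \<phi> ((g \<otimes>\<^bsub>G\<^esub> h) a))"
      using Lh by (intro sum.cong refl) (simp add: phi_mult phi_of_rat G_apply_mult[OF g _ a])
    finally show ?thesis .
  qed
  then have "resolvent (act x a) =
      (\<Sum>g\<in>carrier G. \<Sum>h\<in>carrier G. \<chi> g ^ (p - 1) * (of_rat (x h) * \<phi> ((g \<otimes>\<^bsub>G\<^esub> h) a)))"
    unfolding resolvent_def by (simp add: sum_distrib_left)
  also have "\<dots> = (\<Sum>h\<in>carrier G. \<Sum>g\<in>carrier G. \<chi> g ^ (p - 1) * (of_rat (x h) * \<phi> ((g \<otimes>\<^bsub>G\<^esub> h) a)))"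
    by (rule sum.swap)
  also have "\<dots> = (\<Sum>h\<in>carrier G. of_rat (x h) * \<chi> h * resolvent a)"
  proof (intro sum.cong refl)
    fix h assume h: "h \<in> carrier G"
    have "of_rat (x h) * \<chi> h * resolvent a =
      of_rat (x h) * \<chi> h * (\<Sum>g\<in>carrier G. \<chi> (g \<otimes>\<^bsub>G\<^esub> h) ^ (p - 1) * \<phi> ((g \<otimes>\<^bsub>G\<^esub> h) a))"
      unfolding resolvent_def
      using sum.reindex_bij_betw[OF right_mult_bij[OF h], of "\<lambda>k. \<chi> k ^ (p - 1) * \<phi> (k a)"] by simp
    also have "\<dots> = (\<Sum>g\<in>carrier G. \<chi> g ^ (p - 1) * (of_rat (x h) * \<phi> ((g \<otimes>\<^bsub>G\<^esub> h) a)))"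
      unfolding sum_distrib_left
    proof (intro sum.cong refl)
      fix g assume g: "g \<in> carrier G"
      have e: "\<chi> (g \<otimes>\<^bsub>G\<^esub> h) ^ (p - 1) * \<chi> h = \<chi> g ^ (p - 1)"
        using chi_power_p[of h] by (simp add: chi_mult[OF g h] power_mult_distrib mult.assoc)
      show "of_rat (x h) * \<chi> h * (\<chi> (g \<otimes>\<^bsub>G\<^esub> h) ^ (p - 1) * \<phi> ((g \<otimes>\<^bsub>G\<^esub> h) a)) =
          \<chi> g ^ (p - 1) * (of_rat (x h) * \<phi> ((g \<otimes>\<^bsub>G\<^esub> h) a))"
        unfolding e[symmetric] by (simp add: mult_ac)
    qed
    finally show "(\<Sum>g\<in>carrier G. \<chi> g ^ (p - 1) * (of_rat (x h) * \<phi> ((g \<otimes>\<^bsub>G\<^esub> h) a))) =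
        of_rat (x h) * \<chi> h * resolvent a" by simp
  qed
  also have "\<dots> = \<psi> x * resolvent a" by (simp add: ev_def sum_distrib_right)
  finally show ?thesis .
qed

text \<open>Evaluating \<open>\<Prod>\<^bsub>g \<noteq> 1\<^esub> (X - g x)\<close> at the conjugates of a generator \<open>x\<close> shows that some
  power of \<open>x\<close> has nonzero resolvent.\<close>

lemma resolvent_nonzero: "\<exists>a\<in>ring_of_integers L. resolvent a \<noteq> 0"
proof -
  obtain x where x: "x \<in> L" "adjoin \<rat> x = L" using generator_exists by blast
  define c where "c = (\<lambda>g. \<phi> (g x))"
  define u where "u = (\<Prod>g\<in>carrier G - {\<one>\<^bsub>G\<^esub>}. [:- c g, 1:])"
  have pow: "\<phi> (g (x ^ j)) = c g ^ j" if g: "g \<in> carrier G" for g j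
    by (induction j)
      (auto simp: G_1[OF g] phi_1 c_def G_mult[OF g x(1)] sring_power[OF L_sring] x(1)
        phi_mult[OF G_closed[OF g x(1)]] G_closed[OF g])
  have u0: "poly u (c g) = 0" if "g \<in> carrier G" "g \<noteq> \<one>\<^bsub>G\<^esub>" for g
    unfolding u_def poly_prod using finite_G that by (intro prod_zero bexI[of _ g]) auto
  have u1: "poly u (c \<one>\<^bsub>G\<^esub>) \<noteq> 0"
  proof
    assume "poly u (c \<one>\<^bsub>G\<^esub>) = 0"
    then obtain g where "g \<in> carrier G - {\<one>\<^bsub>G\<^esub>}" "poly [:- c g, 1:] (c \<one>\<^bsub>G\<^esub>) = 0"
      unfolding u_def poly_prod prod_zero_iff[OF finite_Diff[OF finite_G]] by (elim bexE)
    then have g: "g \<in> carrier G" "g \<noteq> \<one>\<^bsub>G\<^esub>" "c g = c \<one>\<^bsub>G\<^esub>" by auto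
    then have "g x = \<one>\<^bsub>G\<^esub> x" using phi_inj G_closed x(1) unfolding c_def by blast
    then show False using G_eqI[OF x g(1) G.one_closed] g(2) by simp
  qed
  have "(\<Sum>j\<le>degree u. coeff u j * resolvent (x ^ j)) = (\<Sum>g\<in>carrier G. \<chi> g ^ (p - 1) * poly u (c g))"
  proof -
    have "(\<Sum>j\<le>degree u. coeff u j * resolvent (x ^ j)) =
      (\<Sum>j\<le>degree u. \<Sum>g\<in>carrier G. \<chi> g ^ (p - 1) * (coeff u j * c g ^ j))"
      unfolding resolvent_def sum_distrib_left by (intro sum.cong refl) (simp add: pow)
    also have "\<dots> = (\<Sum>g\<in>carrier G. \<Sum>j\<le>degree u. \<chi> g ^ (p - 1) * (coeff u j * c g ^ j))"
      by (rule sum.swap)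
    finally show ?thesis by (simp add: poly_altdef sum_distrib_left)
  qed
  also have "\<dots> = (\<Sum>g\<in>carrier G. if g = \<one>\<^bsub>G\<^esub> then poly u (c g) else 0)"
    using u0 by (intro sum.cong refl) (auto simp: chi_one)
  also have "\<dots> = poly u (c \<one>\<^bsub>G\<^esub>)" using finite_G by simp
  finally obtain j where j: "resolvent (x ^ j) \<noteq> 0" using u1
    by (metis (no_types, lifting) mult_zero_right sum.neutral)
  have xj: "x ^ j \<in> L" by (rule sring_power[OF L_sring x(1)])
  obtain N where N: "N > 0" "of_nat N * \<phi> (x ^ j) \<in> S" using K_denominator[OF phi_in_K[OF xj]] by blast
  have NL: "of_nat N \<in> L" by (rule sring_of_nat[OF L_sring])
  define a where "a = of_nat N * x ^ j"
  have phiN: "\<phi> (of_nat N) = of_nat N" using phi_of_int[of "int N"] by simp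
  have "a \<in> ring_of_integers L"
    unfolding ring_of_integers_iff a_def
    using N(2) sring_mult[OF L_sring NL xj] by (simp add: phi_mult[OF NL xj] phiN)
  moreover have "resolvent a = of_nat N * resolvent (x ^ j)"
  proof -
    have "\<phi> (g a) = of_nat N * \<phi> (g (x ^ j))" if g: "g \<in> carrier G" for g
      unfolding a_def using G_mult[OF g NL xj] phi_mult[OF NL G_closed[OF g xj]] phiN
        G_rat[OF g, of "of_nat N"] by simp
    then show ?thesis by (simp add: resolvent_def sum_distrib_left mult_ac cong: sum.cong)
  qed
  ultimately show ?thesis using j N(1) by (intro bexI[of _ a]) simp_all
qed

lemma psi_in_K: "\<psi> x \<in> P.K"
  unfolding ev_def \<chi>_def using P.Rats_subset_K
  by (intro sring_sum[OF P.K_sring] sring_mult[OF P.K_sring] sring_power[OF P.K_sring] P.z_K) auto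

text \<open>Iterating the action of x on an integer a keeps it integral and multiplies its resolvent
  by powers of \<open>\<psi> x\<close>. So all \<open>\<psi> x ^ n * resolvent a\<close> are
  integral, and a denominator of the inverse of the nonzero resolvent clears every power of
  \<open>\<psi> x\<close>.\<close>

lemma A_psi:
  assumes x: "x \<in> A"
  shows "\<psi> x \<in> P.S"
proof -
  \<comment> \<open>The resolvent mixes values of \<phi> in Q(zeta_f) with p-th roots of unity;
    Q(zeta_pf) contains both.\<close>
  interpret N: cyclotomic "p * f" by unfold_locales (use p_pos f_pos in simp)
  have zf: "zeta f = zeta (p * f) ^ p" using zeta_mult_power[OF p_pos] by simp
  have zp: "\<omega> = zeta (p * f) ^ f" using zeta_mult_power[OF f_pos, of p] by (simp add: mult.commute)
  have SN: "S \<subseteq> N.S" "P.S \<subseteq> N.S" "P.K \<subseteq> N.K"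
    unfolding zf zp
    by (intro adjoin_least Ints_subset_sring Rats_subset_sfield N.S_sring N.K_sring N.K_sfield
        sring_power N.z_S N.z_K)+
  obtain a where a: "a \<in> ring_of_integers L" "resolvent a \<noteq> 0" using resolvent_nonzero by blast
  have res: "resolvent b \<in> N.S" if b: "b \<in> ring_of_integers L" for b
    unfolding resolvent_def
  proof (rule sring_sum[OF N.S_sring], rule sring_mult[OF N.S_sring])
    fix g assume g: "g \<in> carrier G"
    show "\<chi> g ^ (p - 1) \<in> N.S" unfolding \<chi>_def using SN(2) P.z_S
      by (intro sring_power N.S_sring) auto
    show "\<phi> (g b) \<in> N.S" using G_ring_of_integers[OF g b] SN(1) by (auto simp: ring_of_integers_iff)
  qed
  have pow: "\<exists>b\<in>ring_of_integers L. resolvent b = \<psi> x ^ n * resolvent a" for n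
  proof (induction n)
    case (Suc n)
    then obtain b where b: "b \<in> ring_of_integers L" "resolvent b = \<psi> x ^ n * resolvent a" by blast
    then have "act x b \<in> ring_of_integers L" using x by (simp add: A_iff)
    moreover have "resolvent (act x b) = \<psi> x ^ Suc n * resolvent a"
      using resolvent_act[OF integers_in_L[OF b(1)]] b(2) by simp
    ultimately show ?case by blast
  qed (use a in auto)
  have "inverse (resolvent a) \<in> N.K"
    using res[OF a(1)] N.S_subset_K by (intro sfield_inverse N.K_sfield) auto
  then obtain M where M: "M > 0" "of_nat M * inverse (resolvent a) \<in> N.S"
    using N.K_denominator by blast
  have "\<psi> x \<in> N.S"
  proof (rule N.integrally_closed[OF _ M(1)])
    show "\<psi> x \<in> N.K" using psi_in_K SN by auto
    fix n
    have "\<psi> x ^ n * resolvent a \<in> N.S" using pow[of n] res by metis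
    then have "of_nat M * inverse (resolvent a) * (\<psi> x ^ n * resolvent a) \<in> N.S"
      by (rule sring_mult[OF N.S_sring M(2)])
    then show "of_nat M * \<psi> x ^ n \<in> N.S" using a(2) by (simp add: field_simps)
  qed
  then show ?thesis using N.S_algebraic_int P.algebraic_int_in_S psi_in_K by blast
qed

section \<open>Determination of the associated order in the two cases\<close>

lemma integral_lift:
  assumes u: "u \<in> P.S"
  shows "\<exists>z\<in>carrier (QG L). (\<forall>g. z g \<in> \<int>) \<and> \<psi> z = u"
proof -
  obtain n where n: "u = (\<Sum>j<p. of_int (n j) * \<omega> ^ j)"
    using Ints_adjoin_root_of_unity[OF P.z_f p_pos u] by blast
  define z where "z = (\<lambda>g. if g \<in> carrier G then of_int (n (idx g)) else (0::rat))"
  have "\<psi> z = (\<Sum>i<p. of_int (n i) * \<omega> ^ i)"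
    unfolding ev_def sum_G by (intro sum.cong refl) (simp add: z_def chi_pow idx_pow sigma)
  then show ?thesis using n by (intro bexI[of _ z]) (auto simp: z_def)
qed

lemma integral_eps:
  assumes "\<And>g. x g \<in> \<int>"
  shows "\<exists>n. \<epsilon> x = of_int n"
proof -
  have "(\<Sum>g\<in>carrier G. x g) \<in> \<int>" using assms by (intro sring_sum[OF sring_Ints])
  then show ?thesis unfolding eps_of_rat by (auto elim!: Ints_cases)
qed

text \<open>An integral lift z of \<open>\<psi> x\<close> differs from x by a constant c on G.
  Comparing \<epsilon> shows that p c is an integer; acting on some y whose trace T is prime to p
  shows that c T is one. By Bezout c is an integer.\<close>

lemma A_integral:
  assumes f: "\<not> p dvd f" and x: "x \<in> A"
  shows "x g \<in> \<int>"
proof -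
  obtain y where y: "y \<in> ring_of_integers L"
    "\<nexists>T. int p dvd T \<and> (\<Sum>g\<in>carrier G. g y) = of_int T"
    using trace_dvd_imp_dvd_conductor f by blast
  obtain T where T: "(\<Sum>g\<in>carrier G. g y) = of_int T" using trace_integral[OF y(1)] by blast
  then have pT: "\<not> int p dvd T" using y(2) by blast
  obtain z where z: "z \<in> carrier (QG L)" "\<And>g. z g \<in> \<int>" "\<psi> z = \<psi> x"
    using integral_lift[OF A_psi[OF x]] by blast
  obtain c where c: "\<And>g. g \<in> carrier G \<Longrightarrow> x g - z g = c"
    using psi_eq_imp_diff_constant[of x z] z(3) by auto
  have zA: "z \<in> A" by (rule A_integral_coeffs[OF z(1,2)])
  have "act x y - act z y = of_rat c * of_int T"
  proof -
    have "act x y - act z y = (\<Sum>g\<in>carrier G. of_rat (x g - z g) * g y)"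
      by (simp add: galois_action_def of_rat_diff left_diff_distrib sum_subtractf)
    also have "\<dots> = of_rat c * (\<Sum>g\<in>carrier G. g y)" by (simp add: c sum_distrib_left cong: sum.cong)
    finally show ?thesis using T by simp
  qed
  moreover have "act x y - act z y \<in> ring_of_integers L"
    using x zA y(1) by (intro sring_diff[OF ring_of_integers_sring]) (auto simp: A_iff)
  ultimately have "(of_rat (c * of_int T) :: 'a) \<in> ring_of_integers L" by (simp add: of_rat_mult)
  then have "(of_rat (c * of_int T) :: 'a) \<in> \<int>" using ring_of_integers_rat by simp
  then obtain m where "(of_rat (c * of_int T) :: 'a) = of_rat (of_int m)"
    by (auto elim: Ints_cases)
  then have m: "c * of_int T = of_int m" by (simp only: of_rat_eq_iff)
  have "\<epsilon> x - \<epsilon> z = (\<Sum>g\<in>carrier G. of_rat (x g - z g))"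
    by (simp add: ev_def of_rat_diff sum_subtractf)
  also have "\<dots> = of_rat (c * of_int (int p))" by (simp add: c card_G of_rat_mult mult.commute)
  finally have "of_rat (c * of_int (int p)) = \<epsilon> x - \<epsilon> z" by simp
  moreover obtain n n' where "\<epsilon> x = of_int n" "\<epsilon> z = of_int n'"
    using A_eps[OF x] A_eps[OF zA] by blast
  ultimately have "(of_rat (c * of_int (int p)) :: complex) = of_rat (of_int (n - n'))"
    by (simp add: of_rat_diff)
  then have k: "c * of_int (int p) = of_int (n - n')" by (simp only: of_rat_eq_iff)
  have "coprime (int p) T" using pT p_prime by (simp add: prime_imp_coprime)
  then obtain a b where "a * int p + b * T = 1" using bezout_int[of "int p" T] by (auto simp: coprime_iff_gcd_eq_1)
  then have "c = c * of_int (a * int p + b * T)" by simp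
  also have "\<dots> = of_int a * (c * of_int (int p)) + of_int b * (c * of_int T)"
    by (simp only: of_int_add of_int_mult) (simp add: algebra_simps)
  also have "\<dots> = of_int (a * (n - n') + b * m)" unfolding m k by simp
  finally have "c \<in> \<int>" by (metis Ints_of_int)
  show ?thesis
  proof (cases "g \<in> carrier G")
    case True
    then have "x g = z g + c" using c[OF True] by simp
    then show ?thesis using z(2) \<open>c \<in> \<int>\<close> by simp
  next
    case False
    then show ?thesis using A_closed[OF x] by simp
  qed
qed

text \<open>Adding a multiple of \<open>e\<^sub>1\<close>, whose coordinates are (1, 0), adjusts
  \<epsilon> without touching \<psi>. It stays in the order because \<open>e\<^sub>1\<close> acts as
  the trace divided by p.\<close>

lemma A_lift_ramified:
  assumes f: "p dvd f" and u: "u \<in> P.S"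
  shows "\<exists>x\<in>A. \<epsilon> x = of_int n \<and> \<psi> x = u"
proof -
  obtain z where z: "z \<in> carrier (QG L)" "\<And>g. z g \<in> \<int>" "\<psi> z = u"
    using integral_lift[OF u] by blast
  obtain m where m: "\<epsilon> z = of_int m" using integral_eps[of z, OF z(2)] by blast
  define w where "w = of_int (n - m) \<odot>\<^bsub>QG L\<^esub> e\<^sub>1"
  have wC: "w \<in> carrier (QG L)" unfolding w_def by (rule smult_closed[OF idempotent_closed])
  have "act w y \<in> ring_of_integers L" if y: "y \<in> ring_of_integers L" for y
  proof -
    obtain T where T: "(\<Sum>g\<in>carrier G. g y) = of_int T" using trace_integral[OF y] by blast
    then obtain k where k: "T = int p * k"
      using dvd_conductor_imp_trace_dvd[OF conductor f y T] by (auto simp: dvd_def)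
    have "act w y = of_rat (of_int (n - m) / of_nat p) * (\<Sum>g\<in>carrier G. g y)"
      unfolding galois_action_def sum_distrib_left
      by (intro sum.cong refl) (simp add: w_def idempotent_eq)
    also have "\<dots> = of_int (n - m) * of_int k"
      using p_pos by (simp add: T k of_rat_divide of_rat_diff)
    also have "\<dots> \<in> ring_of_integers L"
      by (intro sring_mult sring_of_int ring_of_integers_sring)
    finally show ?thesis .
  qed
  then have "w \<in> A" using wC by (simp add: A_iff del: QG_simps)
  then have "z \<oplus>\<^bsub>QG L\<^esub> w \<in> A" using A_integral_coeffs[OF z(1,2)] by (intro A_add)
  moreover have "\<epsilon> (z \<oplus>\<^bsub>QG L\<^esub> w) = of_int n" "\<psi> (z \<oplus>\<^bsub>QG L\<^esub> w) = u"
    unfolding ev_add w_def ev_smult idempotent_values using m z(3) by (simp_all add: of_rat_diff)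
  ultimately show ?thesis by blast
qed

section \<open>Unit groups read off from the coordinates\<close>

lemma psi_rat_alg_hom: "\<psi> \<in> rat_alg_hom (QG L) (sub_alg (cyclotomic_field p))"
  unfolding rat_alg_hom_def Ring.ring_hom_def
  using psi_in_K ev_mult[OF character_chi] ev_add ev_one[OF character_chi] ev_smult
  by (simp add: cyclotomic_field_eq[OF p_pos] Pi_iff del: QG_simps)

lemma psi_sigma: "\<psi> (group_elt \<sigma>) = \<omega>"
  by (simp add: ev_elt sigma chi_sigma)

lemma A_comm_monoid: "comm_monoid ((QG L)\<lparr>carrier := A\<rparr>)"
proof (rule comm_monoidI)
  fix x y assume "x \<in> carrier ((QG L)\<lparr>carrier := A\<rparr>)" "y \<in> carrier ((QG L)\<lparr>carrier := A\<rparr>)"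
  then show "x \<otimes>\<^bsub>(QG L)\<lparr>carrier := A\<rparr>\<^esub> y = y \<otimes>\<^bsub>(QG L)\<lparr>carrier := A\<rparr>\<^esub> x"
    by (simp del: QG_simps add: QG.m_comm A_closed)
qed (simp_all del: QG_simps add: A_mult A_one A_closed QG.m_assoc)

lemma units_A: "x \<in> carrier (associated_order_units L) \<longleftrightarrow> x \<in> A \<and> (\<exists>y\<in>A. x \<otimes>\<^bsub>QG L\<^esub> y = \<one>\<^bsub>QG L\<^esub>)"
  unfolding associated_order_units_def units_of_carrier Units_def
  using QG.m_comm A_closed by (auto simp del: QG_simps)

lemma units_A_mult: "x \<otimes>\<^bsub>associated_order_units L\<^esub> y = x \<otimes>\<^bsub>QG L\<^esub> y"
  by (simp add: associated_order_units_def units_of_mult)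

lemma units_A_one: "\<one>\<^bsub>associated_order_units L\<^esub> = \<one>\<^bsub>QG L\<^esub>"
  by (simp add: associated_order_units_def units_of_one)

lemma units_A_group: "comm_group (associated_order_units L)"
  unfolding associated_order_units_def by (rule comm_monoid.units_comm_group[OF A_comm_monoid])

lemma units_Z: "u \<in> carrier (cyclotomic_units p) \<longleftrightarrow> u \<in> P.S \<and> (\<exists>v\<in>P.S. u * v = 1)"
  by (auto simp: cyclotomic_units_def units_of_carrier Units_def cyclotomic_integers_eq mult.commute)

lemma units_Z_mult: "u \<otimes>\<^bsub>cyclotomic_units p\<^esub> v = u * v"
  by (simp add: cyclotomic_units_def units_of_mult)

lemma units_Z_one: "\<one>\<^bsub>cyclotomic_units p\<^esub> = 1"
  by (simp add: cyclotomic_units_def units_of_one)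

lemma units_Z_group: "comm_group (cyclotomic_units p)"
proof -
  have "comm_monoid (sub_alg (cyclotomic_integers p) :: (rat, complex) module)"
    by (rule comm_monoidI)
      (auto simp: cyclotomic_integers_eq sring_1[OF P.S_sring] sring_mult[OF P.S_sring])
  then show ?thesis unfolding cyclotomic_units_def by (rule comm_monoid.units_comm_group)
qed

lemma unit_values:
  assumes "x \<in> carrier (associated_order_units L)"
  shows "\<epsilon> x = 1 \<or> \<epsilon> x = - 1" "\<psi> x \<in> carrier (cyclotomic_units p)"
proof -
  obtain y where y: "x \<in> A" "y \<in> A" "x \<otimes>\<^bsub>QG L\<^esub> y = \<one>\<^bsub>QG L\<^esub>" using assms units_A by blast
  have e: "\<epsilon> x * \<epsilon> y = 1" "\<psi> x * \<psi> y = 1"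
    using ev_mult[OF character_trivial, of x y] ev_mult[OF character_chi, of x y] y(3)
      ev_one[OF character_trivial] ev_one[OF character_chi] by simp_all
  then show "\<psi> x \<in> carrier (cyclotomic_units p)" using A_psi y units_Z by blast
  obtain n m where nm: "\<epsilon> x = of_int n" "\<epsilon> y = of_int m" using A_eps y by blast
  then have "(of_int (n * m) :: complex) = of_int 1" using e(1) by simp
  then have "n * m = 1" by (simp only: of_int_eq_iff)
  then have "n = 1 \<or> n = - 1" using zmult_eq_1_iff by auto
  then show "\<epsilon> x = 1 \<or> \<epsilon> x = - 1" using nm(1) by auto
qed

lemma psi_hom: "\<psi> \<in> hom (associated_order_units L) (cyclotomic_units p)"
  by (auto simp: hom_def unit_values(2) units_A_mult units_Z_mult ev_mult[OF character_chi])

text \<open>An element of the associated order is determined by \<open>(\<epsilon>, \<psi>)\<close>, so inverses may be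
  found coordinatewise.\<close>

lemma unitI:
  assumes "x \<in> A" "y \<in> A" "\<epsilon> x * \<epsilon> y = 1" "\<psi> x * \<psi> y = 1"
  shows "x \<in> carrier (associated_order_units L)"
proof -
  have "x \<otimes>\<^bsub>QG L\<^esub> y = \<one>\<^bsub>QG L\<^esub>"
    by (rule QG_eqI[OF QG_mult_closed QG.one_closed])
      (simp_all only: ev_mult[OF character_trivial] ev_mult[OF character_chi]
        ev_one[OF character_trivial] ev_one[OF character_chi] assms)
  then show ?thesis using assms units_A by blast
qed

lemma unit_in_A: "x \<in> carrier (associated_order_units L) \<Longrightarrow> x \<in> A"
  using units_A by blast

text \<open>A unit has \<epsilon> equal to 1 or -1, so the kernel of \<psi> has at most the elements
  with coordinates (1, 1) and (-1, 1), the latter being 1 - 2 \<open>e\<^sub>1\<close>. For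
  surjectivity, a unit and its inverse are both lifted with \<epsilon> = 1.\<close>

lemma ramified_exact:
  assumes f: "p dvd f"
  shows "exact_abelian
     ((associated_order_units L)\<lparr>carrier :=
        {\<one>\<^bsub>QG L\<^esub>, \<one>\<^bsub>QG L\<^esub> \<ominus>\<^bsub>QG L\<^esub> 2 \<odot>\<^bsub>QG L\<^esub> e\<^sub>1}\<rparr>)
     (associated_order_units L) (cyclotomic_units p) id \<psi>"
proof -
  let ?B = "associated_order_units L" and ?C = "cyclotomic_units p"
  let ?r = "\<one>\<^bsub>QG L\<^esub> \<ominus>\<^bsub>QG L\<^esub> 2 \<odot>\<^bsub>QG L\<^esub> e\<^sub>1"
  interpret B: comm_group ?B by (rule units_A_group)
  interpret C: comm_group ?C by (rule units_Z_group)
  interpret h: group_hom ?B ?C \<psi>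
    by (intro group_hom.intro group_hom_axioms.intro B.is_group C.is_group psi_hom)
  have rC: "?r \<in> carrier (QG L)"
    by (intro QG.minus_closed QG.one_closed smult_closed idempotent_closed)
  have r: "\<epsilon> ?r = - 1" "\<psi> ?r = 1"
    using ev_minus[OF QG.one_closed smult_closed[OF idempotent_closed]]
    by (simp_all only: ev_smult idempotent_values ev_one[OF character_trivial] ev_one[OF character_chi])
      simp_all
  have oneS: "1 \<in> P.S" by (rule sring_1[OF P.S_sring])
  obtain r' where r': "r' \<in> A" "\<epsilon> r' = of_int (- 1)" "\<psi> r' = 1"
    using A_lift_ramified[OF f oneS, of "- 1"] by blast
  \<comment> \<open>Equal coordinates identify 1 - 2 \<open>e\<^sub>1\<close> with a lift already
    known to lie in the order.\<close>
  have "r' = ?r" using r r' by (intro QG_eqI A_closed rC) simp_all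
  then have rA: "?r \<in> A" using r' by simp
  have ker: "kernel ?B ?C \<psi> = {\<one>\<^bsub>QG L\<^esub>, ?r}"
  proof (intro equalityI subsetI)
    fix x assume "x \<in> kernel ?B ?C \<psi>"
    then have x: "x \<in> carrier ?B" "\<psi> x = 1" by (auto simp: kernel_def units_Z_one)
    have xC: "x \<in> carrier (QG L)" using x(1) unit_in_A A_closed by blast
    consider "\<epsilon> x = 1" | "\<epsilon> x = - 1" using unit_values(1)[OF x(1)] by blast
    then show "x \<in> {\<one>\<^bsub>QG L\<^esub>, ?r}"
    proof cases
      case 1
      have "x = \<one>\<^bsub>QG L\<^esub>"
        by (rule QG_eqI[OF xC QG.one_closed])
          (simp_all only: 1 x ev_one[OF character_trivial] ev_one[OF character_chi])
      then show ?thesis by blast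
    next
      case 2
      have "x = ?r" by (rule QG_eqI[OF xC rC]) (simp_all only: 2 x r)
      then show ?thesis by blast
    qed
  next
    fix x assume "x \<in> {\<one>\<^bsub>QG L\<^esub>, ?r}"
    moreover have "?r \<in> carrier ?B" by (rule unitI[OF rA rA]) (simp_all only: r, simp_all)
    ultimately show "x \<in> kernel ?B ?C \<psi>"
      using r(2) B.one_closed ev_one[OF character_chi]
      unfolding kernel_def units_Z_one units_A_one by blast
  qed
  have sub: "subgroup {\<one>\<^bsub>QG L\<^esub>, ?r} ?B" using h.subgroup_kernel ker by simp
  have "comm_group (?B\<lparr>carrier := {\<one>\<^bsub>QG L\<^esub>, ?r}\<rparr>)"
    by (rule B.subgroup_comm_group[OF sub])
  moreover have "id \<in> mon (?B\<lparr>carrier := {\<one>\<^bsub>QG L\<^esub>, ?r}\<rparr>) ?B"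
    using subgroup.subset[OF sub] unfolding mon_def hom_def by (auto simp del: QG_simps)
  moreover have "\<psi> \<in> epi ?B ?C"
    unfolding epi_def
  proof (intro CollectI conjI psi_hom equalityI subsetI)
    fix u assume u: "u \<in> carrier ?C"
    then obtain v where uv: "u \<in> P.S" "v \<in> P.S" "u * v = 1" using units_Z by blast
    obtain x where x: "x \<in> A" "\<epsilon> x = of_int 1" "\<psi> x = u" using A_lift_ramified[OF f uv(1)] by blast
    obtain y where y: "y \<in> A" "\<epsilon> y = of_int 1" "\<psi> y = v" using A_lift_ramified[OF f uv(2)] by blast
    have "x \<in> carrier ?B" by (rule unitI[OF x(1) y(1)]) (simp_all add: x y uv)
    then show "u \<in> \<psi> ` carrier ?B" using x(3) by blast
  qed (use unit_values(2) in auto)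
  ultimately show ?thesis
    unfolding exact_abelian_def using ker B.comm_group_axioms C.comm_group_axioms by simp
qed

text \<open>Modulo 1 - \<omega> every value of \<chi> is 1, so \<chi> and the trivial character
  agree on integral elements.\<close>

lemma integral_psi_scong_eps:
  assumes x: "\<And>g. x g \<in> \<int>"
  shows "scong P.S (1 - \<omega>) (\<psi> x) (\<epsilon> x)"
proof -
  have c: "of_rat (x g) \<in> P.S" for g
  proof -
    obtain n where "x g = of_int n" using x[of g] by (auto elim: Ints_cases)
    then show ?thesis by (simp add: sring_of_int[OF P.S_sring])
  qed
  have chi: "scong P.S (1 - \<omega>) (\<chi> g) 1" for g
    using P.zeta_scong_1[of 1 "idx g"] by (simp add: \<chi>_def)
  have "\<chi> g \<in> P.S" for g unfolding \<chi>_def by (intro sring_power P.S_sring P.z_S)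
  then show ?thesis
    unfolding ev_def
    by (intro scong_sum[OF P.S_sring] scong_mult[OF P.S_sring scong_refl[OF P.S_sring] chi] c)
qed

lemma scong_int_dvd:
  assumes "scong P.S (1 - \<omega>) (of_int n) (of_int m)"
  shows "int p dvd n - m"
proof -
  have "\<exists>t. scong P.S (of_nat p) ((1 - \<omega>) ^ t) 0"
    using P.prime_element_ramified(4)[OF p_prime, of 1 1] p_gt_1 by simp
  moreover have "scong P.S (1 - \<omega>) (of_int (n - m)) 0" using assms by (simp add: scong_def)
  ultimately show ?thesis using P.scong_int_radical[OF p_prime] by blast
qed

text \<open>With the preceding congruence this describes Z[G] as a fibre product over Z/p. Adding k
  times the sum of G moves \<epsilon> by p k and keeps \<psi>; the congruence guarantees that the
  required shift is a multiple of p.\<close>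

lemma integral_lift_eps:
  assumes u: "u \<in> P.S" "scong P.S (1 - \<omega>) u (of_int s)"
  shows "\<exists>x\<in>A. \<epsilon> x = of_int s \<and> \<psi> x = u"
proof -
  obtain z where z: "z \<in> carrier (QG L)" "\<And>g. z g \<in> \<int>" "\<psi> z = u"
    using integral_lift[OF u(1)] by blast
  obtain m where m: "\<epsilon> z = of_int m" using integral_eps[of z, OF z(2)] by blast
  have "scong P.S (1 - \<omega>) (of_int s) (of_int m)"
    using scong_trans[OF P.S_sring scong_sym[OF P.S_sring u(2)] integral_psi_scong_eps[of z, OF z(2), unfolded z(3) m]] .
  then obtain k where k: "s - m = int p * k" using scong_int_dvd by (auto simp: dvd_def)
  define w where "w = (\<lambda>g. if g \<in> carrier G then of_int k else (0::rat))"
  have evw: "ev v w = of_int k * (\<Sum>g\<in>carrier G. v g)" for v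
    by (simp add: ev_def w_def sum_distrib_left)
  have "z \<oplus>\<^bsub>QG L\<^esub> w \<in> A"
    using z(1,2) by (intro A_integral_coeffs) (auto simp: w_def)
  moreover have "\<epsilon> (z \<oplus>\<^bsub>QG L\<^esub> w) = of_int (m + int p * k)"
    unfolding ev_add evw m by (simp add: card_G mult.commute)
  then have "\<epsilon> (z \<oplus>\<^bsub>QG L\<^esub> w) = of_int s" by (simp flip: k)
  moreover have "\<psi> (z \<oplus>\<^bsub>QG L\<^esub> w) = u"
    unfolding ev_add evw by (simp add: z(3) sum_G chi_pow sum_omega)
  ultimately show ?thesis by blast
qed

lemma U_group_iff:
  "u \<in> carrier (U_group p) \<longleftrightarrow> u \<in> P.S \<and> (\<exists>v\<in>P.S. u * v = 1) \<and>
     (scong P.S (1 - \<omega>) u 1 \<or> scong P.S (1 - \<omega>) u (- 1))"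
  by (auto simp: U_group_def units_Z scong_def cyclotomic_integers_eq)

text \<open>The coefficients are integral here, so \<psi> determines \<epsilon> modulo p; as p > 2,
  this fixes the sign of a unit and gives injectivity.\<close>

lemma unramified_iso:
  assumes f: "\<not> p dvd f"
  shows "\<psi> \<in> iso (associated_order_units L) (U_group p)"
proof -
  let ?B = "associated_order_units L"
  have sc: "scong P.S (1 - \<omega>) (\<psi> x) (\<epsilon> x)" if "x \<in> carrier ?B" for x
    by (rule integral_psi_scong_eps) (rule A_integral[OF f unit_in_A[OF that]])
  have mem: "\<psi> x \<in> carrier (U_group p)" if x: "x \<in> carrier ?B" for x
    using unit_values[OF x] sc[OF x] unfolding U_group_iff units_Z by auto
  have hom: "\<psi> \<in> hom ?B (U_group p)"
    using mem by (auto simp: hom_def units_A_mult ev_mult[OF character_chi] U_group_def units_Z_mult)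
  have "inj_on \<psi> (carrier ?B)"
  proof (rule inj_onI)
    fix x y assume xy: "x \<in> carrier ?B" "y \<in> carrier ?B" "\<psi> x = \<psi> y"
    obtain n m where nm: "n = 1 \<or> n = - 1" "m = 1 \<or> m = - 1" "\<epsilon> x = of_int n" "\<epsilon> y = of_int m"
      using unit_values(1)[OF xy(1)] unit_values(1)[OF xy(2)]
      by (metis of_int_1 of_int_minus)
    have "scong P.S (1 - \<omega>) (\<epsilon> x) (\<epsilon> y)"
      using scong_trans[OF P.S_sring scong_sym[OF P.S_sring sc[OF xy(1)]] sc[OF xy(2), folded xy(3)]] .
    then have "int p dvd n - m" unfolding nm(3,4) by (rule scong_int_dvd)
    moreover have "int p > 2" using p_gt_1 p_odd by (cases "p = 2") auto
    then have "\<not> int p dvd 2" by (auto dest: zdvd_imp_le)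
    ultimately have nm_eq: "n = m" using nm(1,2) by auto
    show "x = y"
      by (rule QG_eqI[OF A_closed[OF unit_in_A[OF xy(1)]] A_closed[OF unit_in_A[OF xy(2)]] _ xy(3)])
        (simp only: nm(3,4) nm_eq)
  qed
  moreover have "carrier (U_group p) \<subseteq> \<psi> ` carrier ?B"
  proof
    fix u assume "u \<in> carrier (U_group p)"
    then obtain v s where uv: "u \<in> P.S" "v \<in> P.S" "u * v = 1" and s: "s = 1 \<or> s = (- 1 :: int)"
      "scong P.S (1 - \<omega>) u (of_int s)"
      unfolding U_group_iff by (metis of_int_1 of_int_minus)
    \<comment> \<open>The inverse v has the same sign as u because s^2 = 1. Hence u and v both lift
      with \<epsilon> = s, and the lifts are mutually inverse in each coordinate.\<close>
    have "scong P.S (1 - \<omega>) v (of_int s)"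
    proof -
      have "scong P.S (1 - \<omega>) (u * (of_int s * v)) (of_int s * (of_int s * v))"
        by (intro scong_mult s scong_refl P.S_sring sring_of_int sring_mult uv)
      moreover have "u * (of_int s * v) = of_int s" using uv(3) by (simp add: mult.left_commute)
      moreover have "of_int s * (of_int s * v) = v" using s(1) by auto
      ultimately show ?thesis using scong_sym[OF P.S_sring] by simp
    qed
    then obtain y where y: "y \<in> A" "\<epsilon> y = of_int s" "\<psi> y = v" using integral_lift_eps uv by blast
    obtain x where x: "x \<in> A" "\<epsilon> x = of_int s" "\<psi> x = u" using integral_lift_eps uv s by blast
    have "x \<in> carrier ?B" by (rule unitI[OF x(1) y(1)]) (use s x y uv in auto)
    then show "u \<in> \<psi> ` carrier ?B" using x(3) by blast
  qed
  ultimately have "bij_betw \<psi> (carrier ?B) (carrier (U_group p))"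
    using mem by (auto simp: bij_betw_def)
  then show ?thesis using hom by (simp add: iso_def)
qed

end

theorem theorem3p2:
  fixes p f :: nat and L :: "'a::field_char_0 set" and \<sigma> :: "'a \<Rightarrow> 'a"
  assumes "Factorial_Ring.prime p" and "odd p"
    and "galois_extension \<rat> L p"
    and "\<sigma> \<in> carrier (galois_group \<rat> L)"
    and "generate (galois_group \<rat> L) {\<sigma>} = carrier (galois_group \<rat> L)"
    and "is_conductor L f"
  shows "(\<not> p dvd f \<longrightarrow>
           (\<exists>\<psi> \<in> rat_alg_hom (QG L) (sub_alg (cyclotomic_field p)).
              \<psi> (group_elt \<sigma>) = zeta p \<and>
              \<psi> \<in> iso (associated_order_units L) (U_group p))) \<and>
         (p dvd f \<longrightarrow>
           (\<exists>\<psi> \<in> rat_alg_hom (QG L) (sub_alg (cyclotomic_field p)).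
              \<psi> (group_elt \<sigma>) = zeta p \<and>
              exact_abelian
                ((associated_order_units L)\<lparr>carrier :=
                   {\<one>\<^bsub>QG L\<^esub>, \<one>\<^bsub>QG L\<^esub> \<ominus>\<^bsub>QG L\<^esub> 2 \<odot>\<^bsub>QG L\<^esub> trivial_idempotent L \<sigma> p}\<rparr>)
                (associated_order_units L) (cyclotomic_units p) id \<psi>))"
proof -
  obtain \<phi> where "\<phi> \<in> Ring.ring_hom (sub_alg L) (sub_alg (cyclotomic_field f))" and "f > 0"
    using assms(6) by (auto simp: is_conductor_def embeds_cyclotomic_def)
  then interpret cyclic_prime_extension p L f \<phi> \<sigma>
    using assms by unfold_locales auto
  show ?thesis
    using psi_rat_alg_hom psi_sigma unramified_iso ramified_exact by blast
qed

end
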